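(* Let $G$ be an abelian group. Then $G$ is $\mathrm{FS}$-regular if and only if $\mathrm{ord}(g)\in O_{\mathrm{FS}}$ for every element $g\in G$ of finite order.
   Context: Multisets: a finite multiset $A$ with elements in a set $X$ is a function $\mu_A:X\to\mathbb Z_{\ge0}$ with finite total sum $|A|=\sum_x\mu_A(x)$; inclusion, union (adding multiplicities), difference, and images $f(A)$ (pushforward, adding multiplicities) are understood in the multiset sense, and subsets of $A$ are counted with multiplicity (so $A$ has $2^{|A|}$ subsets). For a finite multiset $A=\{a_1,\dots,a_k\}$ in an abelian group $G$, $\mathrm{FS}(A)$ is the multiset of the $2^{k}$ sums $\sum_{i\in I}a_i$, $I\subseteq\{1,\dots,k\}$ (with multiplicity). For finite multisets $A,A'$ in $G$, write $A\sim_0 A'$ if there is a sub-multiset $B\subseteq A$ with $\sum_{b\in B}b=0$ such that $A'=(A\setminus B)\cup(-B)$. The group $G$ is $\mathrm{FS}$-regular if for all finite multisets $A,A'$ in $G$: $\mathrm{FS}(A)=\mathrm{FS}(A')$ if and only if $A\sim_0 A'$. $O_{\mathrm{FS}}$ is the set of odd integers $n\ge1$ such that for every $x\in\mathbb Z$ coprime to $n$ there exists $j\ge0$ with $n\mid x-2^j$ or $n\mid x+2^j$. *)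

theory Defs
  imports "HOL-Algebra.Multiplicative_Group" "HOL-Library.Multiset"
begin

text \<open>
  Abelian groups are rendered by the locale \<^locale>\<open>comm_group\<close>, hence in multiplicative
  notation: sums are products, \<open>0\<close> is \<open>\<one>\<close> and \<open>-B\<close> is the image of \<open>B\<close> under the inverse.
\<close>

definition msum :: "('a, 'b) monoid_scheme \<Rightarrow> 'a multiset \<Rightarrow> 'a" where
  "msum G A = (\<Otimes>\<^bsub>G\<^esub>x\<in>set_mset A. x [^]\<^bsub>G\<^esub> count A x)"

text \<open>
  The \<open>k\<close> elements of a multiset \<open>A = {a\<^sub>1, \<dots>, a\<^sub>k}\<close>, distinguished from each other: an element
  of multiplicity \<open>m\<close> contributes the \<open>m\<close> pairs \<open>(x, 0), \<dots>, (x, m - 1)\<close>. This set serves as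
  the index set \<open>{1, \<dots>, k}\<close>, with \<open>a\<^sub>p = fst p\<close>; see \<open>FS_enumeration\<close> below for independence
  of the choice of enumeration.
\<close>

definition copies :: "'a multiset \<Rightarrow> ('a \<times> nat) set" where
  "copies A = (SIGMA x:set_mset A. {..<count A x})"

definition FS :: "('a, 'b) monoid_scheme \<Rightarrow> 'a multiset \<Rightarrow> 'a multiset" where
  "FS G A = image_mset (\<lambda>I. \<Otimes>\<^bsub>G\<^esub>p\<in>I. fst p) (mset_set (Pow (copies A)))"

definition sim0 :: "('a, 'b) monoid_scheme \<Rightarrow> 'a multiset \<Rightarrow> 'a multiset \<Rightarrow> bool" where
  "sim0 G A A' \<longleftrightarrow>
     (\<exists>B. B \<subseteq># A \<and> msum G B = \<one>\<^bsub>G\<^esub> \<and> A' = (A - B) + image_mset (m_inv G) B)"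

definition FS_regular :: "('a, 'b) monoid_scheme \<Rightarrow> bool" where
  "FS_regular G \<longleftrightarrow>
     (\<forall>A A'. set_mset A \<subseteq> carrier G \<longrightarrow> set_mset A' \<subseteq> carrier G \<longrightarrow>
        (FS G A = FS G A' \<longleftrightarrow> sim0 G A A'))"

definition O_FS :: "nat set" where
  "O_FS = {n. n \<ge> 1 \<and> odd n \<and>
     (\<forall>x::int. coprime x (int n) \<longrightarrow> (\<exists>j::nat. int n dvd x - 2 ^ j \<or> int n dvd x + 2 ^ j))}"

lemma finite_copies [simp]: "finite (copies A)"
  by (simp add: copies_def)

lemma card_copies: "card (copies A) = size A"
  by (simp add: copies_def size_multiset_overloaded_eq)

lemma size_FS: "size (FS G A) = 2 ^ size A"
  by (simp add: FS_def card_Pow card_copies)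

lemma count_image_mset_mset_set:
  "finite I \<Longrightarrow> count (image_mset a (mset_set I)) x = card {i \<in> I. a i = x}"
  by (simp add: count_image_mset vimage_def Int_def conj_commute)

lemma msum_enumeration:
  assumes G: "comm_group G" and I: "finite I" and a: "a \<in> I \<rightarrow> carrier G"
  shows "msum G (image_mset a (mset_set I)) = (\<Otimes>\<^bsub>G\<^esub>i\<in>I. a i)"
proof -
  interpret comm_group G by fact
  have "(\<Otimes>\<^bsub>G\<^esub>i\<in>I. a i) = (\<Otimes>\<^bsub>G\<^esub>i\<in>(\<Union>x\<in>a ` I. {i \<in> I. a i = x}). a i)"
    using a by (intro finprod_cong') auto
  also have "\<dots> = (\<Otimes>\<^bsub>G\<^esub>x\<in>a ` I. \<Otimes>\<^bsub>G\<^esub>i\<in>{i \<in> I. a i = x}. a i)"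
    using I a by (intro finprod_UN_disjoint) (auto simp: pairwise_def disjnt_def)
  also have "\<dots> = (\<Otimes>\<^bsub>G\<^esub>x\<in>a ` I. x [^]\<^bsub>G\<^esub> card {i \<in> I. a i = x})"
  proof (intro finprod_cong' refl)
    fix x assume "x \<in> a ` I"
    then have x: "x \<in> carrier G" using a by auto
    have "(\<Otimes>\<^bsub>G\<^esub>i\<in>{i \<in> I. a i = x}. a i) = (\<Otimes>\<^bsub>G\<^esub>i\<in>{i \<in> I. a i = x}. x)"
      using x by (intro finprod_cong') auto
    then show "(\<Otimes>\<^bsub>G\<^esub>i\<in>{i \<in> I. a i = x}. a i) = x [^]\<^bsub>G\<^esub> card {i \<in> I. a i = x}"
      using x by (simp add: finprod_const)
  qed (use a in auto)
  finally show ?thesis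
    using I by (simp add: msum_def count_image_mset_mset_set)
qed

lemma FS_enumeration:
  assumes G: "comm_group G" and I: "finite I" and a: "a \<in> I \<rightarrow> carrier G"
  shows "FS G (image_mset a (mset_set I)) =
           image_mset (\<lambda>J. \<Otimes>\<^bsub>G\<^esub>i\<in>J. a i) (mset_set (Pow I))"
proof -
  interpret comm_group G by fact
  let ?A = "image_mset a (mset_set I)"
  let ?F = "\<lambda>x. {i \<in> I. a i = x}"
  have "\<forall>x. \<exists>h. bij_betw h (?F x) {..<count ?A x}"
  proof
    fix x
    have "card (?F x) = card {..<count ?A x}"
      by (simp only: count_image_mset_mset_set[OF I] card_lessThan)
    then show "\<exists>h. bij_betw h (?F x) {..<count ?A x}"
      by (intro finite_same_card_bij) (use I in simp_all)
  qed
  from choice[OF this] obtain h where h: "\<And>x. bij_betw (h x) (?F x) {..<count ?A x}" by blast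
  define f where "f i = (a i, h (a i) i)" for i
  have inj: "inj_on f I"
  proof (rule inj_onI)
    fix i j assume ij: "i \<in> I" "j \<in> I" "f i = f j"
    then have "a i = a j" "h (a j) i = h (a j) j" by (auto simp: f_def)
    with ij show "i = j" by (intro inj_onD[OF bij_betw_imp_inj_on[OF h[of "a j"]]]) auto
  qed
  have im: "f ` I = copies ?A"
  proof (intro equalityI subsetI)
    fix p assume "p \<in> f ` I"
    then obtain i where i: "i \<in> I" "p = f i" by auto
    have "h (a i) i \<in> h (a i) ` ?F (a i)" using i by blast
    also have "\<dots> = {..<count ?A (a i)}" using h[of "a i"] by (rule bij_betw_imp_surj_on)
    finally show "p \<in> copies ?A" using i I unfolding copies_def f_def by auto
  next
    fix p assume "p \<in> copies ?A"
    then obtain x j where p: "p = (x, j)" "j \<in> {..<count ?A x}"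
      unfolding copies_def by auto
    then have "j \<in> h x ` ?F x" using bij_betw_imp_surj_on[OF h[of x]] by simp
    then show "p \<in> f ` I" using p unfolding f_def by auto
  qed
  have Pow: "Pow (copies ?A) = (`) f ` Pow I"
    using im by (simp add: image_Pow_surj)
  have inj': "inj_on ((`) f) (Pow I)"
    using inj by (rule inj_on_image_Pow)
  have "FS G ?A = image_mset (\<lambda>J. \<Otimes>\<^bsub>G\<^esub>p\<in>f ` J. fst p) (mset_set (Pow I))"
    unfolding FS_def Pow image_mset_mset_set[OF inj', symmetric]
    by (simp add: multiset.map_comp o_def)
  also have "\<dots> = image_mset (\<lambda>J. \<Otimes>\<^bsub>G\<^esub>i\<in>J. a i) (mset_set (Pow I))"
  proof (intro image_mset_cong)
    fix J assume "J \<in># mset_set (Pow I)"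
    then have J: "J \<subseteq> I" using I by simp
    have "(\<Otimes>\<^bsub>G\<^esub>p\<in>f ` J. fst p) = (\<Otimes>\<^bsub>G\<^esub>i\<in>J. fst (f i))"
      using J a inj by (intro finprod_reindex) (auto simp: f_def intro: inj_on_subset)
    then show "(\<Otimes>\<^bsub>G\<^esub>p\<in>f ` J. fst p) = (\<Otimes>\<^bsub>G\<^esub>i\<in>J. a i)" by (simp add: f_def)
  qed
  finally show ?thesis .
qed

end

theory Submission
  imports Defs "HOL-Analysis.Analysis" "HOL-Number_Theory.Number_Theory"
begin

text \<open>
  An equality \<open>FS(A) = FS(A')\<close> says that \<open>\<Prod>(1 + \<phi> a)\<close> over \<open>A\<close> and over \<open>A'\<close> agree for every
  character \<open>\<phi>\<close>. Put \<open>f = \<mu>\<^sub>A - \<mu>\<^sub>A'\<close> and \<open>g(a) = f(a) + f(-a)\<close>; the point is that \<open>g = 0\<close>, after which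
  \<open>B = A \<setminus> A'\<close> witnesses \<open>A \<sim>\<^sub>0 A'\<close>, its sum being killed by a power of two.

  Letting the absolute value of \<open>\<phi>\<close> degenerate handles the elements of infinite order. On those of
  finite order, expand \<open>ln |1 + z| = \<Sum>m. (-1)\<^sup>m\<^sup>+\<^sup>1 Re z\<^sup>m / m\<close> on the unit circle: with
  \<open>h(m) = \<Sum>a. g(a) \<phi>(a)\<^sup>m\<close> the relations for \<open>\<phi>\<close> and its powers become
  \<open>\<Sum>m. (-1)\<^sup>m\<^sup>+\<^sup>1 h(k m) / m = 0\<close> for all \<open>k\<close>, where \<open>h\<close> is even and periodic modulo some
  \<open>N \<in> O\<^sub>F\<^sub>S\<close>. Removing the primes dividing \<open>N\<close> from the summation and decomposing \<open>h\<close> along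
  \<open>k \<mapsto> 2 k\<close> turns this into the vanishing of \<open>(1 - \<psi>(2)) L(1, \<psi>)\<close> for an even Dirichlet character
  \<open>\<psi>\<close> modulo \<open>N\<close>, or of \<open>ln 2 \<Prod>(1 - 1/p)\<close> if \<open>\<psi>\<close> is principal. Since \<open>2\<close> and \<open>-1\<close> generate the units,
  \<open>\<psi>(2) \<noteq> 1\<close> for \<open>\<psi>\<close> not principal, so Dirichlet's \<open>L(1, \<psi>) \<noteq> 0\<close> forces \<open>h = 0\<close>.

  Conversely, if \<open>a\<close> has even order \<open>2 m\<close>, then \<open>{m a, 0}\<close> and \<open>{m a, m a}\<close> have the same subset sums;
  if it has odd order \<open>n\<close> and \<open>x\<close> is a unit modulo \<open>n\<close> other than \<open>\<plusminus>2\<^sup>j\<close>, so do \<open>{2\<^sup>j a}\<close> and \<open>{2\<^sup>j x a}\<close>.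
\<close>

section \<open>Summation by parts and sieving\<close>

lemma summation_by_parts:
  fixes a c :: "nat \<Rightarrow> complex"
  shows "(\<Sum>k<n. a k * c k) =
    a n * (\<Sum>k<n. c k) + (\<Sum>k<n. (a k - a (Suc k)) * (\<Sum>i<Suc k. c i))"
  by (induction n) (simp_all add: algebra_simps)

text \<open>Summation by parts turns the series into one majorised by the telescoping
  \<open>C * (a k - a (Suc k))\<close>. The bound sees only the first weight, which makes it uniform
  for weights depending on a parameter.\<close>

lemma
  fixes a :: "nat \<Rightarrow> real" and c :: "nat \<Rightarrow> complex"
  assumes dec: "decseq a" and lim: "a \<longlonglongrightarrow> 0" and C: "\<And>n. norm (\<Sum>k<n. c k) \<le> C"
  shows summable_Abel: "summable (\<lambda>n. of_real (a n) * c n)"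
    and suminf_Abel_le: "norm (\<Sum>n. of_real (a n) * c n) \<le> C * a 0"
proof -
  define d where "d k = complex_of_real (a k - a (Suc k)) * (\<Sum>i<Suc k. c i)" for k
  have dle: "norm (d k) \<le> C * (a k - a (Suc k))" for k
  proof -
    have "norm (d k) = (a k - a (Suc k)) * norm (\<Sum>i<Suc k. c i)"
      using dec unfolding d_def by (simp only: norm_mult norm_of_real abs_of_nonneg decseq_SucD diff_ge_0_iff_ge)
    also have "\<dots> \<le> (a k - a (Suc k)) * C"
      using dec C[of "Suc k"] by (intro mult_left_mono) (auto simp: decseq_SucD)
    finally show ?thesis by (simp add: mult.commute)
  qed
  have tel: "(\<lambda>k. C * (a k - a (Suc k))) sums (C * (a 0 - 0))"
    by (intro sums_mult telescope_sums' lim)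
  have sd: "summable (\<lambda>k. norm (d k))"
    using dle by (intro summable_comparison_test'[OF sums_summable[OF tel], of 0]) auto
  have nd: "norm (suminf d) \<le> C * a 0"
  proof -
    have "norm (suminf d) \<le> (\<Sum>k. norm (d k))" using sd by (rule summable_norm)
    also have "\<dots> \<le> (\<Sum>k. C * (a k - a (Suc k)))"
      using sd tel dle by (intro suminf_le) (auto simp: sums_iff)
    finally show ?thesis using tel by (simp add: sums_iff)
  qed
  have z: "(\<lambda>n. complex_of_real (a n) * (\<Sum>k<n. c k)) \<longlonglongrightarrow> 0"
  proof (rule Lim_null_comparison)
    show "\<forall>\<^sub>F n in sequentially. norm (complex_of_real (a n) * (\<Sum>k<n. c k)) \<le> \<bar>a n\<bar> * C"
      using C by (intro always_eventually) (auto simp: norm_mult intro!: mult_left_mono)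
    show "(\<lambda>n. \<bar>a n\<bar> * C) \<longlonglongrightarrow> 0"
      using tendsto_mult_right[OF tendsto_rabs[OF lim], of C] by simp
  qed
  have "(\<lambda>n. \<Sum>k<n. d k) \<longlonglongrightarrow> suminf d"
    using summable_LIMSEQ summable_norm_cancel sd by blast
  from tendsto_add[OF z this] have "(\<lambda>n. \<Sum>k<n. of_real (a k) * c k) \<longlonglongrightarrow> suminf d"
    by (simp only: summation_by_parts[of "\<lambda>k. of_real (a k)" c] d_def of_real_diff add_0)
  then have S: "(\<lambda>n. of_real (a n) * c n) sums suminf d" by (simp add: sums_def)
  then show "summable (\<lambda>n. of_real (a n) * c n)" by (simp add: sums_iff)
  show "norm (\<Sum>n. of_real (a n) * c n) \<le> C * a 0" using S nd by (simp add: sums_iff)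
qed

text \<open>Full periods cancel, and fewer than \<open>N\<close> terms of norm at most 1
  remain.\<close>

lemma norm_sum_periodic_le:
  fixes c :: "nat \<Rightarrow> complex"
  assumes N: "N > 0" and per: "\<And>n. c (n + N) = c n" and z: "(\<Sum>k<N. c k) = 0"
    and c: "\<And>n. norm (c n) \<le> 1"
  shows "norm (\<Sum>k<n. c k) \<le> real N"
proof (induction n rule: less_induct)
  case (less n)
  show ?case
  proof (cases "n < N")
    case True
    have "norm (\<Sum>k<n. c k) \<le> (\<Sum>k<n. 1)" by (intro sum_norm_le c)
    then show ?thesis using True by simp
  next
    case False
    have split: "(\<Sum>k<N + j. c k) = (\<Sum>k<N. c k) + (\<Sum>k<j. c (N + k))" for j
      by (induction j) (simp_all add: add.assoc)
    have "(\<Sum>k<n. c k) = (\<Sum>k<N + (n - N). c k)" using False by simp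
    also have "\<dots> = (\<Sum>k<N. c k) + (\<Sum>k<n - N. c (N + k))" by (rule split)
    also have "\<dots> = (\<Sum>k<n - N. c k)" using z per by (simp add: add.commute)
    finally show ?thesis using less.IH[of "n - N"] False N by simp
  qed
qed

section \<open>The logarithm series on the unit circle\<close>

lemma decseq_inverse_Suc: "decseq (\<lambda>n. 1 / real (Suc n))"
  by (auto simp: decseq_def field_simps)

text \<open>Abel's limit theorem made quantitative: the sums at radius 1 and at radius
  \<open>x\<close> differ by at most \<open>C * (1 - x)\<close>, where \<open>C\<close> bounds
  geometric partial sums. The term \<open>m = 0\<close> is a division by zero, hence 0.\<close>

lemma Ln_series_unit_circle:
  assumes z: "norm z = 1" "z \<noteq> - 1"
  shows "(\<lambda>m. (- 1) ^ (m + 1) * z ^ m / of_nat m) sums Ln (1 + z)"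
proof -
  define c where "c k = z * (- z) ^ k" for k
  define C where "C = 2 / norm (1 + z)"
  have nz: "1 + z \<noteq> 0" using z(2) by (metis add.commute add_eq_0_iff)
  have C: "norm (\<Sum>k<n. c k) \<le> C" for n
  proof -
    have "(\<Sum>k<n. c k) = z * (1 - (- z) ^ n) / (1 + z)"
      using nz z(2) by (simp add: c_def sum_distrib_left[symmetric] sum_gp_strict minus_equation_iff[of z])
    also have "norm \<dots> \<le> C" unfolding C_def
      using z(1) norm_triangle_ineq4[of 1 "(-z)^n"] nz
      by (simp add: norm_divide norm_mult norm_power divide_right_mono)
    finally show ?thesis .
  qed
  define S where "S = (\<Sum>n. of_real (1 / real (Suc n)) * c n)"
  have sum1: "summable (\<lambda>n. of_real (1 / real (Suc n)) * c n)"
    using decseq_inverse_Suc LIMSEQ_Suc[OF lim_1_over_n] C by (rule summable_Abel)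
  define g where "g x = Ln (1 + of_real x * z)" for x :: real
  have diff: "norm (S - g x) \<le> C * (1 - x)" if x: "0 < x" "x < 1" for x
  proof -
    define a where "a n = (1 - x ^ Suc n) / real (Suc n)" for n
    have "a (Suc n) \<le> a n" for n
    proof -
      \<comment> \<open>Up to the factor \<open>1 - x\<close> this is the mean of
        \<open>1, x, \<dots>, x ^ n\<close>, and means of a decreasing sequence decrease.\<close>
      have *: "a n = (1 - x) * (\<Sum>i<Suc n. x ^ i) / real (Suc n)" for n
        unfolding a_def using one_diff_power_eq[of x "Suc n"] by simp
      have "real (Suc n) * x ^ Suc n \<le> (\<Sum>i<Suc n. x ^ i)"
      proof -
        have "(\<Sum>i<Suc n. x ^ Suc n) \<le> (\<Sum>i<Suc n. x ^ i)"
          using x by (intro sum_mono power_decreasing) auto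
        then show ?thesis by simp
      qed
      then have "(\<Sum>i<Suc (Suc n). x ^ i) * real (Suc n) \<le> (\<Sum>i<Suc n. x ^ i) * real (Suc (Suc n))"
        by (simp add: algebra_simps)
      then have "(\<Sum>i<Suc (Suc n). x ^ i) / real (Suc (Suc n)) \<le> (\<Sum>i<Suc n. x ^ i) / real (Suc n)"
        by (simp only: pos_divide_le_eq pos_le_divide_eq of_nat_0_less_iff zero_less_Suc times_divide_eq_left)
      then show ?thesis unfolding * using x
        by (simp only: times_divide_eq_right[symmetric]) (intro mult_left_mono, auto)
    qed
    then have dec: "decseq a" by (rule decseq_SucI)
    have "(\<lambda>n. x ^ Suc n) \<longlonglongrightarrow> 0" using x by (intro LIMSEQ_Suc LIMSEQ_realpow_zero) auto
    from tendsto_mult[OF tendsto_diff[OF tendsto_const[of 1] this] LIMSEQ_Suc[OF lim_1_over_n]]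
    have lim: "a \<longlonglongrightarrow> 0" unfolding a_def by simp
    have "norm (of_real x * z) < 1" using x z by (simp add: norm_mult)
    from Ln_series[OF this] have "(\<lambda>n. (- 1) ^ Suc n / of_nat n * (of_real x * z) ^ n) sums g x"
      by (simp add: g_def)
    then have "(\<lambda>n. (- 1) ^ Suc (Suc n) / of_nat (Suc n) * (of_real x * z) ^ Suc n) sums g x"
      by (subst sums_Suc_iff) simp
    moreover have "(- 1) ^ Suc (Suc n) / of_nat (Suc n) * (of_real x * z) ^ Suc n
       = of_real (x ^ Suc n / real (Suc n)) * c n" for n
      by (simp add: c_def power_mult_distrib power_minus[of z])
    ultimately have g: "(\<lambda>n. of_real (x ^ Suc n / real (Suc n)) * c n) sums g x"
      by (simp only:)
    have "(\<lambda>n. of_real (1 / real (Suc n)) * c n - of_real (x ^ Suc n / real (Suc n)) * c n) sums (S - g x)"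
      using g sum1 unfolding S_def by (intro sums_diff) auto
    also have "(\<lambda>n. of_real (1 / real (Suc n)) * c n - of_real (x ^ Suc n / real (Suc n)) * c n)
        = (\<lambda>n. of_real (a n) * c n)"
      by (rule ext) (simp only: a_def diff_divide_distrib of_real_diff left_diff_distrib)
    finally show ?thesis using suminf_Abel_le[OF dec lim C] by (simp add: sums_iff a_def)
  qed
  have notneg: "1 + z \<notin> \<real>\<^sub>\<le>\<^sub>0"
  proof
    assume "1 + z \<in> \<real>\<^sub>\<le>\<^sub>0"
    then have "Im z = 0" "Re z \<le> -1" by (auto simp: complex_nonpos_Reals_iff)
    moreover have "Re z \<ge> -1" using abs_Re_le_cmod[of z] z by simp
    ultimately show False using z(2) by (simp add: complex_eq_iff)
  qed
  have lim1: "(g \<longlongrightarrow> g 1) (at_left 1)"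
    unfolding g_def using notneg by (intro tendsto_intros) auto
  have "((\<lambda>x. S - g x) \<longlongrightarrow> 0) (at_left 1)"
  proof (rule Lim_null_comparison)
    show "\<forall>\<^sub>F x in at_left 1. norm (S - g x) \<le> C * (1 - x)"
      using eventually_at_left_real[OF zero_less_one] by eventually_elim (use diff in auto)
    show "((\<lambda>x. C * (1 - x)) \<longlongrightarrow> 0) (at_left 1)" by (auto intro!: tendsto_eq_intros)
  qed
  from tendsto_unique[OF _ this tendsto_diff[OF tendsto_const lim1]] have "S = g 1" by auto
  then have "(\<lambda>n. of_real (1 / real (Suc n)) * c n) sums Ln (1 + z)"
    using sum1 unfolding S_def g_def by (simp add: sums_iff)
  moreover have "(\<lambda>n. of_real (1 / real (Suc n)) * c n) = (\<lambda>n. (- 1) ^ (Suc n + 1) * z ^ Suc n / of_nat (Suc n))"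
    by (rule ext) (simp add: c_def power_minus[of z])
  ultimately show ?thesis using sums_Suc_iff[of "\<lambda>m. (- 1) ^ (m + 1) * z ^ m / of_nat m"] by simp
qed

text \<open>The terms with \<open>p dvd m\<close> are those at \<open>p * m\<close>. Since
  \<open>p\<close> is a prime outside \<open>P\<close>, passing from \<open>m\<close> to
  \<open>p * m\<close> does not affect divisibility by the primes of \<open>P\<close>.\<close>

lemma sums_remove_prime:
  fixes w :: "nat \<Rightarrow> complex"
  assumes p: "prime p" "p \<notin> P" and P: "\<And>q. q \<in> P \<Longrightarrow> prime q"
    and s: "(\<lambda>m. if \<forall>q\<in>P. \<not> q dvd m then w m else 0) sums s"
    and s': "(\<lambda>m. if \<forall>q\<in>P. \<not> q dvd m then w (p * m) else 0) sums s'"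
  shows "(\<lambda>m. if \<forall>q\<in>insert p P. \<not> q dvd m then w m else 0) sums (s - s')"
proof -
  define f where "f m = (if p dvd m \<and> (\<forall>q\<in>P. \<not> q dvd m) then w m else 0)" for m
  have "p > 0" using p prime_gt_0_nat by blast
  have dvd: "q dvd p * m \<longleftrightarrow> q dvd m" if "q \<in> P" for q m
    using that P p primes_dvd_imp_eq prime_dvd_mult_iff by metis
  have "f sums s'"
  proof (rule iffD1[OF sums_mono_reindex[of "\<lambda>m. p * m"]])
    show "strict_mono (\<lambda>m. p * m)" using \<open>p > 0\<close> by (intro strict_monoI) auto
    show "f n = 0" if "n \<notin> range ((*) p)" for n using that by (auto simp: f_def elim!: dvdE)
    have "(\<lambda>n. f (p * n)) = (\<lambda>m. if \<forall>q\<in>P. \<not> q dvd m then w (p * m) else 0)"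
      by (rule ext) (auto simp: f_def dvd)
    then show "(\<lambda>n. f (p * n)) sums s'" using s' by simp
  qed
  from sums_diff[OF s this] show ?thesis
    by (rule back_subst[of "\<lambda>g. g sums (s - s')"]) (auto simp: f_def fun_eq_iff)
qed

text \<open>Terms divisible by \<open>p\<close> form a copy of the series scaled by
  \<open>c p\<close>, so sieving by \<open>p\<close> multiplies the sum by an inverse Euler
  factor.\<close>

lemma sums_sieve:
  fixes w :: "nat \<Rightarrow> complex"
  assumes "finite P" and P: "\<And>q. q \<in> P \<Longrightarrow> prime q"
    and mult: "\<And>p m. p \<in> P \<Longrightarrow> w (p * m) = c p * w m" and s: "w sums s"
  shows "(\<lambda>m. if \<forall>q\<in>P. \<not> q dvd m then w m else 0) sums (s * (\<Prod>p\<in>P. 1 - c p))"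
  using \<open>finite P\<close> P mult
proof (induction P rule: finite_induct)
  case empty
  then show ?case using s by simp
next
  case (insert p P)
  let ?s = "s * (\<Prod>p\<in>P. 1 - c p)"
  have IH: "(\<lambda>m. if \<forall>q\<in>P. \<not> q dvd m then w m else 0) sums ?s"
    using insert by auto
  from sums_mult[OF this, of "c p"]
  have "(\<lambda>m. if \<forall>q\<in>P. \<not> q dvd m then w (p * m) else 0) sums (c p * ?s)"
    by (rule back_subst[of "\<lambda>g. g sums _"]) (auto simp: insert fun_eq_iff)
  from sums_remove_prime[OF _ _ _ IH this] insert
  have "(\<lambda>m. if \<forall>q\<in>insert p P. \<not> q dvd m then w m else 0) sums (?s - c p * ?s)" by blast
  then show ?case using insert by (simp add: algebra_simps)
qed

section \<open>Nonvanishing at 1: complex characters\<close>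

locale completely_multiplicative =
  fixes \<psi> :: "nat \<Rightarrow> complex"
  assumes mult: "\<psi> (m * n) = \<psi> m * \<psi> n" and one: "\<psi> 1 = 1"
    and norm_cases: "norm (\<psi> m) = 0 \<or> norm (\<psi> m) = 1"
begin

lemma norm_le_1: "norm (\<psi> m) \<le> 1"
  using norm_cases[of m] by auto

text \<open>The Dirichlet series at a real point. Starting at \<open>m = 0\<close> is harmless since
  \<open>0 powr - s = 0\<close>, whatever \<open>\<psi> 0\<close> is.\<close>

definition L :: "real \<Rightarrow> complex" where
  "L s = (\<Sum>m. \<psi> m * of_real (real m powr - s))"

lemma
  assumes "s > 1"
  shows summable_norm_L: "summable (\<lambda>m. norm (\<psi> m * of_real (real m powr - s)))"
    and L_sums: "(\<lambda>m. \<psi> m * of_real (real m powr - s)) sums L s"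
proof -
  show *: "summable (\<lambda>m. norm (\<psi> m * of_real (real m powr - s)))"
  proof (rule summable_comparison_test')
    show "summable (\<lambda>m. real m powr - s)" using assms by (simp add: summable_real_powr_iff)
    show "norm (norm (\<psi> m * of_real (real m powr - s))) \<le> real m powr - s" for m
      using norm_le_1[of m] by (simp add: norm_mult mult_left_le_one_le)
  qed
  show "(\<lambda>m. \<psi> m * of_real (real m powr - s)) sums L s"
    unfolding L_def using summable_norm_cancel[OF *] by (rule summable_sums)
qed

lemma L_sums_Suc:
  assumes "s > 1"
  shows "(\<lambda>n. \<psi> (Suc n) * of_real (real (Suc n) powr - s)) sums L s"
  using L_sums[OF assms] sums_Suc_iff[of "\<lambda>m. \<psi> m * of_real (real m powr - s)" "L s"] by simp

text \<open>Sieving the primes up to \<open>K\<close> leaves 1 and terms beyond \<open>K\<close>,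
  part of the tail of an absolutely convergent series. Multiplying \<open>L s\<close> by a finite
  product avoids inverses and infinite products.\<close>

lemma Euler_product:
  assumes s: "s > 1"
  shows "(\<lambda>K. L s * (\<Prod>p | prime p \<and> p \<le> K. 1 - \<psi> p * of_real (real p powr - s))) \<longlonglongrightarrow> 1"
proof -
  define w where "w m = \<psi> m * of_real (real m powr - s)" for m
  define E where "E K = (\<Prod>p | prime p \<and> p \<le> K. 1 - \<psi> p * of_real (real p powr - s))" for K
  have sw: "summable (\<lambda>m. norm (w m))" using summable_norm_L[OF s] by (simp add: w_def)
  define R where "R K = (\<Sum>m. norm (w (m + Suc K)))" for K
  have R: "R \<longlonglongrightarrow> 0"
  proof -
    have "R K = (\<Sum>m. norm (w m)) - (\<Sum>m<Suc K. norm (w m))" for K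
      unfolding R_def by (rule suminf_minus_initial_segment[OF sw])
    moreover have "(\<lambda>K. (\<Sum>m. norm (w m)) - (\<Sum>m<Suc K. norm (w m))) \<longlonglongrightarrow> 0"
      using tendsto_diff[OF tendsto_const LIMSEQ_Suc[OF summable_LIMSEQ[OF sw]], of "\<Sum>m. norm (w m)"]
      by simp
    ultimately show ?thesis by presburger
  qed
  have le: "norm (L s * E K - 1) \<le> R K" if "K \<ge> 1" for K
  proof -
    define v where "v m = (if \<forall>q\<in>{p. prime p \<and> p \<le> K}. \<not> q dvd m then w m else 0)" for m
    have "finite {p::nat. prime p \<and> p \<le> K}" by (rule finite_subset[of _ "{..K}"]) auto
    moreover have "w sums L s" unfolding w_def by (rule L_sums[OF s])
    moreover have "w (p * m) = (\<psi> p * of_real (real p powr - s)) * w m" for p m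
      by (simp add: w_def mult powr_mult)
    ultimately have v: "v sums (L s * E K)"
      unfolding v_def E_def by (intro sums_sieve) auto
    \<comment> \<open>Every \<open>i\<close> with \<open>2 \<le> i \<le> K\<close> has a prime
      divisor at most \<open>K\<close>, and \<open>w 0 = 0\<close>.\<close>
    have "(\<Sum>i<Suc K. v i) = (\<Sum>i\<in>{1}. v i)"
    proof (rule sum.mono_neutral_right)
      show "\<forall>i\<in>{..<Suc K} - {1}. v i = 0"
      proof
        fix i assume i: "i \<in> {..<Suc K} - {1}"
        show "v i = 0"
        proof (cases "i = 0")
          case True then show ?thesis by (simp add: v_def w_def)
        next
          case False
          then obtain q where q: "prime q" "q dvd i" using i prime_factor_nat[of i] by auto
          then have "q \<le> K" using False i dvd_imp_le[of q i] by auto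
          then show ?thesis using q by (auto simp: v_def)
        qed
      qed
    qed (use that in auto)
    also have "\<dots> = 1" using one by (auto simp: v_def w_def)
    finally have tail: "(\<lambda>n. v (n + Suc K)) sums (L s * E K - 1)"
      using sums_split_initial_segment[OF v, of "Suc K"] by simp
    have sn: "summable (\<lambda>m. norm (w (m + Suc K)))" using summable_ignore_initial_segment[OF sw] .
    have vw: "norm (v m) \<le> norm (w m)" for m by (simp add: v_def)
    have "norm (\<Sum>n. v (n + Suc K)) \<le> R K"
      unfolding R_def by (intro norm_suminf_le sn vw)
    then show ?thesis using tail by (simp add: sums_iff)
  qed
  have "(\<lambda>K. L s * E K - 1) \<longlonglongrightarrow> 0"
    by (rule Lim_null_comparison[OF _ R]) (use le in \<open>auto simp: eventually_sequentially\<close>)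
  from LIM_zero_cancel[OF this] show ?thesis unfolding E_def .
qed

lemma L_bounded:
  assumes s: "s > 1" and C: "\<And>n. norm (\<Sum>k<n. \<psi> (Suc k)) \<le> C"
  shows "norm (L s) \<le> C"
proof -
  define a where "a n = real (Suc n) powr - s" for n
  have "decseq a" using s by (intro decseq_SucI) (auto simp: a_def intro!: powr_mono2')
  moreover have "a \<longlonglongrightarrow> 0" unfolding a_def
    using s by (intro tendsto_neg_powr filterlim_compose[OF filterlim_real_sequentially filterlim_Suc]) auto
  ultimately have "norm (\<Sum>n. of_real (a n) * \<psi> (Suc n)) \<le> C * a 0" using C by (rule suminf_Abel_le)
  moreover have "(\<lambda>n. of_real (a n) * \<psi> (Suc n)) sums L s"
    using L_sums_Suc[OF s] by (simp add: a_def mult.commute)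
  ultimately show ?thesis by (simp add: sums_iff a_def)
qed

text \<open>The weights \<open>s / m - m\<^sup>-\<^sup>s\<close> decrease from \<open>s - 1\<close> to \<open>0\<close>, unlike \<open>1 / m - m\<^sup>-\<^sup>s\<close>.\<close>
lemma L_le_near_1:
  assumes s: "s > 1" and C: "\<And>n. norm (\<Sum>k<n. \<psi> (Suc k)) \<le> C"
    and z: "(\<lambda>m. \<psi> m / of_nat m) sums 0"
  shows "norm (L s) \<le> C * (s - 1)"
proof -
  define a where "a n = s / real (Suc n) - real (Suc n) powr - s" for n
  have "a (Suc n) \<le> a n" for n
  proof -
    have "s / real (Suc (Suc n)) - real (Suc (Suc n)) powr - s \<le> s / real (Suc n) - real (Suc n) powr - s"
    proof (rule DERIV_nonpos_imp_nonincreasing[where f = "\<lambda>x. s / x - x powr - s"])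
      fix x assume x: "real (Suc n) \<le> x" "x \<le> real (Suc (Suc n))"
      then have x1: "x \<ge> 1" by linarith
      have "x powr (- s - 1) \<le> x powr (- 2)" using x1 s by (intro powr_mono) auto
      also have "\<dots> = 1 / x^2" using x1 by (simp add: powr_minus powr_numeral divide_inverse)
      finally have "s * x powr (- s - 1) - s / x^2 \<le> 0" using s by (simp add: mult_left_mono[of _ "1/x^2" s, simplified])
      moreover have "((\<lambda>x. s / x - x powr - s) has_real_derivative (s * x powr (- s - 1) - s / x^2)) (at x)"
        using x1 by (auto intro!: derivative_eq_intros simp: power2_eq_square)
      ultimately show "\<exists>y. ((\<lambda>x. s / x - x powr - s) has_real_derivative y) (at x) \<and> y \<le> 0" by blast
    qed auto
    then show ?thesis by (simp add: a_def)
  qed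
  then have dec: "decseq a" by (rule decseq_SucI)
  have "(\<lambda>n. real (Suc n) powr - s) \<longlonglongrightarrow> 0"
    using s by (intro tendsto_neg_powr filterlim_compose[OF filterlim_real_sequentially filterlim_Suc]) auto
  from tendsto_diff[OF tendsto_mult[OF tendsto_const[of s] LIMSEQ_Suc[OF lim_1_over_n]] this]
  have lim: "a \<longlonglongrightarrow> 0" unfolding a_def by simp
  have "(\<lambda>n. \<psi> (Suc n) * of_real (real (Suc n) powr - s)) sums L s"
    by (rule L_sums_Suc[OF s])
  \<comment> \<open>As the series at 1 vanishes, the weights \<open>s / m\<close> can be added for
    free, so the Abel sum with weights \<open>a\<close> is \<open>- L s\<close>; the first weight is
    \<open>s - 1\<close>.\<close>
  moreover have "(\<lambda>n. of_real s * (\<psi> (Suc n) / of_nat (Suc n))) sums (of_real s * 0)"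
    using z sums_Suc_iff[of "\<lambda>m. \<psi> m / of_nat m" 0] by (intro sums_mult) simp
  ultimately have "(\<lambda>n. of_real s * (\<psi> (Suc n) / of_nat (Suc n)) - \<psi> (Suc n) * of_real (real (Suc n) powr - s))
     sums (of_real s * 0 - L s)" by (intro sums_diff)
  also have "(\<lambda>n. of_real s * (\<psi> (Suc n) / of_nat (Suc n)) - \<psi> (Suc n) * of_real (real (Suc n) powr - s))
      = (\<lambda>n. of_real (a n) * \<psi> (Suc n))"
    by (rule ext) (simp add: a_def algebra_simps)
  finally show ?thesis using suminf_Abel_le[OF dec lim C] by (simp add: sums_iff a_def)
qed

end

section \<open>The pole of zeta at 1 and the 3-4-1 inequality\<close>

lemma zeta_le:
  assumes s: "s > 1"
  shows "(\<Sum>m. real m powr - s) \<le> s / (s - 1)"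
proof -
  \<comment> \<open>An antiderivative of \<open>x powr - s\<close> at \<open>Suc n\<close>,
    vanishing at infinity. Each term from \<open>m = 2\<close> on is at most an increment of
    \<open>g\<close>, and these telescope to \<open>1 / (s - 1)\<close>.\<close>
  define g where "g n = - (real (Suc n) powr (1 - s)) / (s - 1)" for n
  have step: "real (Suc (Suc n)) powr - s \<le> g (Suc n) - g n" for n
  proof -
    obtain x where x: "real (Suc n) < x" "x < real (Suc (Suc n))"
      "- (real (Suc (Suc n)) powr (1 - s)) / (s - 1) - - (real (Suc n) powr (1 - s)) / (s - 1)
        = (real (Suc (Suc n)) - real (Suc n)) * x powr - s"
    proof (rule MVT2[of "real (Suc n)" "real (Suc (Suc n))" "\<lambda>x. - (x powr (1 - s)) / (s - 1)" "\<lambda>x. x powr - s", THEN exE])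
      fix x assume "real (Suc n) \<le> x" "x \<le> real (Suc (Suc n))"
      then have "x > 0" by linarith
      from DERIV_cdivide[OF DERIV_minus[OF has_real_derivative_powr[OF this]]]
      have "((\<lambda>x. - (x powr (1 - s)) / (s - 1)) has_real_derivative
              - ((1 - s) * x powr (1 - s - 1)) / (s - 1)) (at x)" .
      also have "- ((1 - s) * x powr (1 - s - 1)) / (s - 1) = x powr - s"
        using s by (simp add: divide_eq_eq algebra_simps)
      finally show "((\<lambda>x. - (x powr (1 - s)) / (s - 1)) has_real_derivative x powr - s) (at x)" .
    qed auto
    have "real (Suc (Suc n)) powr - s \<le> x powr - s" using x s by (intro powr_mono2') auto
    then show ?thesis using x(3) by (simp add: g_def)
  qed
  have "(\<lambda>n. real (Suc n) powr (1 - s)) \<longlonglongrightarrow> 0"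
    using s by (intro tendsto_neg_powr filterlim_compose[OF filterlim_real_sequentially filterlim_Suc]) auto
  from tendsto_divide[OF tendsto_minus[OF this] tendsto_const, of "s - 1"]
  have "g \<longlonglongrightarrow> 0" using s unfolding g_def by simp
  from telescope_sums[OF this] have tel: "(\<lambda>n. g (Suc n) - g n) sums (1 / (s - 1))" by (simp add: g_def)
  have sm: "summable (\<lambda>m. real m powr - s)" using s by (simp add: summable_real_powr_iff)
  then have sm2: "summable (\<lambda>m. real (m + 2) powr - s)" by (rule summable_ignore_initial_segment)
  have "(\<Sum>m. real m powr - s) = (\<Sum>m. real (m + 2) powr - s) + (\<Sum>m<2. real m powr - s)"
    by (rule suminf_split_initial_segment[OF sm])
  also have "(\<Sum>m<2. real m powr - s) = 1" by (simp add: numeral_2_eq_2)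
  also have "(\<Sum>m. real (m + 2) powr - s) \<le> (\<Sum>n. g (Suc n) - g n)"
    using step sm2 tel by (intro suminf_le) (auto simp: sums_iff)
  also have "\<dots> = 1 / (s - 1)" using tel by (simp add: sums_iff)
  finally show ?thesis using s by (simp add: field_simps)
qed

text \<open>The inequality \<open>3 + 4 cos \<theta> + cos 2\<theta> \<ge> 0\<close>, exponentiated.\<close>

lemma norm_341_le_1:
  fixes z :: complex
  assumes t: "0 \<le> t" "t < 1" and z: "norm z = 1"
  shows "norm (1 - complex_of_real t) ^ 3 * norm (1 - z * of_real t) ^ 4 * norm (1 - z\<^sup>2 * of_real t) \<le> 1"
proof -
  have ser: "(\<lambda>n. - Re (w ^ n) / real n) sums ln (norm (1 - w))" if "norm w < 1" for w :: complex
  proof -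
    have "(\<lambda>n. - (w ^ n) / of_nat n) sums Ln (1 - w)" using Ln_series'[of "- w"] that by simp
    from sums_Re[OF this] have "(\<lambda>n. Re (- (w ^ n) / of_nat n)) sums Re (Ln (1 - w))" .
    moreover have "w \<noteq> 1" using that by auto
    ultimately show ?thesis by (simp add: Re_divide_of_nat)
  qed
  let ?a = "complex_of_real t" let ?b = "z * of_real t" let ?c = "z\<^sup>2 * of_real t"
  have n: "norm ?a < 1" "norm ?b < 1" "norm ?c < 1" using t z by (auto simp: norm_mult norm_power)
  have sums: "(\<lambda>n. 3 * (- Re (?a ^ n) / real n) + 4 * (- Re (?b ^ n) / real n) + - Re (?c ^ n) / real n)
     sums (3 * ln (norm (1 - ?a)) + 4 * ln (norm (1 - ?b)) + ln (norm (1 - ?c)))"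
    by (intro sums_add sums_mult ser n)
  have nonpos: "3 * (- Re (?a ^ n) / real n) + 4 * (- Re (?b ^ n) / real n) + - Re (?c ^ n) / real n \<le> 0" for n
  proof -
    define u where "u = z ^ n"
    have "norm u = 1" using z by (simp add: u_def norm_power)
    then have "(Re u)\<^sup>2 + (Im u)\<^sup>2 = 1" by (simp add: cmod_power2[symmetric])
    then have Re2: "Re (u\<^sup>2) = 2 * (Re u)\<^sup>2 - 1" by (simp add: power2_eq_square)
    have "3 * Re (?a ^ n) + 4 * Re (?b ^ n) + Re (?c ^ n) = t ^ n * (3 + 4 * Re u + Re (u\<^sup>2))"
      by (simp add: power_mult_distrib u_def power_mult[symmetric] mult.commute[of 2] algebra_simps
          flip: of_real_power)
    also have "\<dots> = t ^ n * (2 * (1 + Re u)\<^sup>2)" unfolding Re2 by (simp add: power2_eq_square algebra_simps)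
    also have "\<dots> \<ge> 0" using t by simp
    finally have "- (3 * Re (?a ^ n) + 4 * Re (?b ^ n) + Re (?c ^ n)) / real n \<le> 0"
      by (simp add: divide_nonpos_nonneg)
    then show ?thesis by (simp add: add_divide_distrib diff_divide_distrib)
  qed
  have le: "3 * ln (norm (1 - ?a)) + 4 * ln (norm (1 - ?b)) + ln (norm (1 - ?c)) \<le> 0"
    using nonpos sums sums_zero by (rule sums_le)
  have pos: "norm (1 - ?a) > 0" "norm (1 - ?b) > 0" "norm (1 - ?c) > 0" using n by auto
  have "ln (norm (1 - ?a) ^ 3 * norm (1 - ?b) ^ 4 * norm (1 - ?c)) \<le> 0"
    using pos le by (simp add: ln_mult ln_realpow del: zero_less_norm_iff)
  then show ?thesis using pos by (subst (asm) ln_le_zero_iff) auto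
qed

context completely_multiplicative begin

lemma completely_multiplicative_square: "completely_multiplicative (\<lambda>m. (\<psi> m)\<^sup>2)"
proof
  show "cmod ((\<psi> m)\<^sup>2) = 0 \<or> cmod ((\<psi> m)\<^sup>2) = 1" for m
    using norm_cases[of m] by (auto simp: norm_power)
qed (use one in \<open>simp_all add: mult power_mult_distrib\<close>)

text \<open>The principal character attached to \<open>\<psi>\<close>: the indicator of the set
  where \<open>\<psi>\<close> is nonzero.\<close>

lemma completely_multiplicative_norm: "completely_multiplicative (\<lambda>m. of_real (norm (\<psi> m)))"
proof
  show "cmod (complex_of_real (cmod (\<psi> m))) = 0 \<or> cmod (complex_of_real (cmod (\<psi> m))) = 1" for m
    using norm_cases[of m] by auto
qed (use one in \<open>simp_all add: mult norm_mult\<close>)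

text \<open>\<open>norm_341_le_1\<close> at \<open>t = p powr - s\<close> bounds each triple of
  inverse Euler factors by 1, trivially if \<open>\<psi> p = 0\<close>. Multiplying by the three
  values of \<open>L\<close> and letting \<open>K\<close> grow turns the left side into 1, by
  \<open>Euler_product\<close>.\<close>

lemma L_341:
  assumes s: "s > 1"
  shows "norm (completely_multiplicative.L (\<lambda>m. of_real (norm (\<psi> m))) s) ^ 3 * norm (L s) ^ 4 *
           norm (completely_multiplicative.L (\<lambda>m. (\<psi> m)\<^sup>2) s) \<ge> 1"
proof -
  interpret sq: completely_multiplicative "\<lambda>m. (\<psi> m)\<^sup>2" by (rule completely_multiplicative_square)
  interpret nm: completely_multiplicative "\<lambda>m. of_real (norm (\<psi> m))" by (rule completely_multiplicative_norm)
  let ?P = "\<lambda>K. {p. prime p \<and> p \<le> (K::nat)}" and ?t = "\<lambda>p. real p powr - s"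
  define E1 where "E1 K = (\<Prod>p\<in>?P K. 1 - of_real (norm (\<psi> p)) * complex_of_real (?t p))" for K
  define E2 where "E2 K = (\<Prod>p\<in>?P K. 1 - \<psi> p * complex_of_real (?t p))" for K
  define E3 where "E3 K = (\<Prod>p\<in>?P K. 1 - (\<psi> p)\<^sup>2 * complex_of_real (?t p))" for K
  have E: "norm (E1 K) ^ 3 * norm (E2 K) ^ 4 * norm (E3 K) \<le> 1" for K
  proof -
    have "norm (1 - of_real (norm (\<psi> p)) * complex_of_real (?t p)) ^ 3 *
      norm (1 - \<psi> p * complex_of_real (?t p)) ^ 4 * norm (1 - (\<psi> p)\<^sup>2 * complex_of_real (?t p)) \<le> 1"
      if "p \<in> ?P K" for p
    proof -
      have p: "p > 1" using that prime_gt_1_nat by auto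
      then have "?t p < real p powr 0" using s by (subst powr_less_cancel_iff) auto
      then have "?t p < 1" using p by simp
      then show ?thesis using norm_cases[of p] norm_341_le_1[of "?t p" "\<psi> p"] by auto
    qed
    then have "(\<Prod>p\<in>?P K. norm (1 - of_real (norm (\<psi> p)) * complex_of_real (?t p)) ^ 3 *
      norm (1 - \<psi> p * complex_of_real (?t p)) ^ 4 * norm (1 - (\<psi> p)\<^sup>2 * complex_of_real (?t p))) \<le> 1"
      by (intro prod_le_1) auto
    then show ?thesis
      by (simp only: E1_def E2_def E3_def prod.distrib prod_norm[symmetric] prod_power_distrib)
  qed
  let ?X = "norm (nm.L s) ^ 3 * norm (L s) ^ 4 * norm (sq.L s)"
  have lim: "(\<lambda>K. norm (nm.L s * E1 K) ^ 3 * norm (L s * E2 K) ^ 4 * norm (sq.L s * E3 K))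
     \<longlonglongrightarrow> norm (1::complex) ^ 3 * norm (1::complex) ^ 4 * norm (1::complex)"
    unfolding E1_def E2_def E3_def
    by (intro tendsto_intros Euler_product nm.Euler_product sq.Euler_product s)
  have le: "norm (nm.L s * E1 K) ^ 3 * norm (L s * E2 K) ^ 4 * norm (sq.L s * E3 K) \<le> ?X" for K
  proof -
    have "norm (nm.L s * E1 K) ^ 3 * norm (L s * E2 K) ^ 4 * norm (sq.L s * E3 K)
       = ?X * (norm (E1 K) ^ 3 * norm (E2 K) ^ 4 * norm (E3 K))"
      by (simp add: norm_mult power_mult_distrib)
    also have "\<dots> \<le> ?X * 1" by (intro mult_left_mono E) auto
    finally show ?thesis by simp
  qed
  have "norm (1::complex) ^ 3 * norm (1::complex) ^ 4 * norm (1::complex) \<le> ?X"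
    by (rule LIMSEQ_le_const2[OF lim]) (use le in blast)
  then show ?thesis by simp
qed

text \<open>If the series at 1 vanished, then as \<open>s\<close> decreases to 1 the cube in
  \<open>L_341\<close> has at most a pole of order 3, \<open>L s ^ 4\<close> vanishes to order 4,
  and the value for the squared character stays below \<open>D\<close>. The product would tend to
  0.\<close>

theorem L_1_nonzero_complex:
  assumes C: "\<And>n. norm (\<Sum>k<n. \<psi> (Suc k)) \<le> C" and D: "\<And>n. norm (\<Sum>k<n. (\<psi> (Suc k))\<^sup>2) \<le> D"
  shows "\<not> (\<lambda>m. \<psi> m / of_nat m) sums 0"
proof
  assume z: "(\<lambda>m. \<psi> m / of_nat m) sums 0"
  interpret sq: completely_multiplicative "\<lambda>m. (\<psi> m)\<^sup>2" by (rule completely_multiplicative_square)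
  interpret nm: completely_multiplicative "\<lambda>m. of_real (norm (\<psi> m))" by (rule completely_multiplicative_norm)
  have C0: "C \<ge> 0" and D0: "D \<ge> 0" using C[of 0] D[of 0] by auto
  have "1 \<le> s ^ 3 * C ^ 4 * D * (s - 1)" if s: "s > 1" for s
  proof -
    have "norm (nm.L s) \<le> (\<Sum>m. real m powr - s)"
      unfolding nm.L_def
    proof (rule norm_suminf_le)
      show "summable (\<lambda>m. real m powr - s)" using s by (simp add: summable_real_powr_iff)
    qed (use norm_le_1 in \<open>simp add: norm_mult mult_left_le_one_le\<close>)
    then have a: "norm (nm.L s) \<le> s / (s - 1)" using zeta_le[OF s] by linarith
    have "1 \<le> norm (nm.L s) ^ 3 * norm (L s) ^ 4 * norm (sq.L s)" using L_341[OF s] .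
    also have "\<dots> \<le> (s / (s - 1)) ^ 3 * (C * (s - 1)) ^ 4 * D"
      using s C0 D0 by (intro mult_mono power_mono a L_le_near_1 sq.L_bounded C D z) auto
    also have "\<dots> = s ^ 3 * C ^ 4 * D * (s - 1)"
    proof -
      have "(s / d) ^ 3 * (C * d) ^ 4 * D = s ^ 3 * C ^ 4 * D * d" if "d \<noteq> 0" for d
        using that by (simp add: power_divide power_mult_distrib eval_nat_numeral)
      then show ?thesis using s by simp
    qed
    finally show ?thesis .
  qed
  then have ev: "\<forall>\<^sub>F s in at_right 1. 1 \<le> s ^ 3 * C ^ 4 * D * (s - 1)"
    by (auto simp: eventually_at_filter)
  have lim: "((\<lambda>s::real. s ^ 3 * C ^ 4 * D * (s - 1)) \<longlongrightarrow> 1 ^ 3 * C ^ 4 * D * (1 - 1)) (at_right 1)"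
    by (intro tendsto_intros)
  show False using tendsto_lowerbound[OF lim ev] by simp
qed

end

section \<open>Nonvanishing at 1: real characters\<close>

text \<open>AM-GM for the terms \<open>i\<close> and \<open>m - 1 - i\<close>, whose product is
  \<open>(t ^ (m - 1))\<^sup>2\<close>.\<close>

lemma geometric_AM_GM:
  fixes t :: real
  assumes "t \<ge> 0"
  shows "real m * t ^ (m - 1) \<le> (\<Sum>i<m. (t\<^sup>2) ^ i)"
proof -
  have "2 * (real m * t ^ (m - 1)) = (\<Sum>i<m. 2 * t ^ (m - 1))" by simp
  also have "\<dots> \<le> (\<Sum>i<m. (t\<^sup>2) ^ i + (t\<^sup>2) ^ (m - Suc i))"
  proof (rule sum_mono)
    fix i assume "i \<in> {..<m}"
    then have "t ^ (m - 1) = t ^ i * t ^ (m - Suc i)" by (simp add: power_add[symmetric])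
    then show "2 * t ^ (m - 1) \<le> (t\<^sup>2) ^ i + (t\<^sup>2) ^ (m - Suc i)"
      using sum_squares_bound[of "t ^ i" "t ^ (m - Suc i)"]
      by (simp add: power_mult[symmetric] mult_ac)
  qed
  also have "\<dots> = 2 * (\<Sum>i<m. (t\<^sup>2) ^ i)"
    by (simp add: sum.distrib sum.nat_diff_reindex)
  finally show ?thesis by simp
qed

text \<open>With \<open>A\<close>, \<open>B\<close> the geometric sums of length \<open>m\<close>
  and \<open>m + 1\<close>, the claim reduces to \<open>t ^ m * (m * (m + 1)) \<le> A * B\<close>,
  which follows from \<open>geometric_AM_GM\<close> at \<open>sqrt t\<close> for both
  factors.\<close>

lemma Lambert_weights_decseq:
  fixes t :: real
  assumes t: "0 < t" "t < 1"
  shows "decseq (\<lambda>n. 1 / (real (Suc n) * (1 - t)) - t ^ Suc n / (1 - t ^ Suc n))"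
proof (rule decseq_SucI)
  fix n
  let ?m = "Suc n"
  define A where "A = (\<Sum>i<?m. t ^ i)"
  define B where "B = (\<Sum>i<Suc ?m. t ^ i)"
  define u where "u = sqrt t"
  have u: "u \<ge> 0" "u\<^sup>2 = t" using t by (auto simp: u_def)
  have A: "1 - t ^ ?m = (1 - t) * A" "1 - t ^ Suc ?m = (1 - t) * B"
    unfolding A_def B_def by (rule one_diff_power_eq)+
  have "u \<le> 1" using t by (simp add: u_def)
  \<comment> \<open>The exponent is weakened from \<open>?m - 1\<close> to \<open>?m\<close> so that
    the two bounds together contain \<open>u ^ ?m * u ^ ?m = t ^ ?m\<close>.\<close>
  have "real ?m * u ^ ?m \<le> real ?m * u ^ (?m - 1)"
    using u \<open>u \<le> 1\<close> by (intro mult_left_mono power_decreasing) auto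
  also have "\<dots> \<le> A" using geometric_AM_GM[OF u(1), of ?m] by (simp add: A_def u)
  finally have A1: "real ?m * u ^ ?m \<le> A" .
  have B1: "real (Suc ?m) * u ^ ?m \<le> B" using geometric_AM_GM[OF u(1), of "Suc ?m"] by (simp add: B_def u)
  have "(real ?m * u ^ ?m) * (real (Suc ?m) * u ^ ?m) \<le> A * B"
    using A1 B1 u by (intro mult_mono) (auto intro: order_trans[rotated])
  moreover have "u ^ ?m * u ^ ?m = t ^ ?m" using u by (metis power2_eq_square power_mult_distrib)
  moreover have "(real ?m * u ^ ?m) * (real (Suc ?m) * u ^ ?m) = (u ^ ?m * u ^ ?m) * (real ?m * real (Suc ?m))"
    by (simp only: mult_ac)
  ultimately have AB: "t ^ ?m * (real ?m * real (Suc ?m)) \<le> A * B" by (simp only:)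
  have pos: "A > 0" "B > 0"
    unfolding A_def B_def using t by (auto intro!: sum_pos simp del: sum.lessThan_Suc)
  \<comment> \<open>This identity collapses the difference of the two fractions to
    \<open>t ^ ?m / (A * B)\<close>.\<close>
  have "B - t * A = 1"
    unfolding A_def B_def by (subst sum.lessThan_Suc_shift) (simp add: sum_distrib_left del: sum.lessThan_Suc)
  moreover have "t ^ ?m / A - t ^ Suc ?m / B = t ^ ?m * (B - t * A) / (A * B)"
    using pos by (simp add: field_simps)
  ultimately have "t ^ ?m / A - t ^ Suc ?m / B = t ^ ?m / (A * B)" by simp
  also have "\<dots> \<le> 1 / (real ?m * real (Suc ?m))"
    using AB pos by (simp add: divide_le_eq pos_le_divide_eq)
  also have "\<dots> = 1 / real ?m - 1 / real (Suc ?m)" by (simp add: field_simps)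
  finally have "1 / real (Suc ?m) - t ^ Suc ?m / B \<le> 1 / real ?m - t ^ ?m / A" by simp
  then have "(1 / real (Suc ?m) - t ^ Suc ?m / B) / (1 - t) \<le> (1 / real ?m - t ^ ?m / A) / (1 - t)"
    using t by (intro divide_right_mono) auto
  then show "1 / (real (Suc ?m) * (1 - t)) - t ^ Suc ?m / (1 - t ^ Suc ?m)
      \<le> 1 / (real ?m * (1 - t)) - t ^ ?m / (1 - t ^ ?m)"
    unfolding A by (simp only: diff_divide_distrib divide_divide_eq_left mult.commute)
qed

section \<open>Divisor sums of a real character and their Lambert series\<close>

locale real_completely_multiplicative =
  fixes \<rho> :: "nat \<Rightarrow> real"
  assumes mult: "\<rho> (m * n) = \<rho> m * \<rho> n" and one: "\<rho> 1 = 1"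
    and range: "\<rho> m \<in> {-1, 0, 1}"
begin

text \<open>The Dirichlet convolution of \<open>\<rho>\<close> with 1; for \<open>j > 0\<close> it
  is the coefficient of \<open>t ^ j\<close> in the Lambert series of \<open>\<rho>\<close>.\<close>

definition r :: "nat \<Rightarrow> real" where "r j = (\<Sum>d | d dvd j. \<rho> d)"

lemma power: "\<rho> (m ^ i) = \<rho> m ^ i"
  using one by (induction i) (simp_all add: mult)

text \<open>The divisors of \<open>p ^ k * m\<close> are uniquely \<open>p ^ i * d\<close> with
  \<open>i \<le> k\<close> and \<open>d dvd m\<close>.\<close>

lemma r_prime_power_mult:
  assumes p: "prime p" and m: "\<not> p dvd m" "m > 0"
  shows "r (p ^ k * m) = (\<Sum>i\<le>k. \<rho> p ^ i) * r m"
proof -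
  have cop: "coprime (p ^ i) d" if "d dvd m" for i d
    using p m(1) that by (meson coprime_power_left_iff prime_imp_coprime dvd_trans)
  have "{d. d dvd p ^ k * m} = (\<lambda>(i, d). p ^ i * d) ` ({..k} \<times> {d. d dvd m})"
  proof (intro equalityI subsetI)
    fix x assume "x \<in> {d. d dvd p ^ k * m}"
    then obtain a b where ab: "x = a * b" "a dvd p ^ k" "b dvd m" using division_decomp by blast
    then obtain i where "i \<le> k" "a = p ^ i" using p by (auto simp: divides_primepow_nat)
    then show "x \<in> (\<lambda>(i, d). p ^ i * d) ` ({..k} \<times> {d. d dvd m})" using ab by auto
  qed (auto intro!: mult_dvd_mono le_imp_power_dvd)
  moreover have "inj_on (\<lambda>(i, d). p ^ i * d) ({..k} \<times> {d. d dvd m})"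
  proof (rule inj_onI, clarsimp)
    fix i d j e assume *: "d dvd m" "e dvd m" "p ^ i * d = p ^ j * e"
    have "p ^ i dvd p ^ j" using * cop[of e i] by (metis coprime_dvd_mult_left_iff dvd_triv_left)
    moreover have "p ^ j dvd p ^ i" using * cop[of d j] by (metis coprime_dvd_mult_left_iff dvd_triv_left)
    ultimately have "p ^ i = p ^ j" by (rule dvd_antisym)
    then show "i = j \<and> d = e" using * p prime_gt_1_nat[OF p] by (auto dest: power_inject_exp[THEN iffD1, rotated])
  qed
  ultimately have "r (p ^ k * m) = (\<Sum>(i, d)\<in>{..k} \<times> {d. d dvd m}. \<rho> p ^ i * \<rho> d)"
    unfolding r_def by (simp add: sum.reindex case_prod_unfold mult power)
  then show ?thesis unfolding r_def by (simp add: sum_product sum.cartesian_product)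
qed

text \<open>According as \<open>\<rho> p\<close> is 1, 0 or -1, the sum is \<open>k + 1\<close>, 1
  (because \<open>0 ^ 0 = 1\<close>), or the indicator of even \<open>k\<close>.\<close>

lemma sum_power_nonneg: "(\<Sum>i\<le>k. \<rho> p ^ i) \<ge> 0"
  and sum_power_ge_1: "even k \<Longrightarrow> (\<Sum>i\<le>k. \<rho> p ^ i) \<ge> 1"
proof -
  have m1: "(\<Sum>i\<le>k. (-1) ^ i) = (if even k then 1 else (0::real))" by (induction k) auto
  have z: "(\<Sum>i\<le>k. 0 ^ i) = (1::real)" by (induction k) auto
  show "(\<Sum>i\<le>k. \<rho> p ^ i) \<ge> 0" "even k \<Longrightarrow> (\<Sum>i\<le>k. \<rho> p ^ i) \<ge> 1"
    using range[of p] m1 z by auto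
qed

lemma split_off_prime:
  assumes "m > (1::nat)"
  obtains p k m' where "prime p" "m = p ^ k * m'" "\<not> p dvd m'" "m' > 0" "m' < m"
proof -
  obtain p where p: "prime p" "p dvd m" using assms prime_factor_nat[of m] by auto
  obtain m' where m': "m = p ^ multiplicity p m * m'" "\<not> p dvd m'"
    by (rule multiplicity_decompose'[of m p]) (use p assms in auto)
  have "m' > 0" using m' assms by (cases "m' = 0") auto
  moreover have "m' \<noteq> m" using m' p by metis
  moreover have "m' \<le> m" using m' assms by (metis dvd_imp_le dvd_triv_right less_trans zero_less_one)
  ultimately show ?thesis using that[of p "multiplicity p m" m'] p m' by auto
qed

lemma r_1: "r 1 = 1"
  using one by (simp add: r_def)

lemma r_nonneg: "j > 0 \<Longrightarrow> r j \<ge> 0"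
proof (induction j rule: less_induct)
  case (less j)
  show ?case
  proof (cases "j = 1")
    case True then show ?thesis using r_1 by simp
  next
    case False
    then obtain p k m where *: "prime p" "j = p ^ k * m" "\<not> p dvd m" "m > 0" "m < j"
      using less.prems split_off_prime[of j] by auto
    then show ?thesis using r_prime_power_mult[of p m k] sum_power_nonneg[where p = p and k = k] less.IH[of m] by simp
  qed
qed

text \<open>In a square every prime has an even exponent, so each local factor of \<open>r\<close>
  is at least 1.\<close>

lemma r_square_ge_1: "n > 0 \<Longrightarrow> r (n ^ 2) \<ge> 1"
proof (induction n rule: less_induct)
  case (less n)
  show ?case
  proof (cases "n = 1")
    case True then show ?thesis using r_1 by simp
  next
    case False
    then obtain p k m where *: "prime p" "n = p ^ k * m" "\<not> p dvd m" "m > 0" "m < n"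
      using less.prems split_off_prime[of n] by auto
    have "n ^ 2 = p ^ (2 * k) * m ^ 2" unfolding *(2) by (simp add: power_mult_distrib power_mult[symmetric] mult.commute)
    moreover have "\<not> p dvd m ^ 2" using * prime_dvd_power by blast
    ultimately have "r (n ^ 2) = (\<Sum>i\<le>2 * k. \<rho> p ^ i) * r (m ^ 2)"
      using r_prime_power_mult[of p "m ^ 2" "2 * k"] * by simp
    moreover have "1 * 1 \<le> (\<Sum>i\<le>2 * k. \<rho> p ^ i) * r (m ^ 2)"
      using * less.IH[of m] by (intro mult_mono sum_power_ge_1 sum_power_nonneg) auto
    ultimately show ?thesis by simp
  qed
qed

text \<open>All coefficients \<open>r j\<close> except those at squares, which are at least 1, are
  discarded; then the pairs \<open>j = m * k\<close> are regrouped by \<open>m\<close>. Truncation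
  at \<open>J\<close> keeps the exchange of sums finite.\<close>

lemma sum_over_squares_le:
  assumes t: "0 < t" "t < 1" and J: "K ^ 2 \<le> J"
  shows "(\<Sum>k\<in>{1..K}. t ^ (k ^ 2)) \<le> (\<Sum>m\<in>{1..J}. \<rho> m * (\<Sum>k\<in>{1..J div m}. (t ^ m) ^ k))"
proof -
  have "(\<Sum>k\<in>{1..K}. t ^ (k ^ 2)) \<le> (\<Sum>k\<in>{1..K}. r (k ^ 2) * t ^ (k ^ 2))"
    using t r_square_ge_1 by (intro sum_mono) (auto simp: mult_le_cancel_right1)
  also have "\<dots> = (\<Sum>j\<in>(\<lambda>k. k ^ 2) ` {1..K}. r j * t ^ j)"
    by (subst sum.reindex) (auto simp: inj_on_def)
  also have "\<dots> \<le> (\<Sum>j\<in>{1..J}. r j * t ^ j)"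
  proof (rule sum_mono2)
    have "k ^ 2 \<le> J" if "k \<le> K" for k using order.trans[OF power_mono[OF that] J] by simp
    then show "(\<lambda>k. k ^ 2) ` {1..K} \<subseteq> {1..J}" by (auto simp: Suc_le_eq)
  qed (use t r_nonneg in auto)
  also have "\<dots> = (\<Sum>j\<in>{1..J}. \<Sum>m | m dvd j. \<rho> m * t ^ j)"
    by (simp add: r_def sum_distrib_right)
  also have "\<dots> = (\<Sum>(j, m)\<in>Sigma {1..J} (\<lambda>j. {m. m dvd j}). \<rho> m * t ^ j)"
    by (subst sum.Sigma) auto
  also have "\<dots> = (\<Sum>(m, k)\<in>Sigma {1..J} (\<lambda>m. {1..J div m}). \<rho> m * (t ^ m) ^ k)"
  proof (rule sum.reindex_bij_witness[where j = "\<lambda>(j, m). (m, j div m)" and i = "\<lambda>(m, k). (m * k, m)"])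
    show "(case a of (j, m) \<Rightarrow> (m, j div m)) \<in> Sigma {1..J} (\<lambda>m. {1..J div m})"
      if "a \<in> Sigma {1..J} (\<lambda>j. {m. m dvd j})" for a
    proof -
      from that obtain m k where a: "a = (m * k, m)" "m * k \<ge> 1" "m * k \<le> J" by (auto elim!: dvdE)
      then have "m > 0" "k > 0" by (auto intro!: gr0I)
      moreover from this have "m \<le> m * k" by simp
      then have "m \<le> J" using a by linarith
      ultimately show ?thesis using a by (auto simp: less_eq_div_iff_mult_less_eq mult.commute)
    qed
    show "(case b of (m, k) \<Rightarrow> (m * k, m)) \<in> Sigma {1..J} (\<lambda>j. {m. m dvd j})"
      if "b \<in> Sigma {1..J} (\<lambda>m. {1..J div m})" for b
      using that by (auto simp: Suc_le_eq less_eq_div_iff_mult_less_eq mult.commute)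
  qed (auto simp: power_mult[symmetric])
  also have "\<dots> = (\<Sum>m\<in>{1..J}. \<rho> m * (\<Sum>k\<in>{1..J div m}. (t ^ m) ^ k))"
    by (subst sum.Sigma[symmetric]) (auto simp: sum_distrib_left)
  finally show ?thesis .
qed

text \<open>The cut-off geometric series for \<open>m\<close> misses a tail starting at exponent
  \<open>m * Suc (J div m)\<close>, which exceeds \<open>J\<close>.\<close>

lemma Lambert_truncation:
  assumes t: "0 < t" "t < 1"
  shows "\<bar>(\<Sum>m\<in>{1..J}. \<rho> m * (\<Sum>k\<in>{1..J div m}. (t ^ m) ^ k)) - (\<Sum>m\<in>{1..J}. \<rho> m * (t ^ m / (1 - t ^ m)))\<bar>
     \<le> real J * (t ^ J / (1 - t))"
proof -
  have "\<bar>\<rho> m * ((\<Sum>k\<in>{1..J div m}. (t ^ m) ^ k) - t ^ m / (1 - t ^ m))\<bar> \<le> t ^ J / (1 - t)"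
    if m: "m \<in> {1..J}" for m
  proof -
    let ?q = "J div m"
    have tm: "0 < t ^ m" "t ^ m \<le> t" using t m power_decreasing[of 1 m t] by auto
    have "(\<Sum>k\<in>{1..?q}. (t ^ m) ^ k) = (\<Sum>k\<le>?q. (t ^ m) ^ k) - 1"
      by (simp add: atMost_atLeast0 sum.atLeast_Suc_atMost[of 0])
    also have "(\<Sum>k\<le>?q. (t ^ m) ^ k) = (1 - (t ^ m) ^ Suc ?q) / (1 - t ^ m)"
      using tm t by (simp add: sum_gp0)
    finally have S: "(\<Sum>k\<in>{1..?q}. (t ^ m) ^ k) = (1 - (t ^ m) ^ Suc ?q) / (1 - t ^ m) - 1" .
    have "(1 - y * w) / (1 - y) - (1 - y) / (1 - y) - y / (1 - y) = - (y * w / (1 - y))" for y w :: real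
      by (simp only: diff_divide_distrib[symmetric] minus_divide_left) simp
    from this[of "t ^ m" "(t ^ m) ^ ?q"]
    have "(\<Sum>k\<in>{1..?q}. (t ^ m) ^ k) - t ^ m / (1 - t ^ m) = - ((t ^ m) ^ Suc ?q / (1 - t ^ m))"
      unfolding S using tm t by simp
    also have "\<bar>\<dots>\<bar> = (t ^ m) ^ Suc ?q / (1 - t ^ m)" using tm t by simp
    also have "\<dots> \<le> t ^ J / (1 - t)"
    proof (rule frac_le)
      have "J \<le> m * Suc ?q" using m dividend_less_times_div[of m J] by auto
      then show "(t ^ m) ^ Suc ?q \<le> t ^ J"
        using t by (simp only: power_mult[symmetric]) (intro power_decreasing, auto)
    qed (use t tm in auto)
    finally have "\<bar>(\<Sum>k\<in>{1..?q}. (t ^ m) ^ k) - t ^ m / (1 - t ^ m)\<bar> \<le> t ^ J / (1 - t)" .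
    moreover have "\<bar>\<rho> m\<bar> \<le> 1" using range[of m] by auto
    ultimately show ?thesis unfolding abs_mult by (meson abs_ge_zero mult_left_le_one_le order_trans)
  qed
  then have "(\<Sum>m\<in>{1..J}. \<bar>\<rho> m * ((\<Sum>k\<in>{1..J div m}. (t ^ m) ^ k) - t ^ m / (1 - t ^ m))\<bar>) \<le> real J * (t ^ J / (1 - t))"
    using sum_bounded_above[of "{1..J}" _ "t ^ J / (1 - t)"] by auto
  then show ?thesis
    using sum_abs[of "\<lambda>m. \<rho> m * ((\<Sum>k\<in>{1..J div m}. (t ^ m) ^ k) - t ^ m / (1 - t ^ m))" "{1..J}"]
    by (simp add: right_diff_distrib sum_subtractf)
qed

text \<open>Monsky's argument: if \<open>L(1, \<rho>) = 0\<close> then the Lambert series \<open>\<Sum>m. \<rho> m t\<^sup>m / (1 - t\<^sup>m)\<close> equals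
  \<open>- \<Sum>m. \<rho> m (1 / (m (1 - t)) - t\<^sup>m / (1 - t\<^sup>m))\<close>, which stays bounded as \<open>t\<close> tends to \<open>1\<close> because
  the weights decrease from \<open>1\<close> to \<open>0\<close>; but it dominates \<open>\<Sum>k. t ^ k\<^sup>2\<close>.\<close>

theorem L_1_nonzero_real:
  assumes C: "\<And>n. \<bar>\<Sum>k<n. \<rho> (Suc k)\<bar> \<le> C"
  shows "\<not> (\<lambda>m. \<rho> m / real m) sums 0"
proof
  assume z: "(\<lambda>m. \<rho> m / real m) sums 0"
  have bound: "(\<Sum>k\<in>{1..K}. t ^ (k ^ 2)) \<le> C" if t: "0 < t" "t < 1" for t K
  proof -
    define b where "b n = 1 / (real (Suc n) * (1 - t)) - t ^ Suc n / (1 - t ^ Suc n)" for n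
    have dec: "decseq b" unfolding b_def using t by (rule Lambert_weights_decseq)
    have t0: "(\<lambda>n. t ^ Suc n) \<longlonglongrightarrow> 0" using t by (intro LIMSEQ_Suc LIMSEQ_realpow_zero) auto
    have "(\<lambda>n. 1 / real (Suc n) / (1 - t) - t ^ Suc n / (1 - t ^ Suc n)) \<longlonglongrightarrow> 0 / (1 - t) - 0 / (1 - 0)"
      using t by (intro tendsto_intros t0 LIMSEQ_Suc[OF lim_1_over_n]) auto
    then have lim: "b \<longlonglongrightarrow> 0" unfolding b_def by simp
    have C': "norm (\<Sum>k<n. complex_of_real (\<rho> (Suc k))) \<le> C" for n
      using C[of n] by (simp flip: of_real_sum)
    have b0: "b 0 = 1" using t by (simp add: b_def diff_divide_distrib[symmetric])
    define S where "S = (\<Sum>n. b n * \<rho> (Suc n))"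
    have "summable (\<lambda>n. complex_of_real (b n * \<rho> (Suc n)))"
      using summable_Abel[OF dec lim C'] by simp
    then have sm: "summable (\<lambda>n. b n * \<rho> (Suc n))" by (subst (asm) summable_of_real_iff)
    have "norm (\<Sum>n. complex_of_real (b n * \<rho> (Suc n))) \<le> C"
      using suminf_Abel_le[OF dec lim C'] b0 by simp
    then have "norm (complex_of_real S) \<le> C" unfolding S_def by (simp only: suminf_of_real[OF sm])
    then have S: "(\<lambda>n. b n * \<rho> (Suc n)) sums S" "\<bar>S\<bar> \<le> C"
      using sm by (auto simp: S_def)
    have "(\<lambda>n. 1 / (1 - t) * (\<rho> (Suc n) / real (Suc n))) sums (1 / (1 - t) * 0)"
      using z sums_Suc_iff[of "\<lambda>m. \<rho> m / real m" 0] by (intro sums_mult) simp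
    from sums_diff[OF this S(1)]
    have "(\<lambda>n. \<rho> (Suc n) * (t ^ Suc n / (1 - t ^ Suc n))) sums (1 / (1 - t) * 0 - S)"
      by (rule back_subst[of "\<lambda>f. f sums _"]) (auto simp: b_def fun_eq_iff field_simps)
    then have a: "(\<lambda>J. \<Sum>n<J. \<rho> (Suc n) * (t ^ Suc n / (1 - t ^ Suc n))) \<longlonglongrightarrow> - S" by (simp add: sums_def)
    have eq: "(\<Sum>n<J. \<rho> (Suc n) * (t ^ Suc n / (1 - t ^ Suc n))) = (\<Sum>m\<in>{1..J}. \<rho> m * (t ^ m / (1 - t ^ m)))" for J
      by (rule sum.reindex_bij_witness[where i = "\<lambda>m. m - 1" and j = Suc]) auto
    have b: "(\<lambda>J. real J * (t ^ J / (1 - t))) \<longlonglongrightarrow> 0"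
      using tendsto_divide[OF powser_times_n_limit_0[of t] tendsto_const[of "1 - t"]] t by simp
    have lim2: "(\<lambda>J. (\<Sum>m\<in>{1..J}. \<rho> m * (t ^ m / (1 - t ^ m))) + real J * (t ^ J / (1 - t))) \<longlonglongrightarrow> - S + 0"
      using tendsto_add[OF a b] unfolding eq .
    have "(\<Sum>k\<in>{1..K}. t ^ (k ^ 2)) \<le> - S + 0"
    proof (rule LIMSEQ_le_const[OF lim2], intro exI[of _ "K ^ 2"] allI impI)
      fix J assume "K ^ 2 \<le> J"
      from sum_over_squares_le[OF t this] Lambert_truncation[OF t, of J]
      show "(\<Sum>k\<in>{1..K}. t ^ (k ^ 2)) \<le> (\<Sum>m\<in>{1..J}. \<rho> m * (t ^ m / (1 - t ^ m))) + real J * (t ^ J / (1 - t))"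
        by linarith
    qed
    then show ?thesis using S(2) by linarith
  qed
  \<comment> \<open>With \<open>K\<close> fixed, letting \<open>t\<close> tend to 1 turns the bound
    into \<open>K \<le> C\<close>.\<close>
  have "real K \<le> C" for K
  proof -
    have lim: "((\<lambda>t::real. \<Sum>k\<in>{1..K}. t ^ (k ^ 2)) \<longlongrightarrow> (\<Sum>k\<in>{1..K}. 1 ^ (k ^ 2))) (at_left 1)"
      by (intro tendsto_intros)
    have ev: "\<forall>\<^sub>F t::real in at_left 1. (\<Sum>k\<in>{1..K}. t ^ (k ^ 2)) \<le> C"
      using eventually_at_left_real[OF zero_less_one] by eventually_elim (use bound in auto)
    show ?thesis using tendsto_upperbound[OF lim ev] by simp
  qed
  then show False using reals_Archimedean2[of C] by (meson not_le)
qed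

end

section \<open>Even periodic functions\<close>

lemma periodic_nat_mod:
  fixes \<psi> :: "nat \<Rightarrow> 'b"
  assumes "\<And>m. \<psi> (m + N) = \<psi> m"
  shows "\<psi> (m mod N) = \<psi> m"
proof -
  have "\<psi> (m mod N + N * q) = \<psi> (m mod N)" for q
  proof (induction q)
    case (Suc q)
    then show ?case using assms[of "m mod N + N * q"] by (simp add: add_ac)
  qed simp
  from this[of "m div N"] show ?thesis by simp
qed

lemma periodic_int_mult:
  fixes h :: "int \<Rightarrow> 'b"
  assumes per: "\<And>k. h (k + n) = h k"
  shows "h (k + n * q) = h k"
proof (induction q rule: int_induct[where k = 0])
  case (step1 i)
  then show ?case using per[of "k + n * i"] by (simp add: algebra_simps)
next
  case (step2 i)
  then show ?case using per[of "k + n * (i - 1)"] by (simp add: algebra_simps)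
qed simp

text \<open>Doubling permutes the residues modulo an odd \<open>N\<close>, so the sum over a period
  equals \<open>\<omega>\<close> times itself and vanishes.\<close>

lemma norm_sum_eigenfunction_le:
  fixes \<psi> :: "nat \<Rightarrow> complex"
  assumes N: "odd N" and per: "\<And>m. \<psi> (m + N) = \<psi> m" and norm: "\<And>m. norm (\<psi> m) \<le> 1"
    and double: "\<And>m. \<psi> (2 * m) = \<omega> * \<psi> m" and \<omega>: "\<omega> \<noteq> 1"
  shows "norm (\<Sum>k<n. \<psi> (Suc k)) \<le> real N"
proof (rule norm_sum_periodic_le)
  show "N > 0" using N by (auto intro!: gr0I)
  have inj: "inj_on (\<lambda>x. 2 * x mod N) {..<N}"
  proof (rule inj_onI)
    fix x y assume xy: "x \<in> {..<N}" "y \<in> {..<N}" "2 * x mod N = 2 * y mod N"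
    then have "[2 * x = 2 * y] (mod N)" by (simp add: cong_def)
    then have "[x = y] (mod N)" using N by (subst (asm) cong_mult_lcancel_nat) auto
    then show "x = y" using xy by (simp add: cong_def)
  qed
  moreover have "(\<lambda>x. 2 * x mod N) ` {..<N} \<subseteq> {..<N}" using \<open>N > 0\<close> by auto
  ultimately have "bij_betw (\<lambda>x. 2 * x mod N) {..<N} {..<N}"
    by (simp add: bij_betw_def endo_inj_surj)
  from sum.reindex_bij_betw[OF this, of \<psi>]
  have "(\<Sum>x<N. \<psi> x) = (\<Sum>x<N. \<psi> (2 * x mod N))" by simp
  also have "\<dots> = \<omega> * (\<Sum>x<N. \<psi> x)"
    using per by (simp add: periodic_nat_mod double sum_distrib_left)
  finally have "(\<Sum>x<N. \<psi> x) = 0" using \<omega> by auto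
  moreover have "(\<Sum>k<n. \<psi> (Suc k)) = (\<Sum>k<n. \<psi> k) + \<psi> n - \<psi> 0" for n by (induction n) auto
  ultimately show "(\<Sum>k<N. \<psi> (Suc k)) = 0" using per[of 0] by simp
  show "\<psi> (Suc (n + N)) = \<psi> (Suc n)" for n using per[of "Suc n"] by simp
qed (rule norm)

lemma dvd_iff_coprime_prime_factors:
  assumes "N > (0::nat)"
  shows "(\<forall>q\<in>prime_factors N. \<not> q dvd m) \<longleftrightarrow> coprime m N"
proof
  assume *: "\<forall>q\<in>prime_factors N. \<not> q dvd m"
  show "coprime m N"
  proof (rule ccontr)
    assume "\<not> coprime m N"
    then have "gcd m N \<noteq> 1" unfolding coprime_iff_gcd_eq_1 .
    then obtain q where "prime q" "q dvd gcd m N" using prime_factor_nat by blast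
    then show False using * assms by (auto simp: prime_factors_dvd)
  qed
next
  assume *: "coprime m N"
  show "\<forall>q\<in>prime_factors N. \<not> q dvd m"
  proof safe
    fix q assume "q \<in> prime_factors N" "q dvd m"
    then have "prime q" "q dvd N" by (auto simp: in_prime_factors_iff)
    with * \<open>q dvd m\<close> show False using coprime_common_divisor not_prime_unit by blast
  qed
qed

text \<open>An eigenfunction of \<open>k \<mapsto> 2 k\<close>: since \<open>\<plusminus>2\<^sup>j\<close> exhaust the units modulo \<open>N\<close>, where it is
  nonzero it is, up to scaling, an even Dirichlet character \<open>\<psi>\<close> with \<open>\<psi> 2 = \<omega>\<close>.\<close>

locale periodic_eigenfunction =
  fixes N :: nat and H :: "int \<Rightarrow> complex" and \<omega> :: complex and r :: nat
  assumes N: "N \<in> O_FS" and r: "r > 0" and \<omega>: "\<omega> ^ r = 1"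
    and per: "H (k + int N) = H k" and even: "H (- k) = H k"
    and double: "H (2 * k) = \<omega> * H k"
    and series: "(\<lambda>m. if \<forall>q\<in>prime_factors N. \<not> q dvd m
                  then (- 1) ^ (m + 1) * H (k * int m) / of_nat m else 0) sums 0"
begin

lemma N_pos: "N > 0" and N_odd: "odd N"
  using N by (auto simp: O_FS_def)

lemma norm_\<omega>: "norm \<omega> = 1"
proof -
  have "norm \<omega> ^ r = 1 ^ r" using \<omega> by (simp flip: norm_power)
  then show ?thesis by (rule power_eq_imp_eq_base) (use r in auto)
qed

lemma power2: "H (2 ^ j * k) = \<omega> ^ j * H k"
  by (induction j) (simp_all add: double mult.assoc)

lemma per_mult: "H (k + int N * q) = H k"
  using per by (rule periodic_int_mult)

text \<open>Membership in \<open>O_FS\<close> makes \<open>m\<close> congruent to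
  \<open>2 ^ j\<close> or \<open>- (2 ^ j)\<close> modulo \<open>N\<close>, and evenness of
  \<open>H\<close> absorbs the sign.\<close>

lemma H_mult_coprime:
  assumes "coprime m N"
  obtains j where "\<And>k. H (k * int m) = \<omega> ^ j * H k"
proof -
  from assms have "coprime (int m) (int N)" by simp
  then obtain j where "int N dvd int m - 2 ^ j \<or> int N dvd int m + 2 ^ j"
    using N unfolding O_FS_def by blast
  then have "H (k * int m) = \<omega> ^ j * H k" for k
  proof
    assume "int N dvd int m - 2 ^ j"
    then obtain q where "int m - 2 ^ j = int N * q" by (auto elim!: dvdE)
    then have q: "int m = 2 ^ j + int N * q" by simp
    have "k * int m = 2 ^ j * k + int N * (k * q)" unfolding q by (simp add: algebra_simps)
    then show ?thesis using per_mult power2 by presburger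
  next
    assume "int N dvd int m + 2 ^ j"
    then obtain q where "int m + 2 ^ j = int N * q" by (auto elim!: dvdE)
    then have q: "int m = int N * q - 2 ^ j" by simp
    have "k * int m = - (2 ^ j * k) + int N * (k * q)" unfolding q by (simp add: algebra_simps)
    then show ?thesis using per_mult power2 even by presburger
  qed
  then show ?thesis using that by blast
qed

context
  fixes k assumes nz: "H k \<noteq> 0"
begin

definition \<psi> :: "nat \<Rightarrow> complex" where
  "\<psi> m = (if coprime m N then H (k * int m) / H k else 0)"

text \<open>The factor \<open>\<omega> ^ j\<close> depends on \<open>m\<close> alone, so the ratio
  taken at \<open>k\<close> serves at every \<open>x\<close>; multiplicativity of
  \<open>\<psi>\<close> follows from this.\<close>

lemma H_mult: "coprime m N \<Longrightarrow> H (x * int m) = \<psi> m * H x"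
proof -
  assume m: "coprime m N"
  then obtain j where "\<And>k. H (k * int m) = \<omega> ^ j * H k" using H_mult_coprime by blast
  then show ?thesis using m nz by (simp add: \<psi>_def)
qed

lemma \<psi>_power: "coprime m N \<Longrightarrow> \<exists>j. \<psi> m = \<omega> ^ j"
proof -
  assume m: "coprime m N"
  then obtain j where "\<And>k. H (k * int m) = \<omega> ^ j * H k" using H_mult_coprime by blast
  then show ?thesis using m nz by (auto simp: \<psi>_def)
qed

lemma \<psi>_mult: "\<psi> (m * n) = \<psi> m * \<psi> n"
proof (cases "coprime m N \<and> coprime n N")
  case True
  have "\<psi> (m * n) * H k = H (k * int m * int n)" using True nz by (simp add: \<psi>_def mult.assoc)
  also have "\<dots> = \<psi> n * (\<psi> m * H k)" using H_mult True by simp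
  finally show ?thesis using nz by simp
next
  case False
  then show ?thesis by (auto simp: \<psi>_def)
qed

lemma \<psi>_1: "\<psi> 1 = 1"
  using nz by (simp add: \<psi>_def)

lemma \<psi>_2: "\<psi> 2 = \<omega>"
  using nz N_odd double[of k] by (simp add: \<psi>_def mult.commute)

lemma \<psi>_periodic: "\<psi> (m + N) = \<psi> m"
proof -
  have "coprime (m + N) N \<longleftrightarrow> coprime m N" by (metis coprime_iff_gcd_eq_1 gcd_add1)
  then show ?thesis using per_mult[of "k * int m" k] by (simp add: \<psi>_def algebra_simps)
qed

lemma completely_multiplicative_\<psi>: "completely_multiplicative \<psi>"
proof
  fix m
  show "norm (\<psi> m) = 0 \<or> norm (\<psi> m) = 1"
  proof (cases "coprime m N")
    case True
    then show ?thesis using \<psi>_power[OF True] norm_\<omega> by (auto simp: norm_power)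
  qed (simp add: \<psi>_def)
qed (fact \<psi>_mult \<psi>_1)+

interpretation cm: completely_multiplicative \<psi> by (rule completely_multiplicative_\<psi>)

lemma alternating_series: "(\<lambda>m. (- 1) ^ (m + 1) * \<psi> m / of_nat m) sums 0"
proof -
  have "(\<lambda>m. 1 / H k * (if \<forall>q\<in>prime_factors N. \<not> q dvd m
                  then (- 1) ^ (m + 1) * H (k * int m) / of_nat m else 0)) sums (1 / H k * 0)"
    by (intro sums_mult series)
  moreover have "1 / H k * (if \<forall>q\<in>prime_factors N. \<not> q dvd m
                  then (- 1) ^ (m + 1) * H (k * int m) / of_nat m else 0)
      = (- 1) ^ (m + 1) * \<psi> m / of_nat m" for m
    unfolding dvd_iff_coprime_prime_factors[OF N_pos] by (simp add: \<psi>_def)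
  ultimately show ?thesis by simp
qed

text \<open>For \<open>\<omega> = 1\<close> the character is principal, and the series is that of
  \<open>Ln 2\<close> with the primes dividing \<open>N\<close> sieved out, which has a nonzero
  sum.\<close>

lemma \<omega>_neq_1: "\<omega> \<noteq> 1"
proof
  assume "\<omega> = 1"
  then have \<psi>: "\<psi> m = (if coprime m N then 1 else 0)" for m
    using \<psi>_power[of m] by (auto simp: \<psi>_def)
  have "(\<lambda>m. (- 1) ^ (m + 1) * 1 ^ m / of_nat m) sums Ln (1 + 1)"
    by (rule Ln_series_unit_circle) auto
  then have "(\<lambda>m. (- 1) ^ (m + 1) / of_nat m) sums Ln 2" by simp
  have "(\<lambda>m. if \<forall>q\<in>prime_factors N. \<not> q dvd m then (- 1) ^ (m + 1) / of_nat m else 0)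
      sums (Ln 2 * (\<Prod>p\<in>prime_factors N. 1 - 1 / of_nat p))"
  proof -
    have "(- 1) ^ (p * m + 1) / of_nat (p * m) = 1 / complex_of_nat p * ((- 1) ^ (m + 1) / of_nat m)"
      if "p \<in> prime_factors N" for p m
    proof -
      \<comment> \<open>Since \<open>p\<close> is odd, \<open>p * m\<close> and \<open>m\<close>
        have the same parity and the sign survives.\<close>
      have "odd p" using that N_odd by (meson dvd_trans in_prime_factors_iff)
      then show ?thesis by (cases "even m") auto
    qed
    then show ?thesis
      using sums_sieve[OF _ _ _ \<open>(\<lambda>m. (- 1) ^ (m + 1) / of_nat m) sums Ln 2\<close>, of "prime_factors N" "\<lambda>p. 1 / of_nat p"]
      by (simp add: in_prime_factors_iff)
  qed
  also have "(\<lambda>m. if \<forall>q\<in>prime_factors N. \<not> q dvd m then (- 1) ^ (m + 1) / of_nat m else 0)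
      = (\<lambda>m. (- 1) ^ (m + 1) * \<psi> m / of_nat m)"
    unfolding dvd_iff_coprime_prime_factors[OF N_pos] by (auto simp: \<psi>)
  finally have "Ln 2 * (\<Prod>p\<in>prime_factors N. 1 - 1 / complex_of_nat p) = 0"
    using alternating_series sums_unique2 by blast
  moreover have "Ln (2::complex) \<noteq> 0"
    using Ln_of_real[of 2] by (simp del: Ln_of_real)
  moreover have "(\<Prod>p\<in>prime_factors N. 1 - 1 / complex_of_nat p) \<noteq> 0"
    by (auto dest: in_prime_factors_imp_prime)
  ultimately show False by simp
qed

lemma \<psi>_double: "\<psi> (2 * m) = \<omega> * \<psi> m"
  by (simp add: \<psi>_mult \<psi>_2)

lemma \<psi>_partial_sums: "norm (\<Sum>k<n. \<psi> (Suc k)) \<le> real N"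
  using N_odd \<psi>_periodic cm.norm_le_1 \<psi>_double \<omega>_neq_1 by (rule norm_sum_eigenfunction_le)

text \<open>Here the alternating series is \<open>(1 - \<omega>) L(1, \<psi>)\<close>.\<close>

lemma series_sums_0: "(\<lambda>m. \<psi> m / of_nat m) sums 0"
proof -
  have "summable (\<lambda>n. of_real (1 / real (Suc n)) * \<psi> (Suc n))"
    using decseq_inverse_Suc LIMSEQ_Suc[OF lim_1_over_n] \<psi>_partial_sums by (rule summable_Abel)
  then obtain l where "(\<lambda>n. of_real (1 / real (Suc n)) * \<psi> (Suc n)) sums l" by (auto simp: summable_def)
  then have "(\<lambda>n. \<psi> (Suc n) / of_nat (Suc n)) sums l" by simp
  then have l: "(\<lambda>m. \<psi> m / of_nat m) sums l"
    using sums_Suc_iff[of "\<lambda>m. \<psi> m / of_nat m" l] by simp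
  have "(\<lambda>m. if \<forall>q\<in>{}. \<not> q dvd m then \<psi> (2 * m) / of_nat (2 * m) else 0) sums (\<omega> / 2 * l)"
    using sums_mult[OF l, of "\<omega> / 2"] by (simp add: \<psi>_double)
  with l have "(\<lambda>m. if \<forall>q\<in>{2}. \<not> q dvd m then \<psi> m / of_nat m else 0) sums (l - \<omega> / 2 * l)"
    by (intro sums_remove_prime) auto
  \<comment> \<open>The alternating series is twice its odd-indexed part, taken without signs, minus
    the whole unsigned series.\<close>
  from sums_diff[OF sums_mult[OF this, of 2] l]
  have "(\<lambda>m. (- 1) ^ (m + 1) * \<psi> m / of_nat m) sums (2 * (l - \<omega> / 2 * l) - l)"
    by (rule back_subst[of "\<lambda>f. f sums _"]) (auto simp: fun_eq_iff)
  from sums_unique2[OF this alternating_series] have "l * (1 - \<omega>) = 0" by (simp add: algebra_simps)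
  then show ?thesis using l \<omega>_neq_1 by simp
qed

text \<open>If \<open>\<omega>\<^sup>2 = 1\<close>, the values of \<open>\<psi>\<close> are 0 or
  powers of \<open>- 1\<close>, so the real case applies. Otherwise the square of
  \<open>\<psi>\<close> has eigenvalue \<open>\<omega>\<^sup>2 \<noteq> 1\<close> under doubling,
  hence the bounded partial sums that the complex case requires.\<close>

lemma nonzero_contradiction: False
proof (cases "\<omega>\<^sup>2 = 1")
  case False
  have "norm (\<Sum>k<n. (\<psi> (Suc k))\<^sup>2) \<le> real N" for n
    by (rule norm_sum_eigenfunction_le[where \<omega> = "\<omega>\<^sup>2"])
       (use N_odd \<psi>_periodic cm.norm_le_1 False in \<open>auto simp: \<psi>_double power_mult_distrib norm_power power_le_one\<close>)
  from cm.L_1_nonzero_complex[OF \<psi>_partial_sums this] series_sums_0 show False by blast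
next
  case True
  then have "\<omega> = - 1" using \<omega>_neq_1 by (auto simp: power2_eq_1_iff)
  then have \<psi>: "\<psi> m \<in> {-1, 0, 1}" for m
  proof (cases "coprime m N")
    case True
    then obtain j where "\<psi> m = (-1) ^ j" using \<psi>_power \<open>\<omega> = -1\<close> by blast
    then show ?thesis by (cases "even j") auto
  qed (simp add: \<psi>_def)
  define \<rho> where "\<rho> m = Re (\<psi> m)" for m
  have \<rho>: "\<psi> m = of_real (\<rho> m)" for m using \<psi>[of m] by (auto simp: \<rho>_def)
  interpret real_completely_multiplicative \<rho>
  proof
    show "\<rho> (m * n) = \<rho> m * \<rho> n" for m n unfolding \<rho>_def \<psi>_mult using \<psi>[of m] \<psi>[of n] by auto
    show "\<rho> 1 = 1" using \<psi>_1 by (simp add: \<rho>_def)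
    show "\<rho> m \<in> {-1, 0, 1}" for m using \<psi>[of m] by (auto simp: \<rho>_def)
  qed
  have "\<bar>\<Sum>k<n. \<rho> (Suc k)\<bar> \<le> real N" for n
    using \<psi>_partial_sums[of n] by (simp add: \<rho> flip: of_real_sum)
  from L_1_nonzero_real[OF this] have "\<not> (\<lambda>m. \<rho> m / real m) sums 0" .
  moreover have "(\<lambda>m. complex_of_real (\<rho> m / real m)) sums of_real 0"
    using series_sums_0 by (simp add: \<rho>)
  ultimately show False using sums_of_real_iff by blast
qed

end

lemma H_eq_0: "H k = 0"
  using nonzero_contradiction by blast

end

text \<open>The terms divisible by \<open>p\<close> are \<open>1 / p\<close> times the series for
  \<open>k * p\<close>, with signs kept as \<open>p\<close> is odd. This is why the hypothesis is
  made for every \<open>k\<close>.\<close>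

lemma alternating_series_sieve:
  fixes h :: "int \<Rightarrow> complex"
  assumes "finite P" "\<And>p. p \<in> P \<Longrightarrow> prime p \<and> odd p"
    and "\<And>k. (\<lambda>m. (- 1) ^ (m + 1) * h (k * int m) / of_nat m) sums 0"
  shows "(\<lambda>m. if \<forall>q\<in>P. \<not> q dvd m then (- 1) ^ (m + 1) * h (k * int m) / of_nat m else 0) sums 0"
  using assms(1,2)
proof (induction P arbitrary: k rule: finite_induct)
  case empty
  then show ?case using assms(3) by simp
next
  case (insert p P)
  have p: "prime p" "odd p" using insert by auto
  have eq: "(- 1) ^ (p * m + 1) * h (k * int (p * m)) / of_nat (p * m)
      = 1 / of_nat p * ((- 1) ^ (m + 1) * h (k * int p * int m) / of_nat m)" for m
    using p by (cases "even m") (auto simp: mult.assoc)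
  have "(\<lambda>m. 1 / of_nat p * (if \<forall>q\<in>P. \<not> q dvd m then (- 1) ^ (m + 1) * h (k * int p * int m) / of_nat m else 0))
     sums (1 / of_nat p * 0)"
    using insert by (intro sums_mult) auto
  then have "(\<lambda>m. if \<forall>q\<in>P. \<not> q dvd m then (- 1) ^ (p * m + 1) * h (k * int (p * m)) / of_nat (p * m) else 0)
     sums 0" unfolding eq by (simp only: if_distrib mult_zero_right cong: if_cong)
  from sums_remove_prime[OF _ _ _ insert.IH this] insert show ?case by simp
qed

text \<open>A function invariant under \<open>k \<mapsto> 2\<^sup>r k\<close> is the average over the \<open>r\<close>-th roots of unity \<open>\<omega>\<close>
  of its components on the eigenspaces of \<open>k \<mapsto> 2 k\<close>.\<close>

theorem even_periodic_eq_0: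
  fixes h :: "int \<Rightarrow> complex"
  assumes N: "N \<in> O_FS" and per: "\<And>k. h (k + int N) = h k" and even: "\<And>k. h (- k) = h k"
    and series: "\<And>k. (\<lambda>m. (- 1) ^ (m + 1) * h (k * int m) / of_nat m) sums 0"
  shows "h k = 0"
proof -
  have N': "odd N" "N > 0" using N by (auto simp: O_FS_def)
  define r where "r = totient N"
  have r: "r > 0" using N' by (simp add: r_def)
  have "[2 ^ r = 1] (mod N)" unfolding r_def using N' by (intro euler_theorem) auto
  then have "[int (2 ^ r) = int 1] (mod int N)" by (subst cong_int_iff)
  then have "int N dvd 2 ^ r - 1" by (simp add: cong_iff_dvd_diff)
  then obtain c where c: "2 ^ r - 1 = int N * c" by (auto elim!: dvdE)
  note per_mult = periodic_int_mult[of h, OF per]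
  have h2r: "h (2 ^ r * k) = h k" for k
  proof -
    have "2 ^ r * k = k + int N * (c * k)" using c by (simp add: algebra_simps)
    then show ?thesis using per_mult by presburger
  qed
  \<comment> \<open>Up to the factor \<open>r\<close>, this is the projection of \<open>h\<close> to
    the eigenspace of \<open>\<omega>\<close> under doubling.\<close>
  define H where "H \<omega> k = (\<Sum>j<r. (1 / \<omega>) ^ j * h (2 ^ j * k))" for \<omega> k
  have H: "H \<omega> k = 0" if \<omega>: "\<omega> ^ r = 1" for \<omega> k
  proof (rule periodic_eigenfunction.H_eq_0, unfold_locales)
    have nz: "\<omega> \<noteq> 0" using \<omega> r by (auto simp: zero_power)
    show "N \<in> O_FS" "r > 0" "\<omega> ^ r = 1" by fact+
    show "H \<omega> (k + int N) = H \<omega> k" for k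
      using per_mult by (simp add: H_def distrib_left mult.commute[of _ "int N"])
    show "H \<omega> (- k) = H \<omega> k" for k by (simp add: H_def even)
    show "H \<omega> (2 * k) = \<omega> * H \<omega> k" for k
    proof -
      let ?g = "\<lambda>j. (1 / \<omega>) ^ j * h (2 ^ j * k)"
      have "(\<Sum>j<n. ?g (Suc j)) = (\<Sum>j<n. ?g j) + ?g n - ?g 0" for n by (induction n) auto
      \<comment> \<open>The index shift closes up because \<open>\<omega> ^ r = 1\<close> and
        \<open>2 ^ r\<close> is 1 modulo \<open>N\<close>.\<close>
      moreover have "?g r = ?g 0" using \<omega> h2r by (simp add: power_one_over)
      ultimately have "(\<Sum>j<r. ?g (Suc j)) = H \<omega> k" by (simp add: H_def)
      moreover have "H \<omega> (2 * k) = (\<Sum>j<r. \<omega> * ?g (Suc j))"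
        unfolding H_def using nz by (intro sum.cong) (auto simp: mult_ac)
      ultimately show ?thesis by (simp only: sum_distrib_left[symmetric])
    qed
    show "(\<lambda>m. if \<forall>q\<in>prime_factors N. \<not> q dvd m
        then (- 1) ^ (m + 1) * H \<omega> (k * int m) / of_nat m else 0) sums 0" for k
    proof (rule alternating_series_sieve)
      show "prime p \<and> odd p" if "p \<in> prime_factors N" for p
        using that N' by (meson dvd_trans in_prime_factors_iff)
      show "(\<lambda>m. (- 1) ^ (m + 1) * H \<omega> (k * int m) / of_nat m) sums 0" for k
      proof -
        have "(\<lambda>m. \<Sum>j<r. (1 / \<omega>) ^ j * ((- 1) ^ (m + 1) * h (2 ^ j * k * int m) / of_nat m)) sums
            (\<Sum>j<r. (1 / \<omega>) ^ j * 0)"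
          by (intro sums_sum sums_mult series)
        then show ?thesis
          by (simp add: H_def sum_distrib_left sum_divide_distrib mult_ac)
      qed
    qed simp
  qed
  define \<zeta> where "\<zeta> = exp (2 * of_real pi * \<i> * of_nat 1 / of_nat r)"
  have \<zeta>: "\<zeta> ^ j = exp (2 * of_real pi * \<i> * of_nat j / of_nat r)" for j
    unfolding \<zeta>_def by (subst exp_of_nat_mult[symmetric]) (simp add: mult_ac)
  have \<zeta>1: "\<zeta> ^ j = 1 \<longleftrightarrow> r dvd j" for j
    unfolding \<zeta> using r by (subst complex_root_unity_eq_1) auto
  have "\<zeta> \<noteq> 0" by (simp add: \<zeta>_def)
  have swap: "(x ^ j) ^ r = (x ^ r) ^ j" for x :: complex and j
    by (simp add: mult.commute flip: power_mult)
  \<comment> \<open>Summing over all \<open>r\<close>-th roots of unity isolates the term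
    \<open>j = 0\<close>.\<close>
  have orth: "(\<Sum>a<r. ((1 / \<zeta>) ^ j) ^ a) = (if j = 0 then of_nat r else 0)" if "j < r" for j
  proof (cases "j = 0")
    case False
    have "(1 / \<zeta>) ^ j \<noteq> 1" using \<zeta>1[of j] that False by (auto simp: power_one_over dest: dvd_imp_le)
    moreover have "((1 / \<zeta>) ^ j) ^ r = 1"
      using \<zeta>1[of r] by (simp add: swap power_one_over)
    ultimately show ?thesis using False by (simp add: sum_gp_strict)
  qed simp
  have "0 = (\<Sum>a<r. H (\<zeta> ^ a) k)"
  proof -
    have "(\<zeta> ^ a) ^ r = 1" for a using \<zeta>1[of r] by (simp add: swap)
    then show ?thesis using H by simp
  qed
  also have "\<dots> = (\<Sum>j<r. (\<Sum>a<r. ((1 / \<zeta>) ^ j) ^ a) * h (2 ^ j * k))"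
  proof -
    have "(1 / \<zeta> ^ a) ^ j = ((1 / \<zeta>) ^ j) ^ a" for a j
      by (simp add: power_one_over mult.commute flip: power_mult)
    then show ?thesis unfolding H_def by (subst sum.swap) (simp only: sum_distrib_right)
  qed
  also have "\<dots> = (\<Sum>j<r. if j = 0 then of_nat r * h k else 0)"
    using orth by (intro sum.cong) auto
  also have "\<dots> = of_nat r * h k" using r by (simp add: sum.delta)
  finally show ?thesis using r by simp
qed

section \<open>Subset sums and necessity of the condition\<close>

text \<open>One function enumerates \<open>A\<close> and, with one more index,
  \<open>add_mset a A\<close>; this turns the index-set descriptions of \<open>FS\<close> and
  \<open>msum\<close> into recursions.\<close>

lemma multiset_enumeration:
  obtains f :: "nat \<Rightarrow> 'a" where "A = image_mset f (mset_set {..<size A})"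
    "add_mset a A = image_mset f (mset_set {..<Suc (size A)})" "f (size A) = a"
proof -
  obtain xs where xs: "mset xs = A" using ex_mset by blast
  have *: "mset ys = image_mset ((!) ys) (mset_set {..<length ys})" for ys :: "'a list"
    by (metis atLeast_upt map_nth mset_map mset_set_set set_upt distinct_upt lessThan_atLeast0 mset_upt)
  have len: "length xs = size A" using xs by auto
  have "image_mset ((!) (xs @ [a])) (mset_set {..<size A}) = image_mset ((!) xs) (mset_set {..<size A})"
    by (intro image_mset_cong) (auto simp: nth_append len)
  then show ?thesis
    using that[of "(!) (xs @ [a])"] *[of xs] *[of "xs @ [a]"] xs len by (simp add: nth_append)
qed

section \<open>Recursions and translations of subset sums\<close>

context comm_group
begin

lemma FS_empty: "FS G {#} = {#\<one>#}"
  by (simp add: FS_def copies_def)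

text \<open>Index sets are split by whether they contain the last index, which carries
  \<open>a\<close>.\<close>

lemma FS_add_mset:
  assumes "a \<in> carrier G" "set_mset A \<subseteq> carrier G"
  shows "FS G (add_mset a A) = FS G A + image_mset ((\<otimes>) a) (FS G A)"
proof -
  let ?n = "size A"
  obtain f where f: "A = image_mset f (mset_set {..<?n})"
    "add_mset a A = image_mset f (mset_set {..<Suc ?n})" "f ?n = a" using multiset_enumeration .
  have "f ` {..<?n} = set_mset A" by (subst f(1)) simp
  then have "f i \<in> carrier G" if "i < ?n" for i using assms(2) that by blast
  then have fc: "f \<in> {..<?n} \<rightarrow> carrier G" "f \<in> {..<Suc ?n} \<rightarrow> carrier G"
    using assms(1) f(3) by (auto simp: less_Suc_eq)
  have inj: "inj_on (insert ?n) (Pow {..<?n})"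
  proof (rule inj_onI)
    fix J K assume "J \<in> Pow {..<?n}" "K \<in> Pow {..<?n}" "insert ?n J = insert ?n K"
    moreover from this have "?n \<notin> J" "?n \<notin> K" by auto
    ultimately show "J = K" by (simp add: insert_ident)
  qed
  have P: "mset_set (Pow {..<Suc ?n}) = mset_set (Pow {..<?n}) + image_mset (insert ?n) (mset_set (Pow {..<?n}))"
    unfolding lessThan_Suc Pow_insert image_mset_mset_set[OF inj]
    by (rule mset_set_Union) auto
  have "FS G (add_mset a A) = image_mset (\<lambda>J. \<Otimes>i\<in>J. f i) (mset_set (Pow {..<Suc ?n}))"
    by (subst f(2), rule FS_enumeration[OF comm_group_axioms]) (use fc in auto)
  also have "\<dots> = image_mset (\<lambda>J. \<Otimes>i\<in>J. f i) (mset_set (Pow {..<?n}))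
      + image_mset (\<lambda>J. \<Otimes>i\<in>insert ?n J. f i) (mset_set (Pow {..<?n}))"
    unfolding P by (simp add: multiset.map_comp o_def)
  also have "image_mset (\<lambda>J. \<Otimes>i\<in>insert ?n J. f i) (mset_set (Pow {..<?n}))
      = image_mset (\<lambda>J. a \<otimes> (\<Otimes>i\<in>J. f i)) (mset_set (Pow {..<?n}))"
  proof (rule image_mset_cong)
    fix J assume "J \<in># mset_set (Pow {..<?n})"
    then have "J \<subseteq> {..<?n}" by simp
    moreover from this have "finite J" by (rule finite_subset) simp
    ultimately show "(\<Otimes>i\<in>insert ?n J. f i) = a \<otimes> (\<Otimes>i\<in>J. f i)"
      using fc f(3) assms(1) by (subst finprod_insert) auto
  qed
  also have "image_mset (\<lambda>J. \<Otimes>i\<in>J. f i) (mset_set (Pow {..<?n})) = FS G A"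
    by (subst (2) f(1), rule FS_enumeration[OF comm_group_axioms, symmetric]) (use fc in auto)
  also have "image_mset (\<lambda>J. a \<otimes> (\<Otimes>i\<in>J. f i)) (mset_set (Pow {..<?n})) = image_mset ((\<otimes>) a) (FS G A)"
    unfolding \<open>image_mset (\<lambda>J. \<Otimes>i\<in>J. f i) (mset_set (Pow {..<?n})) = FS G A\<close>[symmetric]
    by (simp add: multiset.map_comp o_def)
  finally show ?thesis .
qed

lemma FS_closed: "set_mset A \<subseteq> carrier G \<Longrightarrow> set_mset (FS G A) \<subseteq> carrier G"
  by (induction A) (auto simp: FS_empty FS_add_mset)

lemma msum_empty: "msum G {#} = \<one>"
  by (simp add: msum_def)

lemma msum_add_mset:
  assumes "a \<in> carrier G" "set_mset A \<subseteq> carrier G"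
  shows "msum G (add_mset a A) = a \<otimes> msum G A"
proof -
  let ?n = "size A"
  obtain f where f: "A = image_mset f (mset_set {..<?n})"
    "add_mset a A = image_mset f (mset_set {..<Suc ?n})" "f ?n = a" using multiset_enumeration .
  have "f ` {..<?n} = set_mset A" by (subst f(1)) simp
  then have "f i \<in> carrier G" if "i < ?n" for i using assms(2) that by blast
  then have fc: "f \<in> {..<?n} \<rightarrow> carrier G" "f \<in> {..<Suc ?n} \<rightarrow> carrier G"
    using assms(1) f(3) by (auto simp: less_Suc_eq)
  have "msum G (add_mset a A) = (\<Otimes>i\<in>{..<Suc ?n}. f i)"
    by (subst f(2), rule msum_enumeration[OF comm_group_axioms]) (use fc in auto)
  also have "\<dots> = a \<otimes> (\<Otimes>i\<in>{..<?n}. f i)"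
    unfolding lessThan_Suc using fc f(3) assms(1) by (subst finprod_insert) auto
  also have "(\<Otimes>i\<in>{..<?n}. f i) = msum G A"
    by (subst (2) f(1), rule msum_enumeration[OF comm_group_axioms, symmetric]) (use fc in auto)
  finally show ?thesis .
qed

lemma msum_closed: "set_mset A \<subseteq> carrier G \<Longrightarrow> msum G A \<in> carrier G"
  by (induction A) (auto simp: msum_empty msum_add_mset)

lemma msum_translate:
  assumes "c \<in> carrier G" "set_mset A \<subseteq> carrier G"
  shows "msum G (image_mset ((\<otimes>) c) A) = c [^] size A \<otimes> msum G A"
  using assms(2)
proof (induction A)
  case (add a A)
  then have "set_mset (image_mset ((\<otimes>) c) A) \<subseteq> carrier G" using assms(1) by auto
  then show ?case using add assms(1) by (simp add: msum_add_mset msum_closed m_ac)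
qed (simp add: msum_empty)

text \<open>Replacing \<open>b\<close> by its inverse translates the subset sums by
  \<open>inv b\<close>: choosing \<open>inv b\<close> corresponds to omitting \<open>b\<close>. The
  sum of \<open>B\<close> is left arbitrary because, in the passage from equal \<open>FS\<close> to
  \<open>sim0\<close>, it is shown to be trivial only afterwards.\<close>

lemma FS_plus_inverses:
  assumes A: "set_mset A \<subseteq> carrier G" and B: "set_mset B \<subseteq> carrier G"
  shows "FS G (A + image_mset (m_inv G) B) = image_mset ((\<otimes>) (inv (msum G B))) (FS G (A + B))"
  using B
proof (induction B)
  case empty
  have "image_mset ((\<otimes>) \<one>) (FS G A) = image_mset id (FS G A)"
    by (intro image_mset_cong) (use FS_closed[OF A] in auto)
  then show ?case by (simp add: msum_empty)
next
  case (add b B)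
  let ?c = "inv (msum G B)" and ?F = "FS G (A + B)"
  have b: "b \<in> carrier G" and B: "set_mset B \<subseteq> carrier G" using add by auto
  have AB: "set_mset (A + B) \<subseteq> carrier G" "set_mset (A + image_mset (m_inv G) B) \<subseteq> carrier G" using A B by auto
  have c: "?c \<in> carrier G" "msum G B \<in> carrier G" using msum_closed[OF B] by auto
  have F: "x \<in> carrier G" if "x \<in># ?F" for x using FS_closed[OF AB(1)] that by auto
  have "FS G (A + image_mset (m_inv G) (add_mset b B)) =
      image_mset ((\<otimes>) ?c) ?F + image_mset (\<lambda>x. inv b \<otimes> (?c \<otimes> x)) ?F"
    using FS_add_mset[of "inv b", OF _ AB(2)] b add.IH[OF B] by (simp add: multiset.map_comp o_def)
  also have "image_mset ((\<otimes>) ?c) ?F = image_mset (\<lambda>x. inv (b \<otimes> msum G B) \<otimes> (b \<otimes> x)) ?F"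
  proof (rule image_mset_cong)
    fix x assume "x \<in># ?F"
    then have x: "x \<in> carrier G" by (rule F)
    have "inv (b \<otimes> msum G B) \<otimes> (b \<otimes> x) = (inv b \<otimes> b) \<otimes> (?c \<otimes> x)"
      using b c x by (simp only: inv_mult m_ac inv_closed m_closed)
    then show "?c \<otimes> x = inv (b \<otimes> msum G B) \<otimes> (b \<otimes> x)" using b c x by simp
  qed
  also have "image_mset (\<lambda>x. inv b \<otimes> (?c \<otimes> x)) ?F = image_mset ((\<otimes>) (inv (b \<otimes> msum G B))) ?F"
    by (rule image_mset_cong) (use F b c in \<open>simp add: inv_mult m_assoc\<close>)
  also have "image_mset (\<lambda>x. inv (b \<otimes> msum G B) \<otimes> (b \<otimes> x)) ?F + image_mset ((\<otimes>) (inv (b \<otimes> msum G B))) ?F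
      = image_mset ((\<otimes>) (inv (msum G (add_mset b B)))) (FS G (A + add_mset b B))"
    using FS_add_mset[OF b AB(1)] b B by (simp add: msum_add_mset multiset.map_comp o_def)
  finally show ?case .
qed

lemma sim0_imp_FS_eq:
  assumes "sim0 G A A'" "set_mset A \<subseteq> carrier G"
  shows "FS G A = FS G A'"
proof -
  obtain B where B: "B \<subseteq># A" "msum G B = \<one>" "A' = (A - B) + image_mset (m_inv G) B"
    using assms(1) by (auto simp: sim0_def)
  have "set_mset B \<subseteq> carrier G" "set_mset (A - B) \<subseteq> carrier G"
    using assms(2) B(1) by (auto dest: mset_subset_eqD in_diffD)
  then have "FS G A' = image_mset ((\<otimes>) \<one>) (FS G A)"
    unfolding B(3) using B(1,2) by (subst FS_plus_inverses) auto
  also have "\<dots> = image_mset id (FS G A)"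
    by (intro image_mset_cong) (use FS_closed[OF assms(2)] in auto)
  finally show ?thesis by simp
qed

section \<open>Necessity: multisets with equal subset sums built from one element\<close>

lemma FS_binary_powers:
  assumes h: "h \<in> carrier G"
  shows "FS G (image_mset (\<lambda>j. h [^] (2 ^ j :: nat)) (mset_set {..<r})) =
    image_mset (\<lambda>i. h [^] i) (mset_set {..<2 ^ r :: nat})"
proof (induction r)
  case 0
  then show ?case by (simp add: FS_empty lessThan_Suc)
next
  case (Suc r)
  have "{..<2 ^ Suc r :: nat} = {..<2 ^ r} \<union> (\<lambda>i. 2 ^ r + i) ` {..<2 ^ r}"
  proof (intro equalityI subsetI)
    fix x :: nat assume "x \<in> {..<2 ^ Suc r}"
    then show "x \<in> {..<2 ^ r} \<union> (\<lambda>i. 2 ^ r + i) ` {..<2 ^ r}"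
      by (cases "x < 2 ^ r") (auto simp: image_iff intro!: bexI[of _ "x - 2 ^ r"])
  qed auto
  then have "mset_set {..<2 ^ Suc r :: nat} = mset_set {..<2 ^ r} + mset_set ((\<lambda>i. 2 ^ r + i) ` {..<2 ^ r})"
    by (simp only:) (rule mset_set_Union, auto)
  also have "mset_set ((\<lambda>i. 2 ^ r + i) ` {..<2 ^ r :: nat}) = image_mset (\<lambda>i. 2 ^ r + i) (mset_set {..<2 ^ r})"
    by (rule image_mset_mset_set[symmetric]) auto
  finally have "image_mset (\<lambda>i. h [^] i) (mset_set {..<2 ^ Suc r :: nat}) =
    image_mset (\<lambda>i. h [^] i) (mset_set {..<2 ^ r :: nat}) + image_mset (\<lambda>i. h [^] (2 ^ r :: nat) \<otimes> h [^] i) (mset_set {..<2 ^ r :: nat})"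
    using h by (simp add: multiset.map_comp o_def nat_pow_mult)
  moreover have "FS G (image_mset (\<lambda>j. h [^] (2 ^ j :: nat)) (mset_set {..<Suc r})) =
     FS G (add_mset (h [^] (2 ^ r :: nat)) (image_mset (\<lambda>j. h [^] (2 ^ j :: nat)) (mset_set {..<r})))"
    by (simp add: lessThan_Suc)
  ultimately show ?case using h Suc by (subst (asm) FS_add_mset) (auto simp: multiset.map_comp o_def)
qed

text \<open>The exponents below \<open>n * q\<close> run through \<open>q\<close> full periods; the
  last exponent, \<open>n * q\<close>, gives the extra \<open>\<one>\<close>. The application has
  \<open>2 ^ r = Suc (n * q)\<close>.\<close>

lemma image_pow_periodic:
  assumes h: "h \<in> carrier G" "h [^] n = \<one>"
  shows "image_mset (\<lambda>i. h [^] i) (mset_set {..<Suc (n * q)}) =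
    add_mset \<one> (repeat_mset q (image_mset (\<lambda>i. h [^] i) (mset_set {..<n :: nat})))"
proof -
  have hq: "h [^] (n * q) = \<one>" for q using h by (simp add: nat_pow_pow[symmetric])
  have "image_mset (\<lambda>i. h [^] i) (mset_set {..<n * q}) =
    repeat_mset q (image_mset (\<lambda>i. h [^] i) (mset_set {..<n :: nat}))"
  proof (induction q)
    case (Suc q)
    have "{..<n * Suc q} = {..<n * q} \<union> (\<lambda>i. n * q + i) ` {..<n}"
    proof (intro equalityI subsetI)
      fix x assume "x \<in> {..<n * Suc q}"
      then show "x \<in> {..<n * q} \<union> (\<lambda>i. n * q + i) ` {..<n}"
        by (cases "x < n * q") (auto simp: image_iff intro!: bexI[of _ "x - n * q"])
    qed auto
    then have "mset_set {..<n * Suc q} = mset_set {..<n * q} + mset_set ((\<lambda>i. n * q + i) ` {..<n})"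
      by (simp only:) (rule mset_set_Union, auto)
    also have "mset_set ((\<lambda>i. n * q + i) ` {..<n}) = image_mset (\<lambda>i. n * q + i) (mset_set {..<n})"
      by (rule image_mset_mset_set[symmetric]) auto
    finally show ?case using Suc h hq by (simp add: multiset.map_comp o_def nat_pow_mult[symmetric])
  qed simp
  then show ?thesis using hq by (simp add: lessThan_Suc)
qed

lemma image_pow_generator:
  assumes g: "g \<in> carrier G" "g [^] n = \<one>" and n: "n > 0" and y: "coprime y n"
  shows "image_mset (\<lambda>i. (g [^] y) [^] i) (mset_set {..<n :: nat}) =
    image_mset (\<lambda>i. g [^] i) (mset_set {..<n :: nat})"
proof -
  have inj: "inj_on (\<lambda>i. y * i mod n) {..<n}"
  proof (rule inj_onI)
    fix i j assume ij: "i \<in> {..<n}" "j \<in> {..<n}" "y * i mod n = y * j mod n"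
    then have "[y * i = y * j] (mod n)" by (simp add: cong_def)
    then have "[i = j] (mod n)" using y by (subst (asm) cong_mult_lcancel_nat) auto
    then show "i = j" using ij by (simp add: cong_def)
  qed
  moreover have "(\<lambda>i. y * i mod n) ` {..<n} \<subseteq> {..<n}" using n by auto
  ultimately have im: "(\<lambda>i. y * i mod n) ` {..<n} = {..<n}" by (intro endo_inj_surj) auto
  have pow: "g [^] (m mod n) = g [^] m" for m :: nat
  proof -
    have "g [^] m = g [^] (n * (m div n) + m mod n)" by simp
    also have "\<dots> = g [^] (m mod n)" using g by (simp only: nat_pow_mult[symmetric] nat_pow_pow[symmetric]) simp
    finally show ?thesis by simp
  qed
  have "image_mset (\<lambda>i. g [^] i) (mset_set {..<n}) =
      image_mset (\<lambda>i. g [^] i) (image_mset (\<lambda>i. y * i mod n) (mset_set {..<n}))"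
    by (simp add: image_mset_mset_set[OF inj] im)
  then show ?thesis using g by (simp add: multiset.map_comp o_def pow nat_pow_pow)
qed

lemma FS_regular_imp_odd_ord:
  assumes reg: "FS_regular G" and g: "g \<in> carrier G" "ord g > 0"
  shows "odd (ord g)"
proof
  assume "even (ord g)"
  then obtain m where m: "ord g = 2 * m" by blast
  define h where "h = g [^] m"
  have h: "h \<in> carrier G" "h \<otimes> h = \<one>"
    using g m pow_ord_eq_1[of g] by (auto simp: h_def nat_pow_mult mult_2)
  have "h \<noteq> \<one>"
  proof
    assume "h = \<one>"
    then have "ord g dvd m" using g by (simp add: h_def pow_eq_id)
    then show False using m g(2) by (auto dest: dvd_imp_le)
  qed
  have inv: "inv h = h" using h by (simp add: inv_equality)
  have "FS G {#h, \<one>#} = FS G {#h, h#}" using h by (simp add: FS_add_mset FS_empty)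
  then have "sim0 G {#h, \<one>#} {#h, h#}"
    using reg h unfolding FS_regular_def by simp
  then obtain B where B: "B \<subseteq># {#h, \<one>#}" "{#h, h#} = ({#h, \<one>#} - B) + image_mset (m_inv G) B"
    by (auto simp: sim0_def)
  \<comment> \<open>\<open>h\<close> and \<open>\<one>\<close> are their own inverses, so inverting
    \<open>B\<close> changes nothing and the two multisets would coincide.\<close>
  have "image_mset (m_inv G) B = image_mset id B"
  proof (rule image_mset_cong)
    fix x assume "x \<in># B"
    then have "x \<in># {#h, \<one>#}" using B(1) by (rule mset_subset_eqD[rotated])
    then show "inv x = id x" using inv by auto
  qed
  with B have "{#h, h#} = {#h, \<one>#}" by simp
  with \<open>h \<noteq> \<one>\<close> show False by simp
qed

text \<open>If \<open>2\<^sup>r = 1\<close> modulo the order \<open>n\<close> of \<open>h\<close>, then the subset sums of the \<open>h ^ 2\<^sup>j\<close>, \<open>j < r\<close>, are the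
  powers \<open>h ^ i\<close>, \<open>i < 2\<^sup>r\<close>, and hence depend only on the subgroup generated by \<open>h\<close>.\<close>

lemma FS_regular_imp_O_FS:
  assumes reg: "FS_regular G" and g: "g \<in> carrier G" "ord g > 0"
  shows "ord g \<in> O_FS"
proof -
  define n where "n = ord g"
  have n: "n > 0" "odd n" using g FS_regular_imp_odd_ord[OF reg g] by (auto simp: n_def)
  have gn: "g [^] n = \<one>" using g by (simp add: n_def)
  have "\<exists>j::nat. int n dvd x - 2 ^ j \<or> int n dvd x + 2 ^ j" if x: "coprime x (int n)" for x
  proof -
    define y where "y = nat (x mod int n)"
    have y: "int y = x mod int n" using n by (simp add: y_def)
    have "coprime (int y) (int n)" unfolding y using x n by simp
    then have "coprime y n" by simp
    define r where "r = totient n"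
    have r: "r > 0" using n by (simp add: r_def)
    have "[2 ^ r = 1] (mod n)" unfolding r_def using n by (intro euler_theorem) auto
    then have "n dvd 2 ^ r - 1" by (subst (asm) cong_sym_eq, subst (asm) cong_altdef_nat) auto
    then obtain q where "2 ^ r - 1 = n * q" by blast
    then have q: "2 ^ r = Suc (n * q)" using one_le_power[of "2::nat" r] by linarith
    define A where "A h = image_mset (\<lambda>j. h [^] (2 ^ j :: nat)) (mset_set {..<r})" for h
    have FS_A: "FS G (A h) = add_mset \<one> (repeat_mset q (image_mset (\<lambda>i. h [^] i) (mset_set {..<n})))"
      if "h \<in> carrier G" "h [^] n = \<one>" for h
      unfolding A_def FS_binary_powers[OF that(1)] q by (rule image_pow_periodic[OF that])
    have gy: "g [^] y \<in> carrier G" "(g [^] y) [^] n = \<one>"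
      using g gn by (auto simp: nat_pow_pow mult.commute[of y]) (simp flip: nat_pow_pow)
    have "FS G (A g) = FS G (A (g [^] y))"
      unfolding FS_A[OF g(1) gn] FS_A[OF gy] image_pow_generator[OF g(1) gn n(1) \<open>coprime y n\<close>] ..
    moreover have "set_mset (A g) \<subseteq> carrier G" "set_mset (A (g [^] y)) \<subseteq> carrier G"
      using g gy by (auto simp: A_def)
    ultimately have "sim0 G (A g) (A (g [^] y))" using reg unfolding FS_regular_def by blast
    then obtain B where B: "B \<subseteq># A g" "A (g [^] y) = (A g - B) + image_mset (m_inv G) B"
      by (auto simp: sim0_def)
    \<comment> \<open>The entry for \<open>j = 0\<close> exists as \<open>r > 0\<close>; up to
      inversion it must come from an entry of \<open>A g\<close>.\<close>
    have "(g [^] y) [^] (2 ^ 0 :: nat) \<in># A (g [^] y)" unfolding A_def using r by (auto simp del: power_0)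
    then have "g [^] y \<in># A (g [^] y)" using gy by simp
    then have "g [^] y \<in># A g - B \<or> g [^] y \<in># image_mset (m_inv G) B"
      unfolding B(2) union_iff .
    then have "g [^] y \<in># A g \<or> (\<exists>a. a \<in># A g \<and> g [^] y = inv a)"
      using mset_subset_eqD[OF B(1)] by (auto dest: in_diffD)
    then obtain j where "g [^] y = g [^] (2 ^ j :: nat) \<or> g [^] y = inv (g [^] (2 ^ j :: nat))"
      by (auto simp: A_def)
    then have "g [^] int y = g [^] (2 ^ j :: int) \<or> g [^] int y = g [^] (- (2 ^ j) :: int)"
      using g by (simp add: int_pow_int int_pow_neg flip: of_nat_power[of 2 j, where 'a = int, simplified])
        (metis int_pow_int int_pow_neg of_nat_numeral of_nat_power)
    then have "int n dvd 2 ^ j - int y \<or> int n dvd - (2 ^ j) - int y"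
      using g by (simp only: int_pow_eq n_def)
    moreover have "int n dvd x - int y" unfolding y by (simp add: minus_mod_eq_mult_div)
    ultimately have "int n dvd (x - int y) - (2 ^ j - int y) \<or> int n dvd (x - int y) - (- (2 ^ j) - int y)"
      using dvd_diff by blast
    then show ?thesis by auto
  qed
  then show ?thesis using n unfolding O_FS_def n_def by auto
qed

end

section \<open>Characters\<close>

text \<open>Dedekind's argument with the roles exchanged: the points of \<open>T\<close> act by
  evaluation as multiplicative functions on \<open>M\<close>. Multiplying by \<open>\<theta>\<close>
  and subtracting \<open>\<theta> a\<close> times the relation eliminates \<open>a\<close>.\<close>

lemma independence_of_characters:
  fixes g :: "'a \<Rightarrow> complex" and M :: "('a \<Rightarrow> complex) set"
  assumes "finite T" and M: "\<And>\<phi> \<theta>. \<phi> \<in> M \<Longrightarrow> \<theta> \<in> M \<Longrightarrow> (\<lambda>x. \<phi> x * \<theta> x) \<in> M"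
    and sep: "\<And>a b. a \<in> T \<Longrightarrow> b \<in> T \<Longrightarrow> a \<noteq> b \<Longrightarrow> \<exists>\<phi>\<in>M. \<phi> a \<noteq> \<phi> b"
    and nz: "\<And>a. a \<in> T \<Longrightarrow> \<exists>\<phi>\<in>M. \<phi> a \<noteq> 0"
    and z: "\<And>\<phi>. \<phi> \<in> M \<Longrightarrow> (\<Sum>a\<in>T. g a * \<phi> a) = 0"
  shows "\<forall>a\<in>T. g a = 0"
  using assms(1,3-)
proof (induction T arbitrary: g rule: finite_induct)
  case (insert a T)
  have gT: "g b = 0" if b: "b \<in> T" for b
  proof -
    obtain \<theta> where \<theta>: "\<theta> \<in> M" "\<theta> b \<noteq> \<theta> a" using insert.prems(1)[of b a] insert.hyps b by blast
    have "\<forall>s\<in>T. g s * (\<theta> s - \<theta> a) = 0"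
    proof (rule insert.IH)
      fix \<phi> assume \<phi>: "\<phi> \<in> M"
      have "(\<Sum>s\<in>insert a T. g s * (\<phi> s * \<theta> s)) - \<theta> a * (\<Sum>s\<in>insert a T. g s * \<phi> s) = 0"
        using insert.prems(3)[OF M[OF \<phi> \<theta>(1)]] insert.prems(3)[OF \<phi>] by simp
      then show "(\<Sum>s\<in>T. g s * (\<theta> s - \<theta> a) * \<phi> s) = 0"
        using insert.hyps by (simp add: algebra_simps sum_subtractf sum_distrib_left)
    qed (use insert.prems in auto)
    then show ?thesis using b \<theta> by auto
  qed
  obtain \<phi> where "\<phi> \<in> M" "\<phi> a \<noteq> 0" using insert.prems(2) by blast
  then have "g a = 0" using insert.prems(3)[of \<phi>] insert.hyps gT by simp
  then show ?case using gT by auto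
qed simp

text \<open>Each prime goes, with its full power, to the side where its exponent is larger, so
  \<open>m' * n'\<close> is the least common multiple split into coprime parts.\<close>

lemma coprime_splitting:
  fixes m n :: nat
  assumes "m > 0" "n > 0"
  shows "\<exists>m' n'. m' dvd m \<and> n' dvd n \<and> coprime m' n' \<and> m dvd m' * n' \<and> n dvd m' * n'"
  using assms
proof (induction "m * n" arbitrary: m n rule: less_induct)
  case less
  show ?case
  proof (cases "coprime m n")
    case True
    then show ?thesis by (intro exI[of _ m] exI[of _ n]) auto
  next
    case False
    then have "gcd m n \<noteq> 1" unfolding coprime_iff_gcd_eq_1 .
    then obtain p where p: "prime p" "p dvd m" "p dvd n" using prime_factor_nat by (metis dvd_trans gcd_dvd1 gcd_dvd2)
    obtain i m1 where m1: "m = p ^ i * m1" "\<not> p dvd m1"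
      by (rule multiplicity_decompose'[of m p]) (use p less.prems in auto)
    obtain j n1 where n1: "n = p ^ j * n1" "\<not> p dvd n1"
      by (rule multiplicity_decompose'[of n p]) (use p less.prems in auto)
    have pos: "m1 > 0" "n1 > 0" using m1(1) n1(1) less.prems by auto
    have "m1 \<noteq> m" using m1 p by metis
    moreover have "m1 \<le> m" using m1(1) less.prems by (intro dvd_imp_le) auto
    moreover have "n1 \<le> n" using n1(1) less.prems by (intro dvd_imp_le) auto
    ultimately have "m1 * n1 < m * n" using less.prems pos by (intro mult_less_le_imp_less) auto
    from less.hyps[OF this pos] obtain m' n' where
      *: "m' dvd m1" "n' dvd n1" "coprime m' n'" "m1 dvd m' * n'" "n1 dvd m' * n'" by blast
    have "\<not> p dvd m'" "\<not> p dvd n'" using * m1(2) n1(2) by (meson dvd_trans)+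
    then have cop: "coprime (p ^ k) m'" "coprime (p ^ k) n'" for k
      using p(1) by (simp_all add: prime_imp_coprime)
    have **: "p ^ k * m1 dvd p ^ l * (m' * n')" "p ^ k * n1 dvd p ^ l * (m' * n')" if "k \<le> l" for k l
      using * that by (intro mult_dvd_mono le_imp_power_dvd; simp)+
    show ?thesis
    proof (cases "i \<ge> j")
      case True
      have "p ^ i * m' dvd m" "n' dvd n" using * by (auto simp: m1(1) n1(1))
      moreover have "coprime (p ^ i * m') n'" using cop *(3) by simp
      moreover have "m dvd (p ^ i * m') * n'" "n dvd (p ^ i * m') * n'"
        using **[of i i] **[OF True] unfolding m1(1) n1(1) by (simp_all add: mult.assoc)
      ultimately show ?thesis by blast
    next
      case False
      have "m' dvd m" "p ^ j * n' dvd n" using * by (auto simp: m1(1) n1(1))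
      moreover have "coprime m' (p ^ j * n')" using cop *(3) by (simp add: coprime_commute)
      moreover have "m dvd m' * (p ^ j * n')" "n dvd m' * (p ^ j * n')"
        using **[of i j] **[of j j] False unfolding m1(1) n1(1) by (simp_all add: mult.left_commute)
      ultimately show ?thesis by blast
    qed
  qed
qed

context comm_group
begin

text \<open>The condition to be exploited speaks of orders of single elements, so a common period of
  finitely many torsion elements has to be realised as such an order. Powers of \<open>c\<close> and
  \<open>a\<close> with coprime orders \<open>m\<close> and \<open>n\<close> multiply to a suitable
  element.\<close>

lemma exists_common_multiple_order:
  assumes "finite T" "T \<subseteq> carrier G" "\<And>a. a \<in> T \<Longrightarrow> ord a > 0"
  shows "\<exists>c\<in>carrier G. ord c > 0 \<and> (\<forall>a\<in>T. ord a dvd ord c)"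
  using assms
proof (induction T rule: finite_induct)
  case empty
  then show ?case by (intro bexI[of _ \<one>]) auto
next
  case (insert a T)
  then obtain c where c: "c \<in> carrier G" "ord c > 0" "\<forall>b\<in>T. ord b dvd ord c" by auto
  have a: "a \<in> carrier G" "ord a > 0" using insert by auto
  obtain m n where mn: "m dvd ord c" "n dvd ord a" "coprime m n" "ord c dvd m * n" "ord a dvd m * n"
    using coprime_splitting[OF c(2) a(2)] by blast
  then obtain s t where st: "ord c = m * s" "ord a = n * t" by (auto elim!: dvdE)
  then have pos: "m > 0" "n > 0" "s > 0" "t > 0" using c a by auto
  define x where "x = c [^] s"
  define y where "y = a [^] t"
  have x: "x \<in> carrier G" "x [^] k = \<one> \<longleftrightarrow> m dvd k" for k :: nat
    using c pos by (auto simp: x_def nat_pow_pow pow_eq_id st)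
  have y: "y \<in> carrier G" "y [^] k = \<one> \<longleftrightarrow> n dvd k" for k :: nat
    using a pos by (auto simp: y_def nat_pow_pow pow_eq_id st)
  let ?d = "x \<otimes> y"
  have d: "?d \<in> carrier G" using x y by simp
  have dk: "?d [^] k = x [^] k \<otimes> y [^] k" for k :: nat using x y by (simp add: nat_pow_distrib)
  have "?d [^] (m * n) = \<one>" unfolding dk using x(2)[of "m * n"] y(2)[of "m * n"] by simp
  then have "ord ?d dvd m * n" using d by (simp add: pow_eq_id)
  then have "ord ?d > 0" using pos by (auto intro!: gr0I)
  have 1: "?d [^] ord ?d = \<one>" using d by simp
  have dn: "?d [^] (ord ?d * k) = \<one>" for k using d 1 by (simp add: nat_pow_pow[symmetric])
  have "y [^] (ord ?d * n) = \<one>" using y(2) by simp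
  then have "x [^] (ord ?d * n) = \<one>" using dn[of n] dk[of "ord ?d * n"] x(1) by simp
  then have "m dvd ord ?d" using x(2) mn(3) by (simp add: coprime_dvd_mult_left_iff)
  have "x [^] (ord ?d * m) = \<one>" using x(2) by simp
  then have "y [^] (ord ?d * m) = \<one>" using dn[of m] dk[of "ord ?d * m"] y(1) by simp
  then have "n dvd ord ?d" using y(2) mn(3) by (simp add: coprime_dvd_mult_left_iff coprime_commute)
  with \<open>m dvd ord ?d\<close> mn(3) have "m * n dvd ord ?d" by (simp add: divides_mult)
  then have "ord c dvd ord ?d" "ord a dvd ord ?d" using mn by (meson dvd_trans)+
  then show ?case using d \<open>ord ?d > 0\<close> c(3) by (intro bexI[of _ ?d]) (auto intro: dvd_trans)
qed

lemma subgroup_nat_pow_closed: "subgroup K G \<Longrightarrow> x \<in> K \<Longrightarrow> x [^] (n::nat) \<in> K"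
  using subgroup_int_pow_closed[of K x "int n"] by (simp add: int_pow_int)

text \<open>Values may have any nonzero modulus, since twists by \<open>exp (T * v x)\<close> leave
  the unit circle. Values outside \<open>K\<close> are arbitrary.\<close>

definition character_on :: "'a set \<Rightarrow> ('a \<Rightarrow> complex) \<Rightarrow> bool" where
  "character_on K \<phi> \<longleftrightarrow> (\<forall>x\<in>K. \<forall>y\<in>K. \<phi> (x \<otimes> y) = \<phi> x * \<phi> y) \<and> (\<forall>x\<in>K. \<phi> x \<noteq> 0)"

lemma character_on_subset: "character_on K \<phi> \<Longrightarrow> K' \<subseteq> K \<Longrightarrow> character_on K' \<phi>"
  unfolding character_on_def by blast

section \<open>Extension of characters from a subgroup\<close>

context
  fixes K \<phi> assumes K: "subgroup K G" and \<phi>: "character_on K \<phi>"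
begin

lemma char_mult: "x \<in> K \<Longrightarrow> y \<in> K \<Longrightarrow> \<phi> (x \<otimes> y) = \<phi> x * \<phi> y"
  and char_nz: "x \<in> K \<Longrightarrow> \<phi> x \<noteq> 0"
  using \<phi> by (auto simp: character_on_def)

lemma char_one: "\<phi> \<one> = 1"
  using char_mult[of \<one> \<one>] char_nz[of \<one>] subgroup.one_closed[OF K] by simp

lemma char_inv: "x \<in> K \<Longrightarrow> \<phi> (inv x) = inverse (\<phi> x)"
  using char_mult[of x "inv x"] char_one char_nz[of x] subgroup.m_inv_closed[OF K] subgroup.mem_carrier[OF K]
  by (simp add: inverse_unique)

lemma char_pow: "x \<in> K \<Longrightarrow> \<phi> (x [^] (n::nat)) = \<phi> x ^ n"
  by (induction n) (simp_all add: char_one char_mult subgroup_nat_pow_closed[OF K])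

lemma char_int_pow:
  assumes x: "x \<in> K"
  shows "\<phi> (x [^] (n::int)) = \<phi> x powi n"
proof (cases "n < 0")
  case True
  have "\<phi> (x [^] n) = \<phi> (inv (x [^] nat (- n)))" using True by (simp only: int_pow_def2 if_True)
  also have "\<dots> = inverse (\<phi> x ^ nat (- n))" by (simp only: char_inv[OF subgroup_nat_pow_closed[OF K x]] char_pow[OF x])
  finally show ?thesis using True by (simp add: power_int_def power_inverse)
next
  case False
  then show ?thesis by (simp only: int_pow_def2 if_False char_pow[OF x]) (simp add: power_int_nonneg_exp)
qed

text \<open>\<open>K\<close> and \<open>g\<close> generate the products
  \<open>k \<otimes> g [^] i\<close>. Two such expressions of an element differ by a power of
  \<open>g\<close> lying in \<open>K\<close>, and \<open>compat\<close> says that both prescriptions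
  agree there.\<close>

lemma extend_character:
  assumes g: "g \<in> carrier G" and c: "c \<noteq> 0"
    and compat: "\<And>i::int. g [^] i \<in> K \<Longrightarrow> \<phi> (g [^] i) = c powi i"
  shows "\<exists>K' \<phi>'. subgroup K' G \<and> insert g K \<subseteq> K' \<and> character_on K' \<phi>' \<and> (\<forall>x\<in>K. \<phi>' x = \<phi> x) \<and> \<phi>' g = c"
proof -
  note mem = subgroup.mem_carrier[OF K]
  define K' where "K' = {k \<otimes> g [^] i | k (i::int). k \<in> K}"
  define \<phi>' where "\<phi>' y = (THE z. \<exists>k (i::int). k \<in> K \<and> y = k \<otimes> g [^] i \<and> z = \<phi> k * c powi i)" for y
  have wd: "\<phi> k * c powi i = \<phi> k' * c powi i'"
    if k: "k \<in> K" "k' \<in> K" and eq: "k \<otimes> g [^] i = k' \<otimes> g [^] i'" for k k' and i i' :: int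
  proof -
    have cl: "k \<in> carrier G" "k' \<in> carrier G" using mem k by auto
    have "g [^] (i - i') = g [^] i \<otimes> inv (g [^] i')" using g by (simp add: int_pow_diff)
    also have "g [^] i = inv k \<otimes> (k' \<otimes> g [^] i')"
      using cl g eq inv_solve_left[of "g [^] i" k "k' \<otimes> g [^] i'"] by simp
    also have "inv k \<otimes> (k' \<otimes> g [^] i') \<otimes> inv (g [^] i') = inv k \<otimes> k'"
      using cl g by (simp add: m_assoc)
    finally have *: "g [^] (i - i') = inv k \<otimes> k'" .
    moreover have ik: "inv k \<otimes> k' \<in> K" "inv k \<in> K" using k K by (simp_all add: subgroup.m_closed subgroup.m_inv_closed)
    ultimately have "c powi (i - i') = \<phi> (inv k \<otimes> k')" using compat[of "i - i'"] by simp
    also have "\<dots> = inverse (\<phi> k) * \<phi> k'" using k ik by (simp add: char_mult char_inv)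
    finally have "c powi i / c powi i' = \<phi> k' / \<phi> k" using c by (simp add: power_int_diff field_simps)
    then show ?thesis using c char_nz[OF k(1)] by (simp add: field_simps)
  qed
  have \<phi>': "\<phi>' (k \<otimes> g [^] i) = \<phi> k * c powi i" if "k \<in> K" for k and i :: int
    unfolding \<phi>'_def
  proof (rule the_equality)
    fix z assume "\<exists>k' (i'::int). k' \<in> K \<and> k \<otimes> g [^] i = k' \<otimes> g [^] i' \<and> z = \<phi> k' * c powi i'"
    then obtain k' and i' :: int where "k' \<in> K" "k \<otimes> g [^] i = k' \<otimes> g [^] i'" "z = \<phi> k' * c powi i'"
      by blast
    then show "z = \<phi> k * c powi i" using wd[OF that] by simp
  qed (use that in blast)
  have mult: "(k \<otimes> g [^] i) \<otimes> (k' \<otimes> g [^] i') = (k \<otimes> k') \<otimes> g [^] (i + i')"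
    if "k \<in> K" "k' \<in> K" for k k' and i i' :: int
    using that mem g by (simp add: int_pow_mult m_ac)
  have one: "\<one> \<in> K" using K by (rule subgroup.one_closed)
  have sub: "subgroup K' G"
  proof (rule subgroupI)
    show "K' \<subseteq> carrier G" using g mem by (auto simp: K'_def)
    show "K' \<noteq> {}" using one by (auto simp: K'_def)
    show "inv a \<in> K'" if "a \<in> K'" for a
    proof -
      from that obtain k and i :: int where "k \<in> K" "a = k \<otimes> g [^] i" by (auto simp: K'_def)
      then have "inv a = inv k \<otimes> g [^] (- i)" "inv k \<in> K"
        using g mem by (simp_all add: inv_mult int_pow_neg subgroup.m_inv_closed[OF K])
      then show ?thesis unfolding K'_def by blast
    qed
    show "a \<otimes> b \<in> K'" if "a \<in> K'" "b \<in> K'" for a b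
      using that mult subgroup.m_closed[OF K] unfolding K'_def by blast
  qed
  have K_eq: "k = k \<otimes> g [^] (0::int)" if "k \<in> K" for k using mem[OF that] by simp
  have "K \<subseteq> K'" using K_eq unfolding K'_def by blast
  moreover have g_eq: "g = \<one> \<otimes> g [^] (1::int)" using g by simp
  then have "g \<in> K'" using one unfolding K'_def by blast
  moreover have "\<phi>' k = \<phi> k" if "k \<in> K" for k using \<phi>'[OF that, of 0] K_eq[OF that] by simp
  moreover have "\<phi>' g = c" using \<phi>'[OF one, of 1] g char_one by simp
  moreover have "character_on K' \<phi>'"
    unfolding character_on_def
  proof (intro conjI ballI)
    fix x y assume "x \<in> K'" "y \<in> K'"
    then obtain k k' and i i' :: int where *: "k \<in> K" "k' \<in> K" "x = k \<otimes> g [^] i" "y = k' \<otimes> g [^] i'"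
      by (auto simp: K'_def)
    have "\<phi>' (x \<otimes> y) = \<phi> (k \<otimes> k') * c powi (i + i')"
      unfolding * mult[OF *(1,2)] using * by (intro \<phi>' subgroup.m_closed[OF K])
    then show "\<phi>' (x \<otimes> y) = \<phi>' x * \<phi>' y"
      using * c by (simp add: \<phi>' char_mult power_int_add)
  next
    fix x assume "x \<in> K'"
    then show "\<phi>' x \<noteq> 0" using \<phi>' char_nz c by (auto simp: K'_def)
  qed
  ultimately show ?thesis using sub by blast
qed

text \<open>Nonzero complex numbers have roots: with \<open>n\<close> the least positive exponent
  such that \<open>g [^] n \<in> K\<close>, an \<open>n\<close>-th root of the value there will do.
  If there is no such \<open>n\<close>, only \<open>i = 0\<close> imposes a condition and 1
  works.\<close>

lemma compatible_value:
  assumes g: "g \<in> carrier G"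
  shows "\<exists>c. c \<noteq> 0 \<and> (\<forall>i::int. g [^] i \<in> K \<longrightarrow> \<phi> (g [^] i) = c powi i)"
proof (cases "\<exists>n::nat. n > 0 \<and> g [^] n \<in> K")
  case True
  define n where "n = (LEAST n::nat. n > 0 \<and> g [^] n \<in> K)"
  have n: "n > 0" "g [^] n \<in> K" using LeastI_ex[OF True] by (auto simp: n_def)
  have least: "m = 0" if "m < n" "g [^] m \<in> K" for m :: nat
    using not_less_Least[of m "\<lambda>n. n > 0 \<and> g [^] n \<in> K"] that by (auto simp: n_def)
  obtain c where c: "c \<noteq> 0" "\<phi> (g [^] n) = c ^ n"
    using exists_complex_root_nonzero[of "\<phi> (g [^] n)" n] char_nz[OF n(2)] n(1) by auto
  have "\<phi> (g [^] i) = c powi i" if i: "g [^] i \<in> K" for i :: int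
  proof -
    define q where "q = i div int n"
    define s where "s = nat (i mod int n)"
    have s: "int s = i mod int n" using n by (simp add: s_def)
    then have "s < n" using n by (metis of_nat_less_iff of_nat_0_less_iff pos_mod_bound)
    have i_eq: "i = int n * q + int s" unfolding s q_def by simp
    have gq: "g [^] (int n * q) = (g [^] n) [^] q" using g by (simp add: int_pow_pow int_pow_int[symmetric])
    then have gqK: "g [^] (int n * q) \<in> K" using n(2) subgroup_int_pow_closed[OF K] by simp
    have "g [^] s = g [^] (i - int n * q)" unfolding i_eq by (simp add: int_pow_int)
    also have "\<dots> = g [^] i \<otimes> inv (g [^] (int n * q))" using g by (simp add: int_pow_diff)
    also have "\<dots> \<in> K" using i gqK K by (simp add: subgroup.m_closed subgroup.m_inv_closed)
    finally have "s = 0" using least \<open>s < n\<close> by blast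
    then have "i = int n * q" using i_eq by simp
    then show ?thesis using gq char_int_pow[OF n(2), of q] c by (simp add: power_int_power)
  qed
  then show ?thesis using c by blast
next
  case False
  have "i = 0" if i: "g [^] i \<in> K" for i :: int
  proof (rule ccontr)
    assume "i \<noteq> 0"
    moreover have "g [^] nat \<bar>i\<bar> \<in> K"
    proof (cases "i \<ge> 0")
      case True
      then show ?thesis using i by (simp add: int_pow_int[symmetric])
    next
      case False
      then have "g [^] nat \<bar>i\<bar> = inv (g [^] i)" using g by (simp add: int_pow_int[symmetric] int_pow_neg)
      then show ?thesis using i K by (simp add: subgroup.m_inv_closed)
    qed
    ultimately show False using False by (metis zero_less_abs_iff zero_less_nat_eq)
  qed
  then have "\<phi> (g [^] i) = 1" if "g [^] i \<in> K" for i :: int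
    using that char_one by (metis int_pow_0)
  then show ?thesis by (intro exI[of _ 1]) auto
qed

end

lemma extend_character_finite:
  assumes "finite S" "S \<subseteq> carrier G" "subgroup K G" "character_on K \<phi>"
  shows "\<exists>K' \<phi>'. subgroup K' G \<and> K \<union> S \<subseteq> K' \<and> character_on K' \<phi>' \<and> (\<forall>x\<in>K. \<phi>' x = \<phi> x)"
  using assms
proof (induction S rule: finite_induct)
  case empty
  then show ?case by auto
next
  case (insert g S)
  then obtain K' \<phi>' where K': "subgroup K' G" "K \<union> S \<subseteq> K'" "character_on K' \<phi>'" "\<forall>x\<in>K. \<phi>' x = \<phi> x"
    by auto
  have g: "g \<in> carrier G" using insert by auto
  obtain c where c: "c \<noteq> 0" "\<And>i::int. g [^] i \<in> K' \<Longrightarrow> \<phi>' (g [^] i) = c powi i"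
    using compatible_value[OF K'(1,3) g] by blast
  obtain K'' \<phi>'' where "subgroup K'' G" "insert g K' \<subseteq> K''" "character_on K'' \<phi>''" "\<forall>x\<in>K'. \<phi>'' x = \<phi>' x"
    using extend_character[OF K'(1,3) g c] by blast
  then show ?case using K' by (intro exI[of _ K''] exI[of _ \<phi>'']) auto
qed

lemma exists_character_with_value:
  assumes S: "finite S" "S \<subseteq> carrier G" and a: "a \<in> generate G S" and c: "c \<noteq> 0"
    and compat: "\<And>i::int. a [^] i = \<one> \<Longrightarrow> c powi i = 1"
  shows "\<exists>\<phi>. character_on (generate G S) \<phi> \<and> \<phi> a = c"
proof -
  have aG: "a \<in> carrier G" using generate_incl[OF S(2)] a by blast
  have triv: "subgroup {\<one>} G" "character_on {\<one>} (\<lambda>_. 1)"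
    by (auto simp: triv_subgroup character_on_def)
  obtain K1 \<phi>1 where 1: "subgroup K1 G" "insert a {\<one>} \<subseteq> K1" "character_on K1 \<phi>1" "\<phi>1 a = c"
    using extend_character[OF triv aG c] compat by auto
  obtain K2 \<phi>2 where 2: "subgroup K2 G" "K1 \<union> S \<subseteq> K2" "character_on K2 \<phi>2" "\<forall>x\<in>K1. \<phi>2 x = \<phi>1 x"
    using extend_character_finite[OF S 1(1,3)] by blast
  have "generate G S \<subseteq> K2" using generate_subgroup_incl[OF _ 2(1)] 2(2) by blast
  then show ?thesis using 1 2 character_on_subset by (intro exI[of _ \<phi>2]) auto
qed

section \<open>Unitary characters and additive functions\<close>

definition unitary_on :: "'a set \<Rightarrow> ('a \<Rightarrow> complex) \<Rightarrow> bool" where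
  "unitary_on K \<phi> \<longleftrightarrow> character_on K \<phi> \<and> (\<forall>x\<in>K. norm (\<phi> x) = 1)"

definition additive_on :: "'a set \<Rightarrow> ('a \<Rightarrow> real) \<Rightarrow> bool" where
  "additive_on K v \<longleftrightarrow> (\<forall>x\<in>K. \<forall>y\<in>K. v (x \<otimes> y) = v x + v y)"

text \<open>The value prescribed at \<open>a\<close> is a primitive root of unity of order
  \<open>ord a\<close>, or \<open>- 1\<close> if the order is infinite.\<close>

lemma unitary_separates:
  assumes S: "finite S" "S \<subseteq> carrier G" and a: "a \<in> generate G S" "a \<noteq> \<one>"
  shows "\<exists>\<phi>. unitary_on (generate G S) \<phi> \<and> \<phi> a \<noteq> 1"
proof -
  have aG: "a \<in> carrier G" using generate_incl[OF S(2)] a by blast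
  then have ord1: "ord a \<noteq> 1" using a by (metis ord_eq_1)
  obtain c :: complex where c: "norm c = 1" "c \<noteq> 1" "\<And>i::int. a [^] i = \<one> \<Longrightarrow> c powi i = 1"
  proof (cases "ord a = 0")
    case True
    have "(- 1 :: complex) powi i = 1" if "a [^] i = \<one>" for i :: int
      using that aG True by (simp add: int_pow_eq_id)
    then show ?thesis using that[of "- 1"] by simp
  next
    case False
    define c where "c = exp (2 * of_real pi * \<i> * of_nat 1 / of_nat (ord a))"
    have "c \<noteq> 1" unfolding c_def using ord1 False by (subst complex_root_unity_eq_1) auto
    moreover have "c ^ ord a = 1" unfolding c_def using complex_root_unity[of "ord a" 1] False by simp
    moreover have "norm c = 1" by (simp add: c_def)
    moreover have "c powi i = 1" if i: "a [^] i = \<one>" for i :: int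
    proof -
      obtain q where "i = int (ord a) * q" using i aG by (auto simp: int_pow_eq_id elim!: dvdE)
      then show ?thesis using \<open>c ^ ord a = 1\<close> by (simp flip: power_int_power)
    qed
    ultimately show ?thesis using that by blast
  qed
  then have "c \<noteq> 0" by auto
  then obtain \<phi> where \<phi>: "character_on (generate G S) \<phi>" "\<phi> a = c"
    using exists_character_with_value[OF S a(1) _ c(3)] by blast
  \<comment> \<open>Dividing by the modulus makes the character unitary without changing its value
    at \<open>a\<close>.\<close>
  have "unitary_on (generate G S) (\<lambda>x. sgn (\<phi> x))"
    using \<phi>(1) by (auto simp: unitary_on_def character_on_def sgn_mult norm_sgn sgn_zero_iff)
  moreover have "sgn (\<phi> a) = c" using \<phi>(2) c(1) by (simp add: sgn_div_norm)
  ultimately show ?thesis using c(2) by auto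
qed

text \<open>An element of infinite order admits a character with value 2; the logarithm of its
  modulus is additive.\<close>

lemma additive_nonzero_at:
  assumes S: "finite S" "S \<subseteq> carrier G" and a: "a \<in> generate G S" "ord a = 0"
  shows "\<exists>v. additive_on (generate G S) v \<and> v a \<noteq> 0"
proof -
  have aG: "a \<in> carrier G" using generate_incl[OF S(2)] a by blast
  have "\<And>i::int. a [^] i = \<one> \<Longrightarrow> (2::complex) powi i = 1" using aG a by (auto simp: int_pow_eq_id)
  then obtain \<phi> where \<phi>: "character_on (generate G S) \<phi>" "\<phi> a = 2"
    using exists_character_with_value[OF S a(1), of 2] by auto
  have "additive_on (generate G S) (\<lambda>x. ln (norm (\<phi> x)))"
    using \<phi>(1) by (auto simp: additive_on_def character_on_def norm_mult ln_mult)
  then show ?thesis using \<phi>(2) by (intro exI[of _ "\<lambda>x. ln (norm (\<phi> x))"]) auto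
qed

lemma additive_nonzero_on:
  assumes S: "finite S" "S \<subseteq> carrier G" and "finite T" "T \<subseteq> generate G S" "\<And>a. a \<in> T \<Longrightarrow> ord a = 0"
  shows "\<exists>v. additive_on (generate G S) v \<and> (\<forall>a\<in>T. v a \<noteq> 0)"
  using assms(3-)
proof (induction T rule: finite_induct)
  case empty
  then show ?case by (intro exI[of _ "\<lambda>_. 0"]) (auto simp: additive_on_def)
next
  case (insert a T)
  then obtain v where v: "additive_on (generate G S) v" "\<forall>a\<in>T. v a \<noteq> 0" by auto
  have "a \<in> generate G S" "ord a = 0" using insert.prems by auto
  from additive_nonzero_at[OF S this] obtain w where w: "additive_on (generate G S) w" "w a \<noteq> 0"
    by blast
  have "infinite (UNIV :: real set)" by (rule infinite_UNIV_char_0)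
  \<comment> \<open>For each \<open>b\<close> at most one value of \<open>e\<close> makes
    \<open>v b + e * w b\<close> vanish, so only a finite set has to be avoided.\<close>
  then obtain e where e: "e \<notin> (\<lambda>b. - v b / w b) ` insert a T \<union> {0}"
    using insert.hyps by (metis ex_new_if_finite finite.emptyI finite.insertI finite_Un finite_imageI)
  have "additive_on (generate G S) (\<lambda>x. v x + e * w x)"
    using v w by (simp add: additive_on_def algebra_simps)
  moreover have "v b + e * w b \<noteq> 0" if "b \<in> insert a T" for b
  proof (cases "w b = 0")
    case True
    then show ?thesis using that v w by auto
  next
    case False
    have "e \<noteq> - v b / w b" using that e by blast
    then have "e * w b \<noteq> - v b" using False nonzero_eq_divide_eq[of "w b" e "- v b"] by blast
    then show ?thesis by linarith
  qed
  ultimately show ?case by blast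
qed

end

section \<open>Relations between characters\<close>

text \<open>The first-order expansion \<open>ln |1 + z x| = x Re z + o(x)\<close> at
  \<open>x = exp (T * v)\<close>, which tends to 0 from above.\<close>

lemma ln_norm_one_plus_small:
  fixes z :: complex
  assumes "v < 0"
  shows "((\<lambda>T. ln (norm (1 + z * of_real (exp (T * v)))) / exp (T * v)) \<longlongrightarrow> Re z) at_top"
proof -
  have "((\<lambda>h. Ln (1 + z * h)) has_field_derivative z) (at 0)"
    by (auto intro!: derivative_eq_intros)
  then have "((\<lambda>h. Ln (1 + z * h) / h) \<longlongrightarrow> z) (at 0)"
    by (simp add: DERIV_def)
  moreover have "filterlim complex_of_real (at 0) (at_right 0)"
    unfolding filterlim_at by (auto intro!: tendsto_eq_intros simp: eventually_at_filter)
  ultimately have "((\<lambda>x. Ln (1 + z * of_real x) / of_real x) \<longlongrightarrow> z) (at_right 0)"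
    by (rule filterlim_compose)
  from tendsto_Re[OF this] have *: "((\<lambda>x. Re (Ln (1 + z * of_real x)) / x) \<longlongrightarrow> Re z) (at_right 0)"
    by (simp add: Re_divide_of_real)
  have "((\<lambda>x. 1 + z * of_real x) \<longlongrightarrow> 1) (at_right 0)" by (auto intro!: tendsto_eq_intros)
  then have "\<forall>\<^sub>F x in at_right 0. 1 + z * of_real x \<noteq> 0" by (rule tendsto_imp_eventually_ne) simp
  then have "\<forall>\<^sub>F x in at_right 0. Re (Ln (1 + z * of_real x)) / x = ln (norm (1 + z * of_real x)) / x"
    by eventually_elim simp
  from Lim_transform_eventually[OF * this]
  have **: "((\<lambda>x. ln (norm (1 + z * of_real x)) / x) \<longlongrightarrow> Re z) (at_right 0)" .
  have "filterlim (\<lambda>T. T * v) at_bot at_top"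
    using assms by (simp add: filterlim_tendsto_neg_mult_at_bot_iff[OF tendsto_const] mult.commute[of _ v] filterlim_ident)
  then have "((\<lambda>T. exp (T * v)) \<longlongrightarrow> 0) at_top" by (rule filterlim_compose[OF exp_at_bot])
  then have "filterlim (\<lambda>T. exp (T * v)) (at_right 0) at_top"
    by (simp add: filterlim_at)
  from filterlim_compose[OF ** this] show ?thesis .
qed

lemma ln_norm_one_plus_smaller:
  fixes z :: complex
  assumes "v < 0" "v < w"
  shows "((\<lambda>T. ln (norm (1 + z * of_real (exp (T * v)))) / exp (T * w)) \<longlongrightarrow> 0) at_top"
proof -
  have "filterlim (\<lambda>T. (v - w) * T) at_bot at_top"
    using assms by (simp add: filterlim_tendsto_neg_mult_at_bot_iff[OF tendsto_const] filterlim_ident)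
  then have "((\<lambda>T. exp ((v - w) * T)) \<longlongrightarrow> 0) at_top" by (rule filterlim_compose[OF exp_at_bot])
  from tendsto_mult[OF ln_norm_one_plus_small[OF assms(1), of z] this]
  have "((\<lambda>T. ln (norm (1 + z * of_real (exp (T * v)))) / exp (T * v) * exp ((v - w) * T)) \<longlongrightarrow> 0) at_top"
    by simp
  moreover have "y / exp (T * v) * exp ((v - w) * T) = y / exp (T * w)" for y T :: real
    by (simp add: left_diff_distrib exp_diff mult.commute[of T])
  ultimately show ?thesis by (simp only:)
qed

lemma affine_plus_vanishing_eq_0:
  fixes c \<kappa> :: real
  assumes e: "(e \<longlongrightarrow> 0) at_top" and z: "\<And>T. T > 0 \<Longrightarrow> c + T * \<kappa> + e T = 0"
  shows "c = 0" "\<kappa> = 0"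
proof -
  have "((\<lambda>T. (c + e T) / T) \<longlongrightarrow> 0) at_top"
    by (rule tendsto_divide_0[OF tendsto_add[OF tendsto_const e]])
       (rule filterlim_at_top_imp_at_infinity[OF filterlim_ident])
  moreover have "\<forall>\<^sub>F T in at_top. (c + e T) / T = - \<kappa>"
    using eventually_gt_at_top[of 0] by eventually_elim (use z in \<open>simp add: field_simps, smt (verit)\<close>)
  ultimately have "((\<lambda>T::real. - \<kappa>) \<longlongrightarrow> 0) at_top" by (rule Lim_transform_eventually)
  then show \<kappa>: "\<kappa> = 0" by (simp add: tendsto_const_iff)
  have "\<forall>\<^sub>F T in at_top. e T = - c"
    using eventually_gt_at_top[of 0] by eventually_elim (use z \<kappa> in \<open>force\<close>)
  from Lim_transform_eventually[OF e this] show "c = 0" by (simp add: tendsto_const_iff)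
qed

section \<open>Independence of unitary characters and twists by additive functions\<close>

context comm_group
begin

lemma unitary_on_mult:
  "unitary_on K \<phi> \<Longrightarrow> unitary_on K \<theta> \<Longrightarrow> unitary_on K (\<lambda>x. \<phi> x * \<theta> x)"
  by (auto simp: unitary_on_def character_on_def norm_mult)

lemma unitary_on_power_int: "unitary_on K \<phi> \<Longrightarrow> unitary_on K (\<lambda>x. \<phi> x powi k)"
  by (auto simp: unitary_on_def character_on_def norm_power_int power_int_mult_distrib)

lemma unitary_on_inv:
  assumes "subgroup K G" "unitary_on K \<phi>" "x \<in> K"
  shows "\<phi> (inv x) = cnj (\<phi> x)"
proof -
  have "norm (\<phi> x) = 1" "\<phi> (inv x) = inverse (\<phi> x)"
    using assms by (auto simp: unitary_on_def char_inv)
  then show ?thesis using complex_norm_square[of "\<phi> x"] by (simp add: inverse_unique)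
qed

lemma unitary_independence:
  fixes g :: "'a \<Rightarrow> real"
  assumes S: "finite S" "S \<subseteq> carrier G" and T: "T \<subseteq> generate G S" "finite T"
    and z: "\<And>\<phi>. unitary_on (generate G S) \<phi> \<Longrightarrow> (\<Sum>a\<in>T. of_real (g a) * \<phi> a) = 0"
    and a: "a \<in> T"
  shows "g a = 0"
proof -
  note K = generate_is_subgroup[OF S(2)]
  have "\<forall>a\<in>T. complex_of_real (g a) = 0"
  proof (rule independence_of_characters[where M = "Collect (unitary_on (generate G S))"])
    show "\<exists>\<phi>\<in>Collect (unitary_on (generate G S)). \<phi> a \<noteq> \<phi> b" if ab: "a \<in> T" "b \<in> T" "a \<noteq> b" for a b
    proof -
      have K_ab: "a \<in> generate G S" "b \<in> generate G S" using ab T by auto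
      then have cl: "a \<in> carrier G" "b \<in> carrier G" using subgroup.mem_carrier[OF K] by auto
      have x: "a \<otimes> inv b \<in> generate G S" using K_ab K by (simp add: subgroup.m_closed subgroup.m_inv_closed)
      have "a \<otimes> inv b \<noteq> \<one>" using cl ab(3) by (metis inv_closed inv_equality inv_inv)
      from unitary_separates[OF S x this] obtain \<phi> where
        \<phi>: "unitary_on (generate G S) \<phi>" "\<phi> (a \<otimes> inv b) \<noteq> 1" by blast
      then have ch: "character_on (generate G S) \<phi>" by (simp add: unitary_on_def)
      have "\<phi> (a \<otimes> inv b) = \<phi> a * inverse (\<phi> b)"
        using K_ab by (simp add: char_mult[OF K ch] char_inv[OF K ch] subgroup.m_inv_closed[OF K])
      then have "\<phi> a \<noteq> \<phi> b" using \<phi>(2) char_nz[OF K ch K_ab(2)] by auto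
      then show ?thesis using \<phi>(1) by blast
    qed
    show "\<exists>\<phi>\<in>Collect (unitary_on (generate G S)). \<phi> a \<noteq> 0" for a
      by (intro bexI[of _ "\<lambda>_. 1"]) (auto simp: unitary_on_def character_on_def)
  qed (use z T unitary_on_mult in auto)
  then show ?thesis using a by simp
qed

context
  fixes K v assumes K: "subgroup K G" and v: "additive_on K v"
begin

lemma additive_mult: "x \<in> K \<Longrightarrow> y \<in> K \<Longrightarrow> v (x \<otimes> y) = v x + v y"
  using v by (simp add: additive_on_def)

lemma additive_one: "v \<one> = 0"
  using additive_mult[of \<one> \<one>] subgroup.one_closed[OF K] by simp

lemma additive_inv: "x \<in> K \<Longrightarrow> v (inv x) = - v x"
  using additive_mult[of x "inv x"] additive_one subgroup.m_inv_closed[OF K] subgroup.mem_carrier[OF K]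
  by simp

lemma additive_pow: "x \<in> K \<Longrightarrow> v (x [^] (n::nat)) = real n * v x"
  by (induction n) (simp_all add: additive_one additive_mult subgroup_nat_pow_closed[OF K] algebra_simps)

lemma additive_finite_order: "x \<in> K \<Longrightarrow> ord x > 0 \<Longrightarrow> v x = 0"
  using additive_pow[of x "ord x"] additive_one subgroup.mem_carrier[OF K] by simp

lemma character_twist: "unitary_on K \<phi> \<Longrightarrow> character_on K (\<lambda>x. \<phi> x * of_real (exp (T * v x)))"
  using v by (auto simp: unitary_on_def character_on_def additive_on_def distrib_left exp_add)

end

end

text \<open>In the application \<open>f\<close> is the difference of two multiplicity functions. The
  relation is the logarithm of the modulus of \<open>character_FS\<close>, assumed only where no
  factor \<open>1 + \<phi> a\<close> is 0.\<close>

locale FS_relation = comm_group G for G (structure) +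
  fixes S :: "'a set" and f :: "'a \<Rightarrow> real"
  assumes finite_S: "finite S" and S_carrier: "S \<subseteq> carrier G"
    and inv_S: "a \<in> S \<Longrightarrow> inv a \<in> S"
    and orders: "a \<in> carrier G \<Longrightarrow> ord a > 0 \<Longrightarrow> ord a \<in> O_FS"
    and relation: "character_on (generate G S) \<phi> \<Longrightarrow> (\<And>a. a \<in> S \<Longrightarrow> 1 + \<phi> a \<noteq> 0) \<Longrightarrow>
      (\<Sum>a\<in>S. f a * ln (norm (1 + \<phi> a))) = 0"
begin

abbreviation "K \<equiv> generate G S"
definition "g a = f a + f (inv a)"
definition "S0 = {a \<in> S. ord a > 0}"

lemma K: "subgroup K G"
  by (rule generate_is_subgroup[OF S_carrier])

lemma S_K: "S \<subseteq> K"
  by (rule subsetI) (rule generate.incl)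

lemma S0_subset: "S0 \<subseteq> S"
  by (simp add: S0_def)

lemma inv_inv_S: "a \<in> S \<Longrightarrow> inv (inv a) = a"
  using S_carrier by auto

lemma g_inv: "a \<in> S \<Longrightarrow> g (inv a) = g a"
  by (simp add: g_def inv_inv_S add.commute)

lemma sum_inv:
  assumes "X \<subseteq> S" "\<And>a. a \<in> X \<Longrightarrow> inv a \<in> X"
  shows "(\<Sum>a\<in>X. F (inv a)) = (\<Sum>a\<in>X. F a :: real)"
  by (rule sum.reindex_bij_witness[where i = "\<lambda>a. inv a" and j = "\<lambda>a. inv a"])
     (use assms inv_inv_S in auto)

text \<open>Pairing \<open>a\<close> with its inverse cancels the imaginary parts, so vanishing real
  parts already give the complex relation that \<open>unitary_independence\<close> needs.\<close>

lemma symmetric_sum_eq_0: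
  assumes X: "X \<subseteq> S" "\<And>a. a \<in> X \<Longrightarrow> inv a \<in> X" and a: "a \<in> X"
    and z: "\<And>\<phi>. unitary_on K \<phi> \<Longrightarrow> (\<Sum>a\<in>X. g a * Re (\<phi> a)) = 0"
  shows "g a = 0"
proof (rule unitary_independence[OF finite_S S_carrier, of X])
  fix \<phi> assume \<phi>: "unitary_on K \<phi>"
  have "(\<Sum>a\<in>X. g a * Im (\<phi> a)) = (\<Sum>a\<in>X. g (inv a) * Im (\<phi> (inv a)))"
    using sum_inv[OF X, of "\<lambda>a. g a * Im (\<phi> a)"] by simp
  also have "\<dots> = (\<Sum>a\<in>X. - (g a * Im (\<phi> a)))"
    using X S_K by (intro sum.cong) (auto simp: g_inv unitary_on_inv[OF K \<phi>] subset_iff)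
  finally have "(\<Sum>a\<in>X. g a * Im (\<phi> a)) = 0" by (simp add: sum_negf)
  then show "(\<Sum>a\<in>X. complex_of_real (g a) * \<phi> a) = 0"
    using z[OF \<phi>] by (simp add: complex_eq_iff)
qed (use X S_K finite_S a in \<open>auto intro: finite_subset\<close>)

text \<open>Orders in \<open>O_FS\<close> are odd, while \<open>- 1\<close> has order 2.\<close>

lemma one_plus_finite_order_neq_0:
  assumes "character_on K \<phi>" "a \<in> S0"
  shows "1 + \<phi> a \<noteq> 0"
proof
  assume "1 + \<phi> a = 0"
  then have "\<phi> a = - 1" by (simp add: add_eq_0_iff)
  moreover have a: "a \<in> K" "a \<in> carrier G" "ord a > 0" using assms S_K S_carrier by (auto simp: S0_def)
  then have "\<phi> a ^ ord a = 1"
    using char_pow[OF K assms(1), of a "ord a"] char_one[OF K assms(1)] by simp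
  moreover have "odd (ord a)" using orders[OF a(2,3)] by (simp add: O_FS_def)
  ultimately show False by simp
qed

text \<open>Twisting a unitary character by \<open>exp (T v)\<close> and letting \<open>T\<close> tend to infinity separates
  the elements of finite order from those of infinite order.\<close>

lemma relation_limit:
  fixes \<phi> v
  assumes v: "additive_on K v" "\<And>a. a \<in> S - S0 \<Longrightarrow> v a \<noteq> 0" and \<phi>: "unitary_on K \<phi>"
  shows "(\<Sum>a\<in>S0. f a * ln (norm (1 + \<phi> a))) = 0"
    and "T > 0 \<Longrightarrow> (\<Sum>a | a \<in> S \<and> v a < 0. g a * ln (norm (1 + \<phi> a * of_real (exp (T * v a))))) = 0"
proof -
  define N where "N = {a \<in> S. v a < 0}"
  define P where "P = {a \<in> S. v a > 0}"
  define l where "l T a = ln (norm (1 + \<phi> a * of_real (exp (T * v a))))" for T a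
  have fin: "finite N" "finite P" "finite S0" using finite_S by (auto simp: N_def P_def S0_def)
  have S0: "v a = 0" if "a \<in> S0" for a
    using that additive_finite_order[OF K v(1)] S_K by (auto simp: S0_def)
  have vinv: "v (inv a) = - v a" if "a \<in> S" for a using that additive_inv[OF K v(1)] S_K by blast
  have S_eq: "S = S0 \<union> N \<union> P" using v(2) by (force simp: S0_def N_def P_def)
  have disj: "S0 \<inter> N = {}" "(S0 \<union> N) \<inter> P = {}" using S0 by (force simp: N_def P_def)+
  have \<phi>1: "norm (\<phi> a) = 1" if "a \<in> S" for a using \<phi> that S_K by (auto simp: unitary_on_def)
  \<comment> \<open>A constant, a term linear in \<open>T\<close> and a term tending to 0: by
    \<open>affine_plus_vanishing_eq_0\<close> each vanishes.\<close>
  have main: "(\<Sum>a\<in>S0. f a * ln (norm (1 + \<phi> a))) + T * (- (\<Sum>a\<in>N. f (inv a) * v a)) + (\<Sum>a\<in>N. g a * l T a) = 0"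
    if T: "T > 0" for T
  proof -
    have nz: "1 + \<phi> a * of_real (exp (T * v a)) \<noteq> 0" if a: "a \<in> S" for a
    proof (cases "a \<in> S0")
      case True
      then show ?thesis using one_plus_finite_order_neq_0[of \<phi> a] \<phi> S0 by (auto simp: unitary_on_def)
    next
      case False
      then have "v a \<noteq> 0" using v(2) a by blast
      then have "exp (T * v a) \<noteq> 1" using T by simp
      moreover have "norm (\<phi> a * of_real (exp (T * v a))) = exp (T * v a)"
        using \<phi>1[OF a] by (simp add: norm_mult)
      ultimately show ?thesis by (metis add_eq_0_iff norm_minus_cancel norm_one)
    qed
    \<comment> \<open>With \<open>z\<close> the twisted value at \<open>a\<close>,
      \<open>1 + 1 / z = (1 + z) / z\<close>. This folds the growing terms over \<open>P\<close>
      onto \<open>N\<close> and produces the part linear in \<open>T\<close>.\<close>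
    have linv: "l T (inv a) = l T a - T * v a" if a: "a \<in> S" for a
    proof -
      define z where "z = \<phi> a * of_real (exp (T * v a))"
      have z: "z \<noteq> 0" "norm z = exp (T * v a)" "1 + z \<noteq> 0"
        using \<phi>1[OF a] nz[OF a] by (auto simp: z_def norm_mult)
      have "\<phi> (inv a) * of_real (exp (T * v (inv a))) = inverse z"
        using char_inv[OF K, of \<phi> a] \<phi> a S_K vinv[OF a]
        by (auto simp: unitary_on_def z_def exp_minus of_real_inverse)
      then have "l T (inv a) = ln (norm (1 + inverse z))" by (simp only: l_def)
      also have "1 + inverse z = (1 + z) / z" using z by (simp add: field_simps)
      also have "ln (norm ((1 + z) / z)) = ln (norm (1 + z)) - T * v a"
        using z by (simp only: norm_divide) (simp add: ln_div)
      also have "ln (norm (1 + z)) = l T a" by (simp only: l_def z_def)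
      finally show ?thesis .
    qed
    have "0 = (\<Sum>a\<in>S. f a * l T a)"
      unfolding l_def using relation[OF character_twist[OF K v(1) \<phi>] nz] by simp
    also have "\<dots> = (\<Sum>a\<in>S0 \<union> N \<union> P. f a * l T a)"
      by (rule arg_cong[OF S_eq])
    also have "\<dots> = (\<Sum>a\<in>S0. f a * l T a) + (\<Sum>a\<in>N. f a * l T a) + (\<Sum>a\<in>P. f a * l T a)"
      using fin disj by (simp add: sum.union_disjoint)
    also have "(\<Sum>a\<in>S0. f a * l T a) = (\<Sum>a\<in>S0. f a * ln (norm (1 + \<phi> a)))"
      by (rule sum.cong) (auto simp: l_def S0)
    also have "(\<Sum>a\<in>P. f a * l T a) = (\<Sum>a\<in>N. f (inv a) * l T (inv a))"
      by (rule sum.reindex_bij_witness[where i = "\<lambda>a. inv a" and j = "\<lambda>a. inv a"])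
         (auto simp: N_def P_def inv_S inv_inv_S vinv)
    also have "\<dots> = (\<Sum>a\<in>N. f (inv a) * (l T a - T * v a))"
      by (rule sum.cong) (auto simp: N_def linv)
    finally show ?thesis
      by (simp add: g_def algebra_simps sum.distrib sum_subtractf sum_distrib_left)
  qed
  have lim: "((\<lambda>T. \<Sum>a\<in>N. g a * l T a) \<longlongrightarrow> 0) at_top"
  proof -
    have "((\<lambda>T. l T a) \<longlongrightarrow> 0) at_top" if "a \<in> N" for a
      using ln_norm_one_plus_smaller[of "v a" 0 "\<phi> a"] that by (simp add: l_def N_def)
    then have "((\<lambda>T. \<Sum>a\<in>N. g a * l T a) \<longlongrightarrow> (\<Sum>a\<in>N. g a * 0)) at_top" by (intro tendsto_intros)
    then show ?thesis by simp
  qed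
  note zero = affine_plus_vanishing_eq_0[OF lim main]
  show "(\<Sum>a\<in>S0. f a * ln (norm (1 + \<phi> a))) = 0" using zero(1) by simp
  show "(\<Sum>a | a \<in> S \<and> v a < 0. g a * ln (norm (1 + \<phi> a * of_real (exp (T * v a))))) = 0" if "T > 0"
    using main[OF that] zero by (simp add: N_def l_def)
qed

lemma exists_separating_additive: "\<exists>v. additive_on K v \<and> (\<forall>a\<in>S - S0. v a \<noteq> 0)"
proof (rule additive_nonzero_on[OF finite_S S_carrier])
  show "finite (S - S0)" using finite_S by (rule finite_Diff)
  show "S - S0 \<subseteq> K" using S_K by (rule Diff_subset[THEN subset_trans])
  show "ord a = 0" if "a \<in> S - S0" for a using that by (simp add: S0_def)
qed

text \<open>Among the elements with \<open>g a \<noteq> 0\<close> and \<open>v a < 0\<close>, those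
  with the largest value \<open>w\<close> of \<open>v\<close> dominate. Dividing by
  \<open>exp (T * w)\<close> and letting \<open>T\<close> grow leaves a relation on that level set
  \<open>M\<close>, valid for every unitary character.\<close>

lemma g_negative_eq_0:
  assumes v: "additive_on K v" "\<And>a. a \<in> S - S0 \<Longrightarrow> v a \<noteq> 0" and b: "b \<in> S" "v b < 0"
  shows "g b = 0"
proof (rule ccontr)
  assume "g b \<noteq> 0"
  define N where "N = {a \<in> S. v a < 0}"
  define N' where "N' = {a \<in> N. g a \<noteq> 0}"
  have fin: "finite N" "finite N'" using finite_S by (auto simp: N_def N'_def)
  have "b \<in> N'" using b \<open>g b \<noteq> 0\<close> by (auto simp: N_def N'_def)
  define w where "w = Max (v ` N')"
  have "w \<in> v ` N'" unfolding w_def using fin \<open>b \<in> N'\<close> by (intro Max_in) auto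
  then obtain a0 where a0: "a0 \<in> N'" "v a0 = w" by auto
  have le: "v a \<le> w" if "a \<in> N'" for a unfolding w_def using fin that by (intro Max_ge) auto
  have w: "w < 0" using a0 by (auto simp: N'_def N_def)
  define M where "M = {a \<in> N'. v a = w}"
  have vinv: "v (inv a) = - v a" if "a \<in> S" for a using that additive_inv[OF K v(1)] S_K by blast
  have ReM: "(\<Sum>a\<in>M. g a * Re (\<phi> a)) = 0" if \<phi>: "unitary_on K \<phi>" for \<phi>
  proof -
    define l where "l T a = ln (norm (1 + \<phi> a * of_real (exp (T * v a)))) / exp (T * w)" for T a
    have "((\<lambda>T. l T a) \<longlongrightarrow> (if v a = w then Re (\<phi> a) else 0)) at_top" if "a \<in> N'" for a
    proof (cases "v a = w")
      case True
      then show ?thesis using ln_norm_one_plus_small[of "v a" "\<phi> a"] w by (simp add: l_def)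
    next
      case False
      then show ?thesis using ln_norm_one_plus_smaller[of "v a" w "\<phi> a"] w le[OF that] by (simp add: l_def)
    qed
    then have "((\<lambda>T. \<Sum>a\<in>N'. g a * l T a) \<longlongrightarrow> (\<Sum>a\<in>N'. g a * (if v a = w then Re (\<phi> a) else 0))) at_top"
      by (intro tendsto_intros)
    moreover have "\<forall>\<^sub>F T in at_top. (\<Sum>a\<in>N'. g a * l T a) = 0"
      using eventually_gt_at_top[of 0]
    proof eventually_elim
      case (elim T)
      have "(\<Sum>a\<in>N'. g a * l T a) = (\<Sum>a\<in>N. g a * l T a)"
        using fin by (intro sum.mono_neutral_left) (auto simp: N'_def)
      also have "\<dots> = (\<Sum>a\<in>N. g a * ln (norm (1 + \<phi> a * of_real (exp (T * v a))))) / exp (T * w)"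
        by (simp add: l_def sum_divide_distrib)
      also have "\<dots> = 0" using relation_limit(2)[OF v \<phi> elim] by (simp add: N_def)
      finally show ?case .
    qed
    ultimately have "((\<lambda>T::real. 0) \<longlongrightarrow> (\<Sum>a\<in>N'. g a * (if v a = w then Re (\<phi> a) else 0))) at_top"
      by (rule Lim_transform_eventually)
    then have "(\<Sum>a\<in>N'. g a * (if v a = w then Re (\<phi> a) else 0)) = 0"
      by (simp add: tendsto_const_iff)
    also have "(\<Sum>a\<in>N'. g a * (if v a = w then Re (\<phi> a) else 0)) = (\<Sum>a\<in>M. g a * Re (\<phi> a))"
      using fin by (intro sum.mono_neutral_cong_right) (auto simp: M_def)
    finally show ?thesis .
  qed
  have MS: "M \<subseteq> S" by (auto simp: M_def N'_def N_def)
  have "g a0 = 0"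
  proof (rule symmetric_sum_eq_0)
    \<comment> \<open>Adjoining the inverses doubles the sum: they are disjoint from
      \<open>M\<close> because \<open>v\<close> changes sign.\<close>
    let ?X = "M \<union> (\<lambda>a. inv a) ` M"
    show "?X \<subseteq> S" using MS inv_S by auto
    show "inv a \<in> ?X" if "a \<in> ?X" for a using that inv_inv_S MS by auto
    show "a0 \<in> ?X" using a0 by (auto simp: M_def)
    fix \<phi> assume \<phi>: "unitary_on K \<phi>"
    have "v a < 0" if "a \<in> M" for a using that w by (auto simp: M_def)
    moreover have "v a > 0" if "a \<in> (\<lambda>a. inv a) ` M" for a using that w MS vinv by (auto simp: M_def subset_iff)
    ultimately have disj: "M \<inter> (\<lambda>a. inv a) ` M = {}" by (metis Int_emptyI less_asym)
    have inj: "inj_on (\<lambda>a. inv a) M" using MS inv_inv_S by (intro inj_on_inverseI[of _ "\<lambda>a. inv a"]) auto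
    have "finite M" using fin by (simp add: M_def)
    then have "(\<Sum>a\<in>?X. g a * Re (\<phi> a)) = (\<Sum>a\<in>M. g a * Re (\<phi> a)) + (\<Sum>a\<in>M. g (inv a) * Re (\<phi> (inv a)))"
      using disj inj by (simp add: sum.union_disjoint sum.reindex)
    also have "(\<Sum>a\<in>M. g (inv a) * Re (\<phi> (inv a))) = (\<Sum>a\<in>M. g a * Re (\<phi> a))"
      using MS S_K by (intro sum.cong) (auto simp: g_inv unitary_on_inv[OF K \<phi>] subset_iff)
    finally show "(\<Sum>a\<in>?X. g a * Re (\<phi> a)) = 0" using ReM[OF \<phi>] by simp
  qed
  then show False using a0 by (simp add: N'_def)
qed

lemma inv_S0: "a \<in> S0 \<Longrightarrow> inv a \<in> S0"
  using S_carrier inv_S by (simp add: S0_def subset_iff)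

lemma torsion_relation:
  assumes \<phi>: "unitary_on K \<phi>"
  shows "(\<Sum>a\<in>S0. g a * ln (norm (1 + \<phi> a))) = 0"
proof -
  obtain v where "additive_on K v" "\<And>a. a \<in> S - S0 \<Longrightarrow> v a \<noteq> 0" using exists_separating_additive by blast
  from relation_limit(1)[OF this \<phi>] have z: "(\<Sum>a\<in>S0. f a * ln (norm (1 + \<phi> a))) = 0" .
  from sum_inv[OF S0_subset inv_S0, of "\<lambda>a. f a * ln (norm (1 + \<phi> a))"] z
  have "(\<Sum>a\<in>S0. f (inv a) * ln (norm (1 + \<phi> (inv a)))) = 0" by simp
  moreover have "norm (1 + \<phi> (inv a)) = norm (1 + \<phi> a)" if "a \<in> S0" for a
  proof -
    have "1 + \<phi> (inv a) = cnj (1 + \<phi> a)"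
      using unitary_on_inv[OF K \<phi>, of a] that S_K by (auto simp: S0_def)
    then show ?thesis by (metis complex_mod_cnj)
  qed
  ultimately have "(\<Sum>a\<in>S0. f (inv a) * ln (norm (1 + \<phi> a))) = 0" by simp
  with z show ?thesis by (simp add: g_def distrib_right sum.distrib)
qed

lemma g_torsion_eq_0:
  assumes "a \<in> S0"
  shows "g a = 0"
proof (rule symmetric_sum_eq_0[OF S0_subset inv_S0 assms])
  fix \<phi> assume \<phi>: "unitary_on K \<phi>"
  note S0 = S0_subset finite_subset[OF S0_subset finite_S] subset_trans[OF S0_subset S_K]
    subset_trans[OF S0_subset S_carrier]
  have "ord a > 0" if "a \<in> S0" for a using that by (simp add: S0_def)
  from exists_common_multiple_order[OF S0(2,4) this]
  obtain c where c: "c \<in> carrier G" "ord c > 0" "\<forall>a\<in>S0. ord a dvd ord c" by blast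
  define n where "n = ord c"
  have n: "n \<in> O_FS" using orders[OF c(1,2)] by (simp add: n_def)
  \<comment> \<open>Periodic modulo \<open>n\<close> since \<open>ord a dvd n\<close> on
    \<open>S0\<close>, and even since \<open>\<phi>\<close> is unitary; its value at 1 is the sum in
    question.\<close>
  define h where "h m = complex_of_real (\<Sum>a\<in>S0. g a * Re (\<phi> a powi m))" for m :: int
  have nz: "\<phi> a \<noteq> 0" if "a \<in> S0" for a using \<phi> that S0 by (auto simp: unitary_on_def character_on_def)
  have "h 1 = 0"
  proof (rule even_periodic_eq_0[OF n])
    fix k
    have "\<phi> a powi int n = 1" if a: "a \<in> S0" for a
    proof -
      have ch: "character_on K \<phi>" using \<phi> by (simp add: unitary_on_def)
      have "a [^] n = \<one>" using c(3) a S0 by (auto simp: pow_eq_id n_def)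
      then have "\<phi> a ^ n = 1" using char_pow[OF K ch, of a n] char_one[OF K ch] a S0 by auto
      then show ?thesis by simp
    qed
    then show "h (k + int n) = h k" using nz by (simp add: h_def power_int_add)
    have "Re (\<phi> a powi - k) = Re (\<phi> a powi k)" if a: "a \<in> S0" for a
    proof -
      have "norm (\<phi> a) = 1" using \<phi> a S0 by (auto simp: unitary_on_def)
      then have "norm (\<phi> a powi k) = 1" by (simp add: norm_power_int)
      then have "inverse (\<phi> a powi k) = cnj (\<phi> a powi k)"
        using complex_norm_square[of "\<phi> a powi k"] by (simp add: inverse_unique)
      then show ?thesis by (simp only: power_int_minus cnj.sel)
    qed
    then show "h (- k) = h k" by (simp add: h_def)
    have \<phi>k: "unitary_on K (\<lambda>x. \<phi> x powi k)" by (rule unitary_on_power_int[OF \<phi>])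
    \<comment> \<open>The relation for the \<open>k\<close>-th power of \<open>\<phi>\<close>, again
      unitary, expanded by the logarithm series, is the series condition at
      \<open>k\<close>.\<close>
    have "(\<lambda>m. \<Sum>a\<in>S0. g a * Re ((- 1) ^ (m + 1) * (\<phi> a powi k) ^ m / of_nat m)) sums
        (\<Sum>a\<in>S0. g a * Re (Ln (1 + \<phi> a powi k)))"
    proof (intro sums_sum sums_mult sums_Re Ln_series_unit_circle)
      fix a assume a: "a \<in> S0"
      show "norm (\<phi> a powi k) = 1" using \<phi>k a S0 by (auto simp: unitary_on_def)
      have "character_on K (\<lambda>x. \<phi> x powi k)" using \<phi>k by (simp add: unitary_on_def)
      from one_plus_finite_order_neq_0[OF this a] show "\<phi> a powi k \<noteq> - 1" by (metis add.right_inverse)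
    qed
    also have "(\<Sum>a\<in>S0. g a * Re (Ln (1 + \<phi> a powi k))) = (\<Sum>a\<in>S0. g a * ln (norm (1 + \<phi> a powi k)))"
    proof (intro sum.cong refl)
      fix a assume a: "a \<in> S0"
      have "character_on K (\<lambda>x. \<phi> x powi k)" using \<phi>k by (simp add: unitary_on_def)
      from one_plus_finite_order_neq_0[OF this a]
      show "g a * Re (Ln (1 + \<phi> a powi k)) = g a * ln (norm (1 + \<phi> a powi k))" by simp
    qed
    also have "\<dots> = 0" by (rule torsion_relation[OF \<phi>k])
    also have "(\<lambda>m. \<Sum>a\<in>S0. g a * Re ((- 1) ^ (m + 1) * (\<phi> a powi k) ^ m / of_nat m))
       = (\<lambda>m. (- 1) ^ (m + 1) * (\<Sum>a\<in>S0. g a * Re (\<phi> a powi (k * int m))) / real m)"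
    proof (rule ext)
      fix m
      have eq: "Re ((- 1) ^ (m + 1) * (\<phi> a powi k) ^ m / of_nat m) = (- 1) ^ (m + 1) * Re (\<phi> a powi (k * int m)) / real m" for a
      proof -
        have "(- 1) ^ (m + 1) * (\<phi> a powi k) ^ m / of_nat m
            = of_real ((- 1) ^ (m + 1) / real m) * \<phi> a powi (k * int m)"
          by (simp add: power_int_power')
        moreover have "Re (of_real c * w) = c * Re w" for c :: real and w by simp
        ultimately show ?thesis by (simp only: times_divide_eq_left)
      qed
      show "(\<Sum>a\<in>S0. g a * Re ((- 1) ^ (m + 1) * (\<phi> a powi k) ^ m / of_nat m))
         = (- 1) ^ (m + 1) * (\<Sum>a\<in>S0. g a * Re (\<phi> a powi (k * int m))) / real m"
        unfolding eq by (simp add: sum_distrib_left sum_divide_distrib mult_ac)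
    qed
    finally have "(\<lambda>m. complex_of_real ((- 1) ^ (m + 1) * (\<Sum>a\<in>S0. g a * Re (\<phi> a powi (k * int m))) / real m)) sums of_real 0"
      by (simp only: sums_of_real_iff)
    then show "(\<lambda>m. (- 1) ^ (m + 1) * h (k * int m) / of_nat m) sums 0"
      by (simp add: h_def)
  qed
  then have "complex_of_real (\<Sum>a\<in>S0. g a * Re (\<phi> a)) = 0" unfolding h_def by simp
  then show "(\<Sum>a\<in>S0. g a * Re (\<phi> a)) = 0" by (simp only: of_real_eq_0_iff)
qed

theorem g_eq_0:
  assumes "a \<in> S"
  shows "g a = 0"
proof -
  obtain v where v: "additive_on K v" "\<And>a. a \<in> S - S0 \<Longrightarrow> v a \<noteq> 0" using exists_separating_additive by blast
  have "a \<in> S0 \<or> v a \<noteq> 0" using v(2)[of a] assms by blast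
  then consider "a \<in> S0" | "v a < 0" | "v a > 0" by linarith
  then show ?thesis
  proof cases
    case 1
    then show ?thesis by (rule g_torsion_eq_0)
  next
    case 2
    show ?thesis by (rule g_negative_eq_0[OF v(1) v(2) assms 2])
  next
    case 3
    have "v (inv a) = - v a" using additive_inv[OF K v(1)] assms S_K by blast
    then have "v (inv a) < 0" using 3 by simp
    have "g (inv a) = 0" by (rule g_negative_eq_0[OF v(1) v(2) inv_S[OF assms] \<open>v (inv a) < 0\<close>])
    then show ?thesis using g_inv[OF assms] by simp
  qed
qed

end

section \<open>Sufficiency of the condition\<close>

lemma ln_norm_prod_mset:
  fixes F :: "'a \<Rightarrow> complex"
  assumes "finite S" "set_mset A \<subseteq> S" "\<And>a. a \<in> S \<Longrightarrow> F a \<noteq> 0"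
  shows "ln (norm (\<Prod>a\<in>#A. F a)) = (\<Sum>a\<in>S. real (count A a) * ln (norm (F a)))"
  using assms(2)
proof (induction A)
  case (add x A)
  have x: "x \<in> S" using add by simp
  have "(\<Prod>a\<in>#A. F a) \<noteq> 0" using add assms(3) by (auto simp: prod_mset_zero_iff)
  then have "ln (norm (\<Prod>a\<in>#add_mset x A. F a)) = ln (norm (F x)) + (\<Sum>a\<in>S. real (count A a) * ln (norm (F a)))"
    using add x assms(3) by (simp add: norm_mult ln_mult)
  also have "ln (norm (F x)) = (\<Sum>a\<in>S. if a = x then ln (norm (F a)) else 0)"
    using assms(1) x by simp
  also have "\<dots> + (\<Sum>a\<in>S. real (count A a) * ln (norm (F a)))
      = (\<Sum>a\<in>S. real (count (add_mset x A) a) * ln (norm (F a)))"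
    unfolding sum.distrib[symmetric] by (rule sum.cong) (auto simp: algebra_simps)
  finally show ?case .
qed simp

context comm_group
begin

lemma FS_subgroup_closed:
  "subgroup K G \<Longrightarrow> set_mset A \<subseteq> K \<Longrightarrow> set_mset (FS G A) \<subseteq> K"
proof (induction A)
  case (add a A)
  then have "a \<in> carrier G" "set_mset A \<subseteq> carrier G" using subgroup.subset[OF add.prems(1)] by auto
  then show ?case using add by (auto simp: FS_add_mset subgroup.m_closed)
qed (simp add: FS_empty subgroup.one_closed)

text \<open>Expanding the product gives one summand per subset, so equal \<open>FS\<close> yield
  equal products for every character.\<close>

lemma character_FS:
  assumes K: "subgroup K G" and \<phi>: "character_on K \<phi>" and A: "set_mset A \<subseteq> K"
  shows "(\<Sum>y\<in>#FS G A. \<phi> y) = (\<Prod>a\<in>#A. 1 + \<phi> a)"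
  using A
proof (induction A)
  case (add a A)
  then have a: "a \<in> K" and A: "set_mset A \<subseteq> K" by auto
  then have cl: "a \<in> carrier G" "set_mset A \<subseteq> carrier G" using subgroup.subset[OF K] by auto
  have "image_mset (\<lambda>x. \<phi> (a \<otimes> x)) (FS G A) = image_mset (\<lambda>x. \<phi> a * \<phi> x) (FS G A)"
    using FS_subgroup_closed[OF K A] a by (intro image_mset_cong) (auto simp: char_mult[OF K \<phi>])
  then have "(\<Sum>x\<in>#FS G A. \<phi> (a \<otimes> x)) = \<phi> a * (\<Sum>x\<in>#FS G A. \<phi> x)"
    by (simp add: sum_mset_distrib_left)
  then show ?case using add.IH[OF A] cl
    by (simp add: FS_add_mset multiset.map_comp o_def distrib_right)
qed (simp add: FS_empty char_one[OF K \<phi>])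

lemma count_image_inv:
  assumes "set_mset B \<subseteq> carrier G" "x \<in> carrier G"
  shows "count (image_mset (m_inv G) B) x = count B (inv x)"
  using assms(1)
proof (induction B)
  case (add b B)
  then have "inv b = x \<longleftrightarrow> b = inv x" using assms(2) by auto
  then show ?case using add by simp
qed simp

lemma FS_eq_imp_sim0:
  assumes orders: "\<And>a. a \<in> carrier G \<Longrightarrow> ord a > 0 \<Longrightarrow> ord a \<in> O_FS"
    and A: "set_mset A \<subseteq> carrier G" and A': "set_mset A' \<subseteq> carrier G" and eq: "FS G A = FS G A'"
  shows "sim0 G A A'"
proof -
  let ?T = "set_mset A \<union> set_mset A'"
  define S where "S = ?T \<union> (\<lambda>a. inv a) ` ?T"
  define f where "f a = real (count A a) - real (count A' a)" for a
  have finS: "finite S" and S: "S \<subseteq> carrier G" using A A' by (auto simp: S_def)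
  have invS: "inv a \<in> S" if "a \<in> S" for a
    using that A A' by (auto simp: S_def image_iff)
  interpret FS_relation G S f
  proof
    fix \<phi> assume \<phi>: "character_on (generate G S) \<phi>" and nz: "\<And>a. a \<in> S \<Longrightarrow> 1 + \<phi> a \<noteq> 0"
    note K = generate_is_subgroup[OF S]
    have TS: "set_mset A \<subseteq> S" "set_mset A' \<subseteq> S" by (auto simp: S_def)
    have SK: "S \<subseteq> generate G S" by (rule subsetI) (rule generate.incl)
    have "(\<Prod>a\<in>#A. 1 + \<phi> a) = (\<Prod>a\<in>#A'. 1 + \<phi> a)"
      using eq character_FS[OF K \<phi> subset_trans[OF TS(1) SK]] character_FS[OF K \<phi> subset_trans[OF TS(2) SK]]
      by simp
    then have "(\<Sum>a\<in>S. real (count A a) * ln (norm (1 + \<phi> a))) = (\<Sum>a\<in>S. real (count A' a) * ln (norm (1 + \<phi> a)))"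
      using ln_norm_prod_mset[OF finS TS(1), of "\<lambda>a. 1 + \<phi> a"] ln_norm_prod_mset[OF finS TS(2), of "\<lambda>a. 1 + \<phi> a"] nz
      by simp
    then show "(\<Sum>a\<in>S. f a * ln (norm (1 + \<phi> a))) = 0"
      by (simp add: f_def left_diff_distrib sum_subtractf)
  qed (use finS S invS orders in blast)+
  have symm: "count A x + count A (inv x) = count A' x + count A' (inv x)" if x: "x \<in> carrier G" for x
  proof (cases "x \<in> S")
    case True
    from g_eq_0[OF True] have "real (count A x + count A (inv x)) = real (count A' x + count A' (inv x))"
      by (simp add: g_def f_def)
    then show ?thesis by (simp only: of_nat_eq_iff)
  next
    case False
    then have "inv x \<notin> S" using invS[of "inv x"] x by auto
    then show ?thesis using False by (simp add: S_def not_in_iff)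
  qed
  \<comment> \<open>By \<open>symm\<close> the surplus of \<open>A\<close> at \<open>inv x\<close>
    equals the surplus of \<open>A'\<close> at \<open>x\<close>, so inverting \<open>B\<close>
    supplies exactly what the common part \<open>A - B\<close> lacks.\<close>
  define B where "B = A - A'"
  have B: "B \<subseteq># A" "set_mset B \<subseteq> carrier G" "set_mset (A - B) \<subseteq> carrier G"
    using A by (auto simp: B_def dest: in_diffD)
  have A'_eq: "A' = (A - B) + image_mset (m_inv G) B"
  proof (rule multiset_eqI)
    fix x
    show "count A' x = count ((A - B) + image_mset (m_inv G) B) x"
    proof (cases "x \<in> carrier G")
      case True
      then show ?thesis using symm[OF True] count_image_inv[OF B(2) True] by (simp add: B_def)
    next
      case False
      then have "x \<notin># A'" "x \<notin># A - B" "x \<notin># image_mset (m_inv G) B" using A' B by auto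
      then show ?thesis by (simp only: not_in_iff count_union)
    qed
  qed
  \<comment> \<open>\<open>FS G A\<close> is invariant under translation by \<open>c\<close>, so \<open>c\<close> has order a power of two.\<close>
  define c where "c = inv (msum G B)"
  have c: "c \<in> carrier G" using msum_closed[OF B(2)] by (simp add: c_def)
  have "FS G A = image_mset ((\<otimes>) c) (FS G A)"
    using FS_plus_inverses[OF B(3,2)] B(1) eq by (simp add: A'_eq[symmetric] c_def)
  then have "msum G (FS G A) = c [^] size (FS G A) \<otimes> msum G (FS G A)"
    using msum_translate[OF c FS_closed[OF A]] by simp
  then have "c [^] (2 ^ size A :: nat) = \<one>"
    using msum_closed[OF FS_closed[OF A]] c by (simp add: size_FS)
  then have dvd: "ord c dvd 2 ^ size A" using c by (simp add: pow_eq_id)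
  then have "ord c > 0" by (auto intro!: gr0I)
  then have "odd (ord c)" using orders[OF c] by (simp add: O_FS_def)
  then have "coprime (ord c) (2 ^ size A)" by simp
  from coprime_common_divisor[OF this dvd_refl dvd] have "ord c = 1" by simp
  then have "c = \<one>" using ord_eq_1[OF c] by blast
  then have "msum G B = \<one>" using msum_closed[OF B(2)] by (simp add: c_def)
  then show ?thesis using B(1) A'_eq unfolding sim0_def by blast
qed

end

theorem theorem1p4:
  fixes G :: "('a, 'b) monoid_scheme"
  assumes "comm_group G"
  shows "FS_regular G \<longleftrightarrow>
    (\<forall>g\<in>carrier G. (\<exists>n::nat. n > 0 \<and> g [^]\<^bsub>G\<^esub> n = \<one>\<^bsub>G\<^esub>) \<longrightarrow> group.ord G g \<in> O_FS)"
proof -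
  interpret comm_group G by fact
  \<comment> \<open>\<open>ord g\<close> is 0 precisely for elements of infinite order.\<close>
  have fin: "(\<exists>n::nat. n > 0 \<and> g [^]\<^bsub>G\<^esub> n = \<one>\<^bsub>G\<^esub>) \<longleftrightarrow> ord g > 0" if g: "g \<in> carrier G" for g
  proof
    assume "\<exists>n::nat. n > 0 \<and> g [^]\<^bsub>G\<^esub> n = \<one>\<^bsub>G\<^esub>"
    then obtain n :: nat where "n > 0" "ord g dvd n" using g by (auto simp: pow_eq_id)
    then show "ord g > 0" by (auto intro!: gr0I)
  next
    assume "ord g > 0"
    then show "\<exists>n::nat. n > 0 \<and> g [^]\<^bsub>G\<^esub> n = \<one>\<^bsub>G\<^esub>" using g by (intro exI[of _ "ord g"]) simp
  qed
  show ?thesis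
  proof
    assume "FS_regular G"
    then show "\<forall>g\<in>carrier G. (\<exists>n::nat. n > 0 \<and> g [^]\<^bsub>G\<^esub> n = \<one>\<^bsub>G\<^esub>) \<longrightarrow> ord g \<in> O_FS"
      using FS_regular_imp_O_FS fin by blast
  next
    assume "\<forall>g\<in>carrier G. (\<exists>n::nat. n > 0 \<and> g [^]\<^bsub>G\<^esub> n = \<one>\<^bsub>G\<^esub>) \<longrightarrow> ord g \<in> O_FS"
    then have orders: "ord a \<in> O_FS" if "a \<in> carrier G" "ord a > 0" for a using that fin by blast
    then show "FS_regular G"
      unfolding FS_regular_def using FS_eq_imp_sim0[OF orders] sim0_imp_FS_eq by blast
  qed
qed

end
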